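(* Let $a\in\mathbb{R}^n$ and $\mathbb{B}(a,r)=\{x\in\mathbb{R}^n:|x-a|<r\}$. Then, for every weakly positive current $T$ of bidimension $(p,p)$ on $\mathbb{R}^n\times\mathbb{R}^n$ such that $T\wedge\beta^{p-1}$ is convex, the positive function $$\nu_T(a,\cdot):r\longmapsto\frac{1}{r^p}\int_{\mathbb{B}(a,r)\times\mathbb{R}^n}T\wedge\beta^p$$ is increasing with respect to $r$. In particular, the limit $\nu_T(a):=\lim_{r\to0}\nu_T(a,r)$ exists (it is called the Lelong number of $T$ at $a$).
   Context: Superformalism. On $\mathbb{R}^n\times\mathbb{R}^n$ with coordinates $(x,\xi)$, a form of bidegree $(p,q)$ is $\sum_{|K|=p,|L|=q}\alpha_{KL}(x)\,dx_K\wedge d\xi_L$ with smooth coefficients depending only on $x$; $dx_i,d\xi_j$ all anticommute. $d=\sum_i dx_i\wedge\partial_{x_i}$, $d^{\#}=\sum_j d\xi_j\wedge\partial_{x_j}$, $\beta=\frac12dd^{\#}|x|^2=\sum_i dx_i\wedge d\xi_i$. For $\alpha=\sum_i a_i\,dx_i$ put $J(\alpha)=\sum_i a_i\,d\xi_i$. The integral of $\alpha_0(x)\,dx_1\wedge d\xi_1\wedge\dots\wedge dx_n\wedge d\xi_n$ over $A\times\mathbb{R}^n$ is $\int_A\alpha_0\,dx$ (similarly for measures). Currents. A current of bidegree $(p,q)$ is $T=\sum_{|I|=p,|J|=q}T_{IJ}\,dx_I\wedge d\xi_J$ with $T_{IJ}$ distributions in $x$; it acts on forms of bidegree $(n-p,n-q)$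 with compactly supported coefficients by $\langle T,\alpha\rangle=\int T\wedge\alpha$. Bidimension $(p,p)$ means bidegree $(n-p,n-p)$. A current of bidegree $(k,k)$ is symmetric if $T_{IJ}=T_{JI}$. A form of bidegree $(k,k)$ is strongly positive if it is a finite sum $\sum_s\lambda_s\alpha_{1,s}\wedge J(\alpha_{1,s})\wedge\dots\wedge\alpha_{k,s}\wedge J(\alpha_{k,s})$, $\lambda_s\ge0$, $\alpha_{i,s}$ of bidegree $(1,0)$. A symmetric current of bidimension $(p,p)$ is weakly positive if it is $\ge0$ on all compactly supported strongly positive forms of bidegree $(p,p)$; its coefficients are then measures. A current $S$ is convex if $dd^{\#}S$ is weakly positive. "Positive" means $\ge0$ and "increasing" is in the wide sense. *)

theory Defs
  imports "HOL-Analysis.Analysis"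
begin

section \<open>Smooth functions, test functions, distributions on \<open>real ^ 'n\<close>\<close>

definition partial :: "'n::finite \<Rightarrow> (real ^ 'n \<Rightarrow> real) \<Rightarrow> real ^ 'n \<Rightarrow> real" where
  "partial i f x = frechet_derivative f (at x) (axis i 1)"

primrec partials :: "'n::finite list \<Rightarrow> (real ^ 'n \<Rightarrow> real) \<Rightarrow> real ^ 'n \<Rightarrow> real" where
  "partials [] f = f"
| "partials (i # is) f = partial i (partials is f)"

definition smooth :: "(real ^ 'n::finite \<Rightarrow> real) \<Rightarrow> bool" where
  "smooth f \<longleftrightarrow> (\<forall>is x. partials is f differentiable (at x))"

definition supp :: "(real ^ 'n::finite \<Rightarrow> real) \<Rightarrow> (real ^ 'n) set" where
  "supp f = closure {x. f x \<noteq> 0}"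

definition test_fun :: "(real ^ 'n::finite \<Rightarrow> real) \<Rightarrow> bool" where
  "test_fun \<phi> \<longleftrightarrow> smooth \<phi> \<and> compact (supp \<phi>)"

text \<open>
  A distribution is a functional on all functions of which only the values on test functions
  matter; in particular, two distributions are equal when they agree on test functions.
\<close>

type_synonym 'n functional = "(real ^ 'n \<Rightarrow> real) \<Rightarrow> real"

definition distribution :: "'n::finite functional \<Rightarrow> bool" where
  "distribution u \<longleftrightarrow>
     (\<forall>\<phi> \<psi>. test_fun \<phi> \<longrightarrow> test_fun \<psi> \<longrightarrow> u (\<lambda>x. \<phi> x + \<psi> x) = u \<phi> + u \<psi>) \<and>
     (\<forall>c \<phi>. test_fun \<phi> \<longrightarrow> u (\<lambda>x. c * \<phi> x) = c * u \<phi>) \<and>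
     (\<forall>K. compact K \<longrightarrow>
        (\<exists>C N. \<forall>\<phi>. test_fun \<phi> \<longrightarrow> supp \<phi> \<subseteq> K \<longrightarrow>
           \<bar>u \<phi>\<bar> \<le> C * (\<Sum>is | length is \<le> N. SUP x. \<bar>partials is \<phi> x\<bar>)))"

definition partial_distr :: "'n::finite \<Rightarrow> 'n functional \<Rightarrow> 'n functional" where
  "partial_distr i u \<phi> = - u (partial i \<phi>)"


section \<open>Superforms\<close>

text \<open>
  Coefficients are indexed by pairs of sets: \<open>\<alpha> K L\<close> is the coefficient of
  $dx_K \wedge d\xi_L$, where $dx_K = dx_{k_1} \wedge \dots \wedge dx_{k_p}$ for
  $K = \{k_1 < \dots < k_p\}$.
\<close>

type_synonym 'n superform = "'n set \<Rightarrow> 'n set \<Rightarrow> real ^ 'n \<Rightarrow> real"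

definition is_form :: "nat \<Rightarrow> nat \<Rightarrow> 'n::{finite,linorder} superform \<Rightarrow> bool" where
  "is_form p q \<alpha> \<longleftrightarrow>
     (\<forall>K L. smooth (\<alpha> K L)) \<and>
     (\<forall>K L. \<not> (card K = p \<and> card L = q) \<longrightarrow> (\<forall>x. \<alpha> K L x = 0))"

definition compactly_supported :: "'n::{finite,linorder} superform \<Rightarrow> bool" where
  "compactly_supported \<alpha> \<longleftrightarrow> (\<forall>K L. compact (supp (\<alpha> K L)))"

text \<open>
  For disjoint \<open>I\<close> and \<open>J\<close>, $dx_I \wedge dx_J = \pm dx_{I \cup J}$, with the sign given by the
  number of inversions; and
  $(dx_I \wedge d\xi_J) \wedge (dx_K \wedge d\xi_L) =
   (-1)^{|J| |K|} (dx_I \wedge dx_K) \wedge (d\xi_J \wedge d\xi_L)$.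
\<close>

definition merge_sign :: "'n::{finite,linorder} set \<Rightarrow> 'n set \<Rightarrow> real" where
  "merge_sign I J = (- 1) ^ card {(i, j). i \<in> I \<and> j \<in> J \<and> j < i}"

definition wedge_sign :: "'n::{finite,linorder} set \<Rightarrow> 'n set \<Rightarrow> 'n set \<Rightarrow> 'n set \<Rightarrow> real" where
  "wedge_sign I J K L = (- 1) ^ (card J * card K) * merge_sign I K * merge_sign J L"

definition wedge ::
  "'n::{finite,linorder} superform \<Rightarrow> 'n superform \<Rightarrow> 'n superform" (infixr \<open>\<and>\<^sub>f\<close> 70) where
  "(\<alpha> \<and>\<^sub>f \<gamma>) M N x =
     (\<Sum>I\<in>Pow M. \<Sum>J\<in>Pow N. wedge_sign I J (M - I) (N - J) * (\<alpha> I J x * \<gamma> (M - I) (N - J) x))"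

definition one_form :: "'n::{finite,linorder} superform" where
  "one_form K L x = (if K = {} \<and> L = {} then 1 else 0)"

definition dx :: "'n::{finite,linorder} \<Rightarrow> 'n superform" where
  "dx i K L x = (if K = {i} \<and> L = {} then 1 else 0)"

definition dxi :: "'n::{finite,linorder} \<Rightarrow> 'n superform" where
  "dxi j K L x = (if K = {} \<and> L = {j} then 1 else 0)"

definition wedge_list :: "'n::{finite,linorder} superform list \<Rightarrow> 'n superform" where
  "wedge_list \<alpha>s = foldr (\<and>\<^sub>f) \<alpha>s one_form"

definition wedge_power :: "'n::{finite,linorder} superform \<Rightarrow> nat \<Rightarrow> 'n superform" where
  "wedge_power \<alpha> k = wedge_list (replicate k \<alpha>)"

definition beta :: "'n::{finite,linorder} superform" where
  "beta K L x = (\<Sum>i\<in>UNIV. (dx i \<and>\<^sub>f dxi i) K L x)"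

text \<open>$dx_1 \wedge d\xi_1 \wedge \dots \wedge dx_n \wedge d\xi_n$, which differs from
  $dx_1 \wedge \dots \wedge dx_n \wedge d\xi_1 \wedge \dots \wedge d\xi_n$ by the sign
  $(-1)^{n(n-1)/2}$\<close>

definition volume_form :: "'n::{finite,linorder} superform" where
  "volume_form = wedge_list (map (\<lambda>i. dx i \<and>\<^sub>f dxi i) (sorted_list_of_set UNIV))"

text \<open>The operator $J$ on forms of bidegree $(1,0)$\<close>

definition J_op :: "'n::{finite,linorder} superform \<Rightarrow> 'n superform" where
  "J_op \<alpha> K L x = (if K = {} then \<alpha> L {} x else 0)"

text \<open>The factors $\lambda_s \ge 0$ are functions: with constants only, no nonzero form of bidegree
  $(0,0)$ would be both strongly positive and compactly supported.\<close>

definition strongly_positive :: "nat \<Rightarrow> 'n::{finite,linorder} superform \<Rightarrow> bool" where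
  "strongly_positive k \<alpha> \<longleftrightarrow>
     (\<exists>(m::nat) (l :: nat \<Rightarrow> real ^ 'n::{finite,linorder} \<Rightarrow> real) (a :: nat \<Rightarrow> nat \<Rightarrow> 'n superform).
        (\<forall>s<m. smooth (l s) \<and> (\<forall>x. 0 \<le> l s x)) \<and>
        (\<forall>s<m. \<forall>i<k. is_form 1 0 (a s i)) \<and>
        \<alpha> = (\<lambda>K L x. \<Sum>s<m. l s x * wedge_list (map (\<lambda>i. a s i \<and>\<^sub>f J_op (a s i)) [0..<k]) K L x))"


section \<open>Currents\<close>

type_synonym 'n current = "'n set \<Rightarrow> 'n set \<Rightarrow> 'n functional"

definition is_current :: "nat \<Rightarrow> nat \<Rightarrow> 'n::{finite,linorder} current \<Rightarrow> bool" where
  "is_current p q T \<longleftrightarrow>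
     (\<forall>I J. distribution (T I J)) \<and>
     (\<forall>I J. \<not> (card I = p \<and> card J = q) \<longrightarrow> (\<forall>\<phi>. test_fun \<phi> \<longrightarrow> T I J \<phi> = 0))"

definition symmetric_current :: "'n::{finite,linorder} current \<Rightarrow> bool" where
  "symmetric_current T \<longleftrightarrow> (\<forall>I J \<phi>. test_fun \<phi> \<longrightarrow> T I J \<phi> = T J I \<phi>)"

definition current_wedge ::
  "'n::{finite,linorder} current \<Rightarrow> 'n superform \<Rightarrow> 'n current" (infixl \<open>\<and>\<^sub>c\<close> 70) where
  "(T \<and>\<^sub>c \<alpha>) M N \<phi> =
     (\<Sum>I\<in>Pow M. \<Sum>J\<in>Pow N.
        wedge_sign I J (M - I) (N - J) * T I J (\<lambda>x. \<alpha> (M - I) (N - J) x * \<phi> x))"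

definition form_wedge_current ::
  "'n::{finite,linorder} superform \<Rightarrow> 'n current \<Rightarrow> 'n current" where
  "form_wedge_current \<alpha> T M N \<phi> =
     (\<Sum>I\<in>Pow M. \<Sum>J\<in>Pow N.
        wedge_sign I J (M - I) (N - J) * T (M - I) (N - J) (\<lambda>x. \<alpha> I J x * \<phi> x))"

definition d_current :: "'n::{finite,linorder} current \<Rightarrow> 'n current" where
  "d_current T M N \<phi> =
     (\<Sum>i\<in>UNIV. form_wedge_current (dx i) (\<lambda>I J. partial_distr i (T I J)) M N \<phi>)"

definition d_sharp_current :: "'n::{finite,linorder} current \<Rightarrow> 'n current" where
  "d_sharp_current T M N \<phi> =
     (\<Sum>j\<in>UNIV. form_wedge_current (dxi j) (\<lambda>I J. partial_distr j (T I J)) M N \<phi>)"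

text \<open>The distribution $T_0$ such that the top-degree part of \<open>T\<close> is
  $T_0\, dx_1 \wedge d\xi_1 \wedge \dots \wedge dx_n \wedge d\xi_n$
  (\<open>volume_form\<close> has constant coefficients)\<close>

definition top_distr :: "'n::{finite,linorder} current \<Rightarrow> 'n functional" where
  "top_distr T \<phi> = T UNIV UNIV \<phi> / (volume_form :: 'n superform) UNIV UNIV 0"

text \<open>$\langle T, \alpha\rangle = \int T \wedge \alpha$. For compactly supported \<open>\<alpha>\<close> the integral of
  $T \wedge \alpha$ is its value on the constant function 1, which only involves the values of the
  coefficients of \<open>T\<close> on the coefficients of \<open>\<alpha>\<close>.\<close>

definition pairing :: "'n::{finite,linorder} current \<Rightarrow> 'n superform \<Rightarrow> real" where
  "pairing T \<alpha> = top_distr (T \<and>\<^sub>c \<alpha>) (\<lambda>_. 1)"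

text \<open>The first argument is the dimension: \<open>T\<close> has bidimension \<open>(p, p)\<close>, i.e. bidegree
  \<open>(n - p, n - p)\<close>.\<close>

definition weakly_positive :: "nat \<Rightarrow> 'n::{finite,linorder} current \<Rightarrow> bool" where
  "weakly_positive p T \<longleftrightarrow>
     p \<le> CARD('n) \<and> is_current (CARD('n) - p) (CARD('n) - p) T \<and> symmetric_current T \<and>
     (\<forall>\<alpha>. strongly_positive p \<alpha> \<longrightarrow> compactly_supported \<alpha> \<longrightarrow> 0 \<le> pairing T \<alpha>)"

text \<open>For \<open>S\<close> of bidimension \<open>(p, p)\<close>, $dd^{\#}S$ has bidimension \<open>(p - 1, p - 1)\<close>
  (for \<open>p = 0\<close> it vanishes).\<close>

definition convex_current :: "nat \<Rightarrow> 'n::{finite,linorder} current \<Rightarrow> bool" where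
  "convex_current p S \<longleftrightarrow>
     p \<le> CARD('n) \<and> is_current (CARD('n) - p) (CARD('n) - p) S \<and>
     weakly_positive (p - 1) (d_current (d_sharp_current S))"


section \<open>Integration of positive top-degree currents\<close>

definition represents :: "(real ^ 'n::finite) measure \<Rightarrow> 'n functional \<Rightarrow> bool" where
  "represents \<mu> u \<longleftrightarrow>
     sets \<mu> = sets borel \<and> (\<forall>K. compact K \<longrightarrow> emeasure \<mu> K < \<infinity>) \<and>
     (\<forall>\<phi>. test_fun \<phi> \<longrightarrow> u \<phi> = integral\<^sup>L \<mu> \<phi>)"

text \<open>The integral over $A \times \mathbb{R}^n$ (\<open>A\<close> bounded and Borel) of a current of bidegree
  \<open>(n, n)\<close> whose coefficient is a positive measure; that measure is unique, and it exists for
  every weakly positive current of bidegree \<open>(n, n)\<close>.\<close>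

definition super_integral :: "(real ^ 'n::{finite,linorder}) set \<Rightarrow> 'n current \<Rightarrow> real" where
  "super_integral A T = measure (THE \<mu>. represents \<mu> (top_distr T)) A"

definition nu :: "nat \<Rightarrow> 'n::{finite,linorder} current \<Rightarrow> real ^ 'n::{finite,linorder} \<Rightarrow> real \<Rightarrow> real" where
  "nu p T a r = 1 / r ^ p * super_integral (ball a r) (T \<and>\<^sub>c wedge_power beta p)"

definition lelong_number :: "nat \<Rightarrow> 'n::{finite,linorder} current \<Rightarrow> real ^ 'n::{finite,linorder} \<Rightarrow> real" where
  "lelong_number p T a = Lim (at_right 0) (nu p T a)"

end

theory Submission
  imports Defs "HOL-Computational_Algebra.Polynomial"
begin

text \<open>Write $t = |x - a|^2$, $\omega = y \wedge J(y)$ with $y = \sum_i (x_i - a_i)\, dx_i$, and let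
$\sigma = T \wedge \beta^p$. For a function $\chi$ of one variable,
$dd^{\#}\chi(t) = 4 \chi''(t)\, \omega + 2 \chi'(t)\, \beta$, so convexity of
$T \wedge \beta^{p-1}$, tested on $\chi(t) \ge 0$, bounds $\int -\chi'(t)\, d\sigma$ by
$2 \int \chi''(t)\, T \wedge \beta^{p-1} \wedge \omega$ (\<open>convex_current_test\<close>). The exponent
$p$ enters through the positivity of $T$. By Lagrange's identity $t\beta - \omega = \frac12\tau$, where
$\tau$ is a sum of terms $w \wedge J(w)$; since $\omega^2 = 0$, the binomial formula gives
\[ p\, t^{p-1} \beta^{p-1} \wedge \omega = t^p \beta^p - 2^{-p} \tau^p, \]
and $T$ is nonnegative on $\tau^p$ (\<open>kaehler_power_decomposition\<close>). So, if $\chi'' \ge 0$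
contains the factor $t^{p-1}$, then $T \wedge \beta^{p-1} \wedge \omega$ may be estimated by
$\frac{t}{p} \sigma$ from above.

With $e(s) = \exp(-1/s)$ for $s > 0$ and $e(s) = 0$ otherwise, the choice $-\chi'(t) = e(c - m t^p)$
has this property, and yields
\[ \int e(c - m t^p)\, d\sigma \le 2 m \int t^p\, e'(c - m t^p)\, d\sigma \]
(\<open>radial_inequality\<close>). This says that $\sqrt m \int e(c - m t^p)\, d\sigma$ has a nonpositive
derivative in $m$ (\<open>sqrt_integral_decreasing\<close>). Take $c = k$ and $m = k / r^{2p}$, so that
$\sqrt m$ is a multiple of $r^{-p}$ and $e(c - m t^p) = e(k (1 - (|x - a| / r)^{2p}))$ increases to
the indicator function of the ball of radius $r$ as $k \to \infty$: the limit is the monotonicity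
of $\nu_T(a, r)$, and a monotone nonnegative function has a limit at $0$.

Two tools are built along the way. Forms of even total degree at a point make up a commutative
algebra, in which the identities above are computations in a ring. And the mass of a ball only makes sense
once $\sigma$ is known to be given by exactly one measure, so the Riesz representation theorem is
proved for functionals on test functions (\<open>functional_measure_represents\<close>,
\<open>represents_unique\<close>).\<close>

section \<open>Smooth functions\<close>

lemma partial_eqI: "(f has_derivative D) (at x) \<Longrightarrow> partial i f x = D (axis i 1)"
  unfolding partial_def by (metis frechet_derivative_at)

lemma partials_partial: "partials is (partial i f) = partials (is @ [i]) f"
  by (induction "is") auto

lemma smooth_differentiable: "smooth f \<Longrightarrow> f differentiable (at x)"
  unfolding smooth_def by (metis partials.simps(1))

lemma smooth_partial: "smooth f \<Longrightarrow> smooth (partial i f)"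
  unfolding smooth_def partials_partial by blast

text \<open>Smoothness is the largest property that implies differentiability and passes to partial
derivatives. This is how closure properties are proved below: it is enough to find a class of
functions that is visibly closed under partial derivatives.\<close>

lemma smooth_coinduct:
  assumes "X f"
    and "\<And>f x. X f \<Longrightarrow> f differentiable (at x)"
    and "\<And>f i. X f \<Longrightarrow> X (partial i f)"
  shows "smooth f"
proof -
  have "X (partials is f)" for "is"
    by (induction "is") (use assms in auto)
  then show ?thesis
    unfolding smooth_def using assms(2) by blast
qed

lemma smooth_from_partials:
  assumes "\<And>x. f differentiable (at x)" and "\<And>i. smooth (partial i f)"
  shows "smooth f"
  by (rule smooth_coinduct[where X = "\<lambda>g. g = f \<or> smooth g"])
     (use assms in \<open>auto intro: smooth_differentiable smooth_partial\<close>)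

text \<open>The derivative of $P(1/s)\, e^{-1/s}$ has the same shape with another polynomial $P$, so this family
contains the function $e^{-1/s}$ together with all its derivatives.\<close>

definition flat :: "real poly \<Rightarrow> real \<Rightarrow> real" where
  "flat P s = (if s > 0 then poly P (inverse s) * exp (- inverse s) else 0)"

lemma flat_nonpos [simp]: "s \<le> 0 \<Longrightarrow> flat P s = 0"
  by (simp add: flat_def)

lemma tendsto_poly_exp_0: "((\<lambda>u. poly P u * exp (- u)) \<longlongrightarrow> 0) (at_top :: real filter)"
proof -
  have "((\<lambda>u. \<Sum>i\<le>degree P. coeff P i * (u ^ i / exp u)) \<longlongrightarrow> (\<Sum>i\<le>degree P. coeff P i * 0)) at_top"
    by (intro tendsto_sum tendsto_mult tendsto_const tendsto_power_div_exp_0)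
  moreover have "(\<lambda>u. \<Sum>i\<le>degree P. coeff P i * (u ^ i / exp u)) = (\<lambda>u. poly P u * exp (- u))"
    by (simp add: poly_altdef exp_minus field_simps sum_distrib_left)
  ultimately show ?thesis by simp
qed

lemma flat_DERIV:
  "(flat P has_real_derivative flat ([:0, 0, 1:] * (P - pderiv P)) s) (at s)"
proof -
  consider "s > 0" | "s < 0" | "s = 0" by linarith
  then show ?thesis
  proof cases
    case 1
    have "((\<lambda>s. poly P (inverse s) * exp (- inverse s)) has_real_derivative
             flat ([:0, 0, 1:] * (P - pderiv P)) s) (at s)"
      using 1 by (auto intro!: derivative_eq_intros DERIV_chain2[OF poly_DERIV]
          simp: flat_def field_simps power2_eq_square)
    then show ?thesis
      by (rule has_field_derivative_transform_within_open[where S = "{0<..}"])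
         (use 1 in \<open>auto simp: flat_def\<close>)
  next
    case 2
    have "((\<lambda>s. 0) has_real_derivative flat ([:0, 0, 1:] * (P - pderiv P)) s) (at s)"
      using 2 by simp
    then show ?thesis
      by (rule has_field_derivative_transform_within_open[where S = "{..<0}"]) (use 2 in auto)
  next
    case 3
    have left: "((\<lambda>h. flat P h / h) \<longlongrightarrow> 0) (at_left 0)"
    proof (rule Lim_transform_eventually[OF tendsto_const])
      show "\<forall>\<^sub>F h in at_left 0. 0 = flat P h / h"
        by (auto simp: eventually_at_filter flat_def)
    qed
    have "((\<lambda>h. poly ([:0, 1:] * P) (inverse h) * exp (- inverse h)) \<longlongrightarrow> 0) (at_right (0::real))"
      by (rule filterlim_compose[OF tendsto_poly_exp_0 filterlim_inverse_at_top_right])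
    then have right: "((\<lambda>h. flat P h / h) \<longlongrightarrow> 0) (at_right 0)"
      by (rule Lim_transform_eventually)
         (auto simp: eventually_at_filter flat_def field_simps)
    have "((\<lambda>h. flat P h / h) \<longlongrightarrow> 0) (at 0)"
      by (rule filterlim_split_at[OF left right])
    then show ?thesis
      using 3 by (simp add: has_field_derivative_iff)
  qed
qed

text \<open>By the sum, product and chain rules, a partial derivative of such an expression is again such an
expression. Smoothness of all of them follows by a single coinduction.\<close>

inductive smooth_expr :: "(real ^ 'n::finite \<Rightarrow> real) \<Rightarrow> bool" where
  "smooth f \<Longrightarrow> smooth_expr f"
| "smooth_expr f \<Longrightarrow> smooth_expr g \<Longrightarrow> smooth_expr (\<lambda>x. f x + g x)"
| "smooth_expr f \<Longrightarrow> smooth_expr g \<Longrightarrow> smooth_expr (\<lambda>x. f x * g x)"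
| "smooth_expr f \<Longrightarrow> smooth_expr (\<lambda>x. flat P (f x))"

lemma has_derivative_partial:
  "f differentiable (at x) \<Longrightarrow> (f has_derivative frechet_derivative f (at x)) (at x)"
  by (simp add: frechet_derivative_works)

lemma partial_add:
  assumes "f differentiable (at x)" "g differentiable (at x)"
  shows "partial i (\<lambda>x. f x + g x) x = partial i f x + partial i g x"
  unfolding partial_def[of i f] partial_def[of i g]
  by (rule partial_eqI) (intro has_derivative_add has_derivative_partial assms)

lemma partial_mult:
  assumes "f differentiable (at x)" "g differentiable (at x)"
  shows "partial i (\<lambda>x. f x * g x) x = f x * partial i g x + partial i f x * g x"
  unfolding partial_def[of i f] partial_def[of i g]
  by (rule partial_eqI) (intro has_derivative_mult has_derivative_partial assms)

lemma partial_compose: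
  assumes "f differentiable (at x)" "(g has_real_derivative g') (at (f x))"
  shows "partial i (\<lambda>x. g (f x)) x = g' * partial i f x"
    and "(\<lambda>x. g (f x)) differentiable (at x)"
proof -
  have D: "((\<lambda>x. g (f x)) has_derivative (\<lambda>h. g' * frechet_derivative f (at x) h)) (at x)"
    by (rule has_derivative_compose[OF has_derivative_partial[OF assms(1)]
          assms(2)[unfolded has_field_derivative_def]])
  show "partial i (\<lambda>x. g (f x)) x = g' * partial i f x"
    unfolding partial_def[of i f] by (rule partial_eqI[OF D])
  show "(\<lambda>x. g (f x)) differentiable (at x)"
    using D differentiable_def by blast
qed

lemma smooth_expr_imp_smooth: "smooth_expr f \<Longrightarrow> smooth f"
proof (rule smooth_coinduct[where X = smooth_expr])
  have *: "(\<forall>x. f differentiable (at x)) \<and> (\<forall>i. smooth_expr (partial i f))" if "smooth_expr f" for f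
    using that
  proof induction
    case (1 f)
    then show ?case
      by (auto intro: smooth_differentiable smooth_partial smooth_expr.intros)
  next
    case (2 f g)
    moreover from 2 have "partial i (\<lambda>x. f x + g x) = (\<lambda>x. partial i f x + partial i g x)" for i
      by (intro ext partial_add) auto
    ultimately show ?case by (auto intro: smooth_expr.intros)
  next
    case (3 f g)
    moreover from 3 have "partial i (\<lambda>x. f x * g x) = (\<lambda>x. f x * partial i g x + partial i f x * g x)" for i
      by (intro ext partial_mult) auto
    ultimately show ?case by (auto intro!: smooth_expr.intros(2,3))
  next
    case (4 f P)
    let ?P' = "[:0, 0, 1:] * (P - pderiv P)"
    have "partial i (\<lambda>x. flat P (f x)) = (\<lambda>x. flat ?P' (f x) * partial i f x)" for i
      using 4 by (intro ext partial_compose(1)[where g = "flat P"] flat_DERIV) blast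
    moreover have "smooth_expr (\<lambda>x. flat ?P' (f x) * partial i f x)" for i
      using 4 by (intro smooth_expr.intros(3,4)) blast+
    moreover have "(\<lambda>x. flat P (f x)) differentiable (at x)" for x
      using 4 partial_compose(2)[where g = "flat P" and f = f, OF _ flat_DERIV] by blast
    ultimately show ?case by simp
  qed
  show "f differentiable (at x)" if "smooth_expr f" for f :: "real ^ 'n::finite \<Rightarrow> real" and x
    using *[OF that] by blast
  show "smooth_expr (partial i f)" if "smooth_expr f" for f :: "real ^ 'n::finite \<Rightarrow> real" and i
    using *[OF that] by blast
qed

lemma smooth_const [simp, intro]: "smooth (\<lambda>x. c)"
proof (rule smooth_coinduct[where X = "\<lambda>f. \<exists>c. f = (\<lambda>x. c)"])
  show "\<exists>c. partial i f = (\<lambda>x. c)" if "\<exists>c. f = (\<lambda>x. c)" for f :: "real ^ 'n::finite \<Rightarrow> real" and i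
  proof -
    from that obtain c where "f = (\<lambda>x. c)" by blast
    then have "partial i f = (\<lambda>x. 0)"
      by (auto intro!: partial_eqI[where D = "\<lambda>h. 0", simplified])
    then show ?thesis by blast
  qed
qed auto

lemma partial_component: "partial i (\<lambda>x :: real ^ 'n::finite. x $ j) = (\<lambda>x. if i = j then 1 else 0)"
proof
  fix x :: "real ^ 'n"
  have "((\<lambda>x. x $ j) has_derivative (\<lambda>h :: real ^ 'n. h $ j)) (at x)"
    by (intro bounded_linear_imp_has_derivative bounded_linear_vec_nth)
  then show "partial i (\<lambda>x. x $ j) x = (if i = j then 1 else 0)"
    by (auto simp: partial_eqI axis_def)
qed

lemma smooth_component [simp, intro]: "smooth (\<lambda>x :: real ^ 'n::finite. x $ j)"
proof (rule smooth_from_partials)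
  show "(\<lambda>x. x $ j) differentiable (at x)" for x :: "real ^ 'n"
    using bounded_linear_imp_has_derivative[OF bounded_linear_vec_nth] differentiable_def by blast
  show "smooth (partial i (\<lambda>x :: real ^ 'n. x $ j))" for i
    unfolding partial_component by (cases "i = j") auto
qed

lemma smooth_add [intro]: "smooth f \<Longrightarrow> smooth g \<Longrightarrow> smooth (\<lambda>x. f x + g x)"
  and smooth_mult [intro]: "smooth f \<Longrightarrow> smooth g \<Longrightarrow> smooth (\<lambda>x. f x * g x)"
  and smooth_flat [intro]: "smooth f \<Longrightarrow> smooth (\<lambda>x. flat P (f x))"
  by (rule smooth_expr_imp_smooth, auto intro: smooth_expr.intros)+

lemma smooth_minus [intro]: "smooth f \<Longrightarrow> smooth (\<lambda>x. - f x)"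
  using smooth_mult[OF smooth_const[of "-1"], of f] by simp

lemma smooth_diff [intro]: "smooth f \<Longrightarrow> smooth g \<Longrightarrow> smooth (\<lambda>x. f x - g x)"
  using smooth_add[OF _ smooth_minus, of f g] by simp

lemma smooth_power [intro]: "smooth f \<Longrightarrow> smooth (\<lambda>x. f x ^ k)"
  by (induction k) auto

lemma smooth_sum [intro]: "(\<And>s. s \<in> F \<Longrightarrow> smooth (f s)) \<Longrightarrow> smooth (\<lambda>x. \<Sum>s\<in>F. f s x)"
  by (induction F rule: infinite_finite_induct) auto

lemma smooth_prod [intro]: "(\<And>s. s \<in> F \<Longrightarrow> smooth (f s)) \<Longrightarrow> smooth (\<lambda>x. \<Prod>s\<in>F. f s x)"
  by (induction F rule: infinite_finite_induct) auto

lemma smooth_continuous: "smooth f \<Longrightarrow> continuous_on A f"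
  by (meson continuous_at_imp_continuous_on differentiable_imp_continuous_within smooth_differentiable)

text \<open>The squared distance as a polynomial in the coordinates, which makes its smoothness evident.\<close>

definition dist_sq :: "real ^ 'n::finite \<Rightarrow> real ^ 'n \<Rightarrow> real" where
  "dist_sq a x = (\<Sum>i\<in>UNIV. (x $ i - a $ i) * (x $ i - a $ i))"

lemma dist_sq: "dist_sq a x = (dist a x)\<^sup>2"
  unfolding dist_commute[of a x]
  by (simp add: dist_sq_def dist_norm norm_vec_def L2_set_def sum_nonneg
      flip: power2_eq_square)

lemma smooth_dist_sq [intro]: "smooth (dist_sq a)"
  unfolding dist_sq_def by (intro smooth_sum smooth_mult smooth_diff smooth_component smooth_const)

lemma partial_dist_sq: "partial i (dist_sq a) x = 2 * (x $ i - a $ i)"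
proof (rule partial_eqI[where D = "\<lambda>h. \<Sum>j\<in>UNIV. (x $ j - a $ j) * h $ j + h $ j * (x $ j - a $ j)", THEN trans])
  show "(dist_sq a has_derivative
          (\<lambda>h. \<Sum>j\<in>UNIV. (x $ j - a $ j) * h $ j + h $ j * (x $ j - a $ j))) (at x)"
    unfolding dist_sq_def
    by (auto intro!: derivative_eq_intros bounded_linear_imp_has_derivative bounded_linear_vec_nth)
  have "(\<Sum>j\<in>UNIV. (x $ j - a $ j) * axis i 1 $ j + axis i 1 $ j * (x $ j - a $ j)) =
        (\<Sum>j\<in>UNIV. if j = i then 2 * (x $ i - a $ i) else 0)"
    by (rule sum.cong) (auto simp: axis_def)
  then show "(\<Sum>j\<in>UNIV. (x $ j - a $ j) * axis i 1 $ j + axis i 1 $ j * (x $ j - a $ j)) =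
        2 * (x $ i - a $ i)" by simp
qed

lemma dist_sq_ge:
  assumes "0 \<le> R" "x \<notin> cball a (sqrt R)"
  shows "R \<le> dist_sq a x"
proof -
  have "(sqrt R)\<^sup>2 \<le> (dist a x)\<^sup>2"
    using assms by (intro power_mono) auto
  then show ?thesis using assms(1) by (simp add: dist_sq)
qed

section \<open>Test functions\<close>

lemma test_fun_smooth: "test_fun f \<Longrightarrow> smooth f"
  by (simp add: test_fun_def)

lemma zero_outside_supp: "x \<notin> supp f \<Longrightarrow> f x = 0"
  using closure_subset[of "{x. f x \<noteq> 0}"] by (auto simp: supp_def)

lemma closed_supp [simp]: "closed (supp f)"
  by (simp add: supp_def)

lemma supp_subset: "closed C \<Longrightarrow> (\<And>x. x \<notin> C \<Longrightarrow> f x = 0) \<Longrightarrow> supp f \<subseteq> C"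
  unfolding supp_def by (rule closure_minimal) auto

lemma test_funI:
  assumes "smooth f" "compact C" "\<And>x. x \<notin> C \<Longrightarrow> f x = 0"
  shows "test_fun f"
proof -
  have "supp f \<subseteq> C"
    by (rule supp_subset[OF compact_imp_closed[OF assms(2)] assms(3)])
  then have "compact (C \<inter> supp f)" "C \<inter> supp f = supp f"
    using compact_Int_closed[OF assms(2), of "supp f"] by (auto simp: supp_def)
  then have "compact (supp f)" by simp
  then show ?thesis using assms(1) by (simp add: test_fun_def)
qed

lemma test_fun_compact: "test_fun f \<Longrightarrow> compact (supp f)"
  by (simp add: test_fun_def)

lemma test_fun_mult [intro]: "smooth g \<Longrightarrow> test_fun f \<Longrightarrow> test_fun (\<lambda>x. g x * f x)"
  by (rule test_funI[where C = "supp f"]) (auto intro: test_fun_smooth test_fun_compact simp: zero_outside_supp[of _ f])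

lemma test_fun_mult' [intro]: "smooth g \<Longrightarrow> test_fun f \<Longrightarrow> test_fun (\<lambda>x. f x * g x)"
  using test_fun_mult[of g f] by (simp add: mult.commute)

lemma test_fun_add [intro]: "test_fun f \<Longrightarrow> test_fun g \<Longrightarrow> test_fun (\<lambda>x. f x + g x)"
  by (rule test_funI[where C = "supp f \<union> supp g"])
     (auto intro: test_fun_smooth test_fun_compact simp: zero_outside_supp[of _ f] zero_outside_supp[of _ g])

lemma test_fun_cmult [intro]: "test_fun f \<Longrightarrow> test_fun (\<lambda>x. c * f x)"
  by auto

lemma test_fun_minus [intro]: "test_fun f \<Longrightarrow> test_fun (\<lambda>x. - f x)"
  using test_fun_cmult[of f "-1"] by simp

lemma test_fun_diff [intro]: "test_fun f \<Longrightarrow> test_fun g \<Longrightarrow> test_fun (\<lambda>x. f x - g x)"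
  using test_fun_add[OF _ test_fun_minus, of f g] by simp

lemma test_fun_zero [simp, intro]: "test_fun (\<lambda>x. 0)"
  by (rule test_funI[where C = "{}"]) auto

lemma test_fun_sum [intro]: "(\<And>s. s \<in> F \<Longrightarrow> test_fun (f s)) \<Longrightarrow> test_fun (\<lambda>x. \<Sum>s\<in>F. f s x)"
  by (induction F rule: infinite_finite_induct) auto

lemma test_fun_bounded:
  assumes "test_fun f" obtains B where "\<And>x. \<bar>f x\<bar> \<le> B" "B \<ge> 0"
proof -
  have "compact (f ` supp f)"
    by (rule compact_continuous_image[OF smooth_continuous[OF test_fun_smooth[OF assms]]
          test_fun_compact[OF assms]])
  then obtain B where B: "\<And>y. y \<in> f ` supp f \<Longrightarrow> \<bar>y\<bar> \<le> B"
    using compact_imp_bounded bounded_real by metis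
  show thesis
  proof
    show "\<bar>f x\<bar> \<le> max B 0" for x
    proof (cases "x \<in> supp f")
      case True
      then show ?thesis using B[of "f x"] by auto
    next
      case False
      then show ?thesis by (simp add: zero_outside_supp)
    qed
  qed simp
qed

section \<open>The algebra of even superforms\<close>

text \<open>For disjoint index sets the signs of the wedge product are multiplicative in each argument. This is
all that associativity needs; commutativity of forms of even degree comes from the parity count in
\<open>wedge_sign_swap\<close>.\<close>

lemma merge_sign_Un_left:
  assumes "I \<inter> I' = {}"
  shows "merge_sign (I \<union> I') K = merge_sign I K * merge_sign I' K"
proof -
  let ?P = "\<lambda>I. {(i, j). i \<in> I \<and> j \<in> K \<and> j < i}"
  have "?P (I \<union> I') = ?P I \<union> ?P I'" by auto
  moreover have "card (?P I \<union> ?P I') = card (?P I) + card (?P I')"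
    by (rule card_Un_disjoint) (use assms in auto)
  ultimately show ?thesis
    unfolding merge_sign_def by (simp add: power_add)
qed

lemma merge_sign_Un_right:
  assumes "K \<inter> K' = {}"
  shows "merge_sign I (K \<union> K') = merge_sign I K * merge_sign I K'"
proof -
  let ?P = "\<lambda>K. {(i, j). i \<in> I \<and> j \<in> K \<and> j < i}"
  have "?P (K \<union> K') = ?P K \<union> ?P K'" by auto
  moreover have "card (?P K \<union> ?P K') = card (?P K) + card (?P K')"
    by (rule card_Un_disjoint) (use assms in auto)
  ultimately show ?thesis
    unfolding merge_sign_def by (simp add: power_add)
qed

lemma merge_sign_swap:
  assumes "I \<inter> K = {}"
  shows "merge_sign I K = (- 1) ^ (card I * card K) * merge_sign K I"
proof -
  (* a pair in I times K is an inversion either of (I, K) or, transposed, of (K, I) *)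
  let ?A = "{(i, k). i \<in> I \<and> k \<in> K \<and> k < i}" and ?B = "{(k, i). k \<in> K \<and> i \<in> I \<and> i < k}"
  have "card (I \<times> K) = card (?A \<union> prod.swap ` ?B)"
    by (rule arg_cong[where f = card]) (use assms in \<open>auto simp: image_iff neq_iff\<close>)
  also have "\<dots> = card ?A + card (prod.swap ` ?B)"
    by (rule card_Un_disjoint) auto
  also have "card (prod.swap ` ?B) = card ?B"
    by (rule card_image) auto
  finally have "card I * card K = card ?A + card ?B"
    by (simp add: card_cartesian_product)
  then show ?thesis
    unfolding merge_sign_def by (simp add: power_add flip: power2_eq_square power_mult)
qed

lemma wedge_sign_Un_left:
  assumes "I \<inter> I' = {}" "J \<inter> J' = {}"
  shows "wedge_sign (I \<union> I') (J \<union> J') K L = wedge_sign I J K L * wedge_sign I' J' K L"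
  unfolding wedge_sign_def
  by (simp add: merge_sign_Un_left assms card_Un_disjoint power_add add_mult_distrib)

lemma wedge_sign_Un_right:
  assumes "K \<inter> K' = {}" "L \<inter> L' = {}"
  shows "wedge_sign I J (K \<union> K') (L \<union> L') = wedge_sign I J K L * wedge_sign I J K' L'"
  unfolding wedge_sign_def
  by (simp add: merge_sign_Un_right assms card_Un_disjoint power_add add_mult_distrib2)

lemma wedge_sign_swap:
  assumes "I \<inter> K = {}" "J \<inter> L = {}" "even (card I + card J)"
  shows "wedge_sign I J K L = wedge_sign K L I J"
proof -
  have "wedge_sign I J K L =
     (- 1) ^ (card J * card K + card I * card K + card J * card L) * merge_sign K I * merge_sign L J"
    unfolding wedge_sign_def merge_sign_swap[OF assms(1)] merge_sign_swap[OF assms(2)]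
    by (simp add: power_add)
  moreover have "even (card J * card K + card I * card K + card J * card L) \<longleftrightarrow> even (card L * card I)"
    using assms(3) by auto
  ultimately show ?thesis
    unfolding wedge_sign_def by (simp add: uminus_power_if)
qed

lemma wedge_sign_empty [simp]:
  "wedge_sign {} {} K L = 1" "wedge_sign I J {} {} = 1" "wedge_sign I {} {} L = 1"
  by (simp_all add: wedge_sign_def merge_sign_def)

lemma wedge_sign_cocycle:
  assumes "A \<inter> B = {}" "A \<inter> C = {}" "B \<inter> C = {}" "A' \<inter> B' = {}" "A' \<inter> C' = {}" "B' \<inter> C' = {}"
  shows "wedge_sign (A \<union> B) (A' \<union> B') C C' * wedge_sign A A' B B' =
         wedge_sign A A' (B \<union> C) (B' \<union> C') * wedge_sign B B' C C'"
  using assms by (simp add: wedge_sign_Un_left wedge_sign_Un_right)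

text \<open>Both sides sum over the ways to split \<open>M\<close> into three parts; this turns the two bracketings of a triple
product into each other.\<close>

lemma sum_Pow_split:
  assumes "finite M"
  shows "(\<Sum>I\<in>Pow M. \<Sum>A\<in>Pow I. F A (I - A) (M - I)) =
         (\<Sum>A\<in>Pow M. \<Sum>B\<in>Pow (M - A). F A B (M - A - B))"
proof -
  have fin: "I \<in> Pow M \<Longrightarrow> finite (Pow I)" for I
    using assms finite_subset by auto
  have "(\<Sum>I\<in>Pow M. \<Sum>A\<in>Pow I. F A (I - A) (M - I)) =
        (\<Sum>(I, A)\<in>Sigma (Pow M) Pow. F A (I - A) (M - I))"
    using assms fin by (intro sum.Sigma) auto
  also have "\<dots> = (\<Sum>(A, B)\<in>Sigma (Pow M) (\<lambda>A. Pow (M - A)). F A B (M - A - B))"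
    by (rule sum.reindex_bij_witness[where i = "\<lambda>(A, B). (A \<union> B, A)" and j = "\<lambda>(I, A). (A, I - A)"])
       (auto intro!: arg_cong[where f = "F _ _"])
  also have "\<dots> = (\<Sum>A\<in>Pow M. \<Sum>B\<in>Pow (M - A). F A B (M - A - B))"
    using assms by (intro sum.Sigma[symmetric]) auto
  finally show ?thesis .
qed

lemma sum_Pow_delta:
  fixes F :: "'n::finite set \<Rightarrow> 'n set \<Rightarrow> real"
  shows "(\<Sum>I\<in>Pow M. \<Sum>J\<in>Pow N. if I = A \<and> J = B then F I J else 0) =
    (if A \<subseteq> M \<and> B \<subseteq> N then F A B else 0)"
proof -
  have "(\<Sum>I\<in>Pow M. \<Sum>J\<in>Pow N. if I = A \<and> J = B then F I J else 0) =
      (\<Sum>IJ\<in>Pow M \<times> Pow N. if IJ = (A, B) then (case IJ of (I, J) \<Rightarrow> F I J) else 0)"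
    unfolding sum.cartesian_product by (rule sum.cong[OF refl]) (simp split: prod.split)
  also have "\<dots> = (if (A, B) \<in> Pow M \<times> Pow N then F A B else 0)"
    by (subst sum.delta) auto
  finally show ?thesis by simp
qed

lemma card_split: "I \<subseteq> M \<Longrightarrow> card M = card I + card (M - I)" for M :: "'n::finite set"
  using card_mono[of M I] card_Diff_subset[of I M] by simp

lemma product_odd_zero:
  fixes f g :: "'n::{finite,linorder} set \<Rightarrow> 'n set \<Rightarrow> real"
  assumes f: "\<forall>K L. odd (card K + card L) \<longrightarrow> f K L = 0"
    and g: "\<forall>K L. odd (card K + card L) \<longrightarrow> g K L = 0"
    and odd: "odd (card M + card N)"
  shows "(\<Sum>I\<in>Pow M. \<Sum>J\<in>Pow N. wedge_sign I J (M - I) (N - J) * (f I J * g (M - I) (N - J))) = 0"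
proof (intro sum.neutral ballI)
  fix I J assume I: "I \<in> Pow M" and J: "J \<in> Pow N"
  have "card M = card I + card (M - I)" "card N = card J + card (N - J)"
    using I J card_split[of I M] card_split[of J N] by auto
  then have "odd (card I + card J) \<or> odd (card (M - I) + card (N - J))"
    using odd by presburger
  then have "f I J = 0 \<or> g (M - I) (N - J) = 0"
    using f g by blast
  then show "wedge_sign I J (M - I) (N - J) * (f I J * g (M - I) (N - J)) = 0" by auto
qed

text \<open>The values at a point of superforms of even total degree. Restricting to even degree makes the
wedge product commutative, so that the ring simplification rules and the power operation apply;
every form that occurs in the argument after the factors $dx_i$ and $d\xi_j$ have been paired is even.\<close>

typedef 'n even_form = "{f :: 'n set \<Rightarrow> 'n set \<Rightarrow> real. \<forall>K L. odd (card K + card L) \<longrightarrow> f K L = 0}"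
  morphisms form_coeff Even_Form
  by (rule exI[of _ "\<lambda>K L. 0"]) auto

setup_lifting type_definition_even_form

lemma even_form_eqI: "(\<And>K L. form_coeff f K L = form_coeff g K L) \<Longrightarrow> f = g"
  by (meson ext form_coeff_inject)

lemma form_coeff_odd: "odd (card K + card L) \<Longrightarrow> form_coeff f K L = 0"
  using form_coeff[of f] by auto

instantiation even_form :: (type) real_vector
begin
lift_definition zero_even_form :: "'a even_form" is "\<lambda>K L. 0" by auto
lift_definition plus_even_form :: "'a even_form \<Rightarrow> 'a even_form \<Rightarrow> 'a even_form" is "\<lambda>f g K L. f K L + g K L" by auto
lift_definition minus_even_form :: "'a even_form \<Rightarrow> 'a even_form \<Rightarrow> 'a even_form" is "\<lambda>f g K L. f K L - g K L" by auto
lift_definition uminus_even_form :: "'a even_form \<Rightarrow> 'a even_form" is "\<lambda>f K L. - f K L" by auto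
lift_definition scaleR_even_form :: "real \<Rightarrow> 'a even_form \<Rightarrow> 'a even_form" is "\<lambda>c f K L. c * f K L" by auto
instance
  by standard (transfer; auto simp: algebra_simps fun_eq_iff)+
end

lemma form_coeff_simps [simp]:
  "form_coeff 0 K L = 0"
  "form_coeff (f + g) K L = form_coeff f K L + form_coeff g K L"
  "form_coeff (f - g) K L = form_coeff f K L - form_coeff g K L"
  "form_coeff (- f) K L = - form_coeff f K L"
  "form_coeff (c *\<^sub>R f) K L = c * form_coeff f K L"
  by (transfer, simp)+

lemma form_coeff_sum [simp]: "form_coeff (\<Sum>s\<in>F. f s) K L = (\<Sum>s\<in>F. form_coeff (f s) K L)"
  by (induction F rule: infinite_finite_induct) auto

instantiation even_form :: ("{finite,linorder}") "{comm_ring_1, real_algebra_1}"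
begin
lift_definition one_even_form :: "'a even_form" is "\<lambda>K L. if K = {} \<and> L = {} then 1 else 0" by auto
lift_definition times_even_form :: "'a even_form \<Rightarrow> 'a even_form \<Rightarrow> 'a even_form" is
  "\<lambda>f g M N. \<Sum>I\<in>Pow M. \<Sum>J\<in>Pow N. wedge_sign I J (M - I) (N - J) * (f I J * g (M - I) (N - J))"
  by (blast intro: product_odd_zero)

lemma form_coeff_mult:
  "form_coeff (f * g) M N =
     (\<Sum>I\<in>Pow M. \<Sum>J\<in>Pow N. wedge_sign I J (M - I) (N - J) * (form_coeff f I J * form_coeff g (M - I) (N - J)))"
  by transfer simp

lemma form_coeff_one: "form_coeff (1 :: 'a even_form) K L = (if K = {} \<and> L = {} then 1 else 0)"
  by transfer simp

lemma form_coeff_mult_monomial: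
  assumes "\<And>I J. form_coeff e I J = (if I = A \<and> J = B then 1 else 0)"
  shows "form_coeff (e * f) M N =
    (if A \<subseteq> M \<and> B \<subseteq> N then wedge_sign A B (M - A) (N - B) * form_coeff f (M - A) (N - B) else 0)"
proof -
  have "form_coeff (e * f) M N = (\<Sum>I\<in>Pow M. \<Sum>J\<in>Pow N. if I = A \<and> J = B then
      wedge_sign I J (M - I) (N - J) * form_coeff f (M - I) (N - J) else 0)"
    unfolding form_coeff_mult assms by (intro sum.cong refl) simp
  then show ?thesis
    unfolding sum_Pow_delta .
qed

instance
proof
  fix f g h :: "'a even_form" and c :: real
  show "f * g * h = f * (g * h)"
  proof (rule even_form_eqI)
    fix M N :: "'a set"
    let ?G = "\<lambda>A B C A' B' C'. wedge_sign A A' (B \<union> C) (B' \<union> C') * wedge_sign B B' C C' *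
        (form_coeff f A A' * form_coeff g B B' * form_coeff h C C')"
    have "form_coeff (f * g * h) M N = (\<Sum>I\<in>Pow M. \<Sum>J\<in>Pow N. \<Sum>A\<in>Pow I. \<Sum>A'\<in>Pow J.
        ?G A (I - A) (M - I) A' (J - A') (N - J))"
      unfolding form_coeff_mult sum_distrib_left sum_distrib_right
    proof (intro sum.cong refl)
      fix I J A A' assume *: "I \<in> Pow M" "J \<in> Pow N" "A \<in> Pow I" "A' \<in> Pow J"
      then have "A \<union> (I - A) = I" "A' \<union> (J - A') = J" by auto
      moreover have "A \<inter> (I - A) = {}" "A \<inter> (M - I) = {}" "(I - A) \<inter> (M - I) = {}"
          "A' \<inter> (J - A') = {}" "A' \<inter> (N - J) = {}" "(J - A') \<inter> (N - J) = {}"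
        using * by auto
      ultimately have "wedge_sign I J (M - I) (N - J) * wedge_sign A A' (I - A) (J - A') =
          wedge_sign A A' ((I - A) \<union> (M - I)) ((J - A') \<union> (N - J)) * wedge_sign (I - A) (J - A') (M - I) (N - J)"
        using wedge_sign_cocycle[of A "I - A" "M - I" A' "J - A'" "N - J"] by simp
      then show "wedge_sign I J (M - I) (N - J) *
          (wedge_sign A A' (I - A) (J - A') * (form_coeff f A A' * form_coeff g (I - A) (J - A')) *
           form_coeff h (M - I) (N - J)) = ?G A (I - A) (M - I) A' (J - A') (N - J)"
        by (simp add: mult.assoc[symmetric])
    qed
    also have "\<dots> = (\<Sum>I\<in>Pow M. \<Sum>A\<in>Pow I. \<Sum>J\<in>Pow N. \<Sum>A'\<in>Pow J.
        ?G A (I - A) (M - I) A' (J - A') (N - J))"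
      by (intro sum.cong refl sum.swap)
    also have "\<dots> = (\<Sum>A\<in>Pow M. \<Sum>B\<in>Pow (M - A). \<Sum>J\<in>Pow N. \<Sum>A'\<in>Pow J.
        ?G A B (M - A - B) A' (J - A') (N - J))"
      by (rule sum_Pow_split[where F = "\<lambda>A B C. \<Sum>J\<in>Pow N. \<Sum>A'\<in>Pow J. ?G A B C A' (J - A') (N - J)"]) simp
    also have "\<dots> = (\<Sum>A\<in>Pow M. \<Sum>B\<in>Pow (M - A). \<Sum>A'\<in>Pow N. \<Sum>B'\<in>Pow (N - A').
        ?G A B (M - A - B) A' B' (N - A' - B'))"
      by (intro sum.cong refl sum_Pow_split) simp
    also have "\<dots> = (\<Sum>A\<in>Pow M. \<Sum>A'\<in>Pow N. \<Sum>B\<in>Pow (M - A). \<Sum>B'\<in>Pow (N - A').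
        ?G A B (M - A - B) A' B' (N - A' - B'))"
      by (intro sum.cong refl sum.swap)
    also have "\<dots> = form_coeff (f * (g * h)) M N"
      unfolding form_coeff_mult sum_distrib_left sum_distrib_right
    proof (intro sum.cong refl)
      fix A A' B B' assume *: "A \<in> Pow M" "A' \<in> Pow N" "B \<in> Pow (M - A)" "B' \<in> Pow (N - A')"
      then have "B \<union> (M - A - B) = M - A" "B' \<union> (N - A' - B') = N - A'" by auto
      then show "?G A B (M - A - B) A' B' (N - A' - B') =
          wedge_sign A A' (M - A) (N - A') * (form_coeff f A A' * (wedge_sign B B' (M - A - B) (N - A' - B') *
          (form_coeff g B B' * form_coeff h (M - A - B) (N - A' - B'))))"
        by simp
    qed
    finally show "form_coeff (f * g * h) M N = form_coeff (f * (g * h)) M N" .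
  qed
  show comm: "f * g = g * f" for f g :: "'a even_form"
  proof (rule even_form_eqI)
    fix M N :: "'a set"
    have inv: "(\<Sum>I\<in>Pow M. F I) = (\<Sum>I\<in>Pow M. F (M - I))" for F :: "'a set \<Rightarrow> real" and M
      by (rule sum.reindex_bij_witness[where i = "\<lambda>I. M - I" and j = "\<lambda>I. M - I"])
         (auto simp: double_diff)
    define G where "G I J = wedge_sign I J (M - I) (N - J) *
        (form_coeff f I J * form_coeff g (M - I) (N - J))" for I J
    have "form_coeff (f * g) M N = (\<Sum>I\<in>Pow M. \<Sum>J\<in>Pow N. G I J)"
      unfolding form_coeff_mult G_def ..
    also have "\<dots> = (\<Sum>I\<in>Pow M. \<Sum>J\<in>Pow N. G (M - I) J)"
      by (rule inv)
    also have "\<dots> = (\<Sum>I\<in>Pow M. \<Sum>J\<in>Pow N. G (M - I) (N - J))"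
      by (intro sum.cong refl inv)
    also have "\<dots> = form_coeff (g * f) M N"
      unfolding form_coeff_mult G_def
    proof (intro sum.cong refl)
      fix I J assume *: "I \<in> Pow M" "J \<in> Pow N"
      then have "M - (M - I) = I" "N - (N - J) = J" by auto
      moreover have "form_coeff g I J = 0 \<or>
          wedge_sign I J (M - I) (N - J) = wedge_sign (M - I) (N - J) I J"
        using wedge_sign_swap[of I "M - I" J "N - J"] form_coeff_odd[of I J g] by blast
      ultimately show "wedge_sign (M - I) (N - J) (M - (M - I)) (N - (N - J)) *
          (form_coeff f (M - I) (N - J) * form_coeff g (M - (M - I)) (N - (N - J))) =
          wedge_sign I J (M - I) (N - J) * (form_coeff g I J * form_coeff f (M - I) (N - J))"
        by (elim disjE) simp_all
    qed
    finally show "form_coeff (f * g) M N = form_coeff (g * f) M N" .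
  qed
  show one: "1 * f = f"
    by (rule even_form_eqI) (simp add: form_coeff_mult_monomial[OF form_coeff_one])
  show "f * 1 = f"
    using comm one by metis
  show distrib: "(f + g) * h = f * h + g * h" for f g h :: "'a even_form"
    by (rule even_form_eqI) (simp add: form_coeff_mult algebra_simps sum.distrib)
  show "f * (g + h) = f * g + f * h"
    using comm distrib by metis
  show "c *\<^sub>R f * g = c *\<^sub>R (f * g)" "f * c *\<^sub>R g = c *\<^sub>R (f * g)"
    by (rule even_form_eqI, simp add: form_coeff_mult algebra_simps sum_distrib_left)+
  show "(0 :: 'a even_form) \<noteq> 1"
  proof
    assume "(0 :: 'a even_form) = 1"
    then have "form_coeff (0 :: 'a even_form) {} {} = form_coeff 1 {} {}" by simp
    then show False by (simp add: form_coeff_one)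
  qed
qed
end


section \<open>Forms of bidegree (1,1)\<close>

text \<open>The form $dx_i \wedge d\xi_j$.\<close>

lift_definition elem :: "'n \<Rightarrow> 'n \<Rightarrow> 'n even_form" is
  "\<lambda>i j K L. if K = {i} \<and> L = {j} then 1 else 0" by auto

lemma form_coeff_elem: "form_coeff (elem i j) K L = (if K = {i} \<and> L = {j} then 1 else 0)"
  by transfer simp

lemma form_coeff_elem_mult:
  "form_coeff (elem i j * f) M N =
     (if i \<in> M \<and> j \<in> N then wedge_sign {i} {j} (M - {i}) (N - {j}) * form_coeff f (M - {i}) (N - {j}) else 0)"
  by (simp add: form_coeff_mult_monomial[OF form_coeff_elem])

lemma merge_sign_singletons: "merge_sign {i} {k} = (if k < i then -1 else 1)"
proof -
  have "{(a, b). a \<in> {i} \<and> b \<in> {k} \<and> b < a} = (if k < i then {(i, k)} else {})" by auto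
  then show ?thesis unfolding merge_sign_def by simp
qed

text \<open>Exchanging $dx_i$ with $dx_k$ in $dx_i \wedge d\xi_j \wedge dx_k \wedge d\xi_l$ costs one sign. If
$i = k$ or $j = l$, both sides vanish.\<close>

lemma elem_mult_swap:
  fixes i j k l :: "'n::{finite,linorder}"
  shows "elem i j * elem k l = - (elem k j * elem i l)"
proof (rule even_form_eqI)
  fix M N :: "'n set"
  have "M - {i} = {k} \<and> i \<in> M \<longleftrightarrow> M = {i, k} \<and> i \<noteq> k" "M - {k} = {i} \<and> k \<in> M \<longleftrightarrow> M = {i, k} \<and> i \<noteq> k"
    by auto
  then show "form_coeff (elem i j * elem k l) M N = form_coeff (- (elem k j * elem i l)) M N"
    by (auto simp: form_coeff_elem_mult form_coeff_elem wedge_sign_def merge_sign_singletons)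
qed

text \<open>The form $v \wedge J(v)$ for $v = \sum_i v_i\, dx_i$; strongly positive forms are built from products of these.\<close>

definition square :: "('n::{finite,linorder} \<Rightarrow> real) \<Rightarrow> 'n even_form" where
  "square v = (\<Sum>i\<in>UNIV. \<Sum>j\<in>UNIV. (v i * v j) *\<^sub>R elem i j)"

text \<open>The value of $\beta$, which is the same at every point.\<close>

definition kaehler :: "'n::{finite,linorder} even_form" where
  "kaehler = (\<Sum>i\<in>UNIV. elem i i)"

lemma square_mult_square: "square v * square v = 0"
proof -
  let ?S = "\<lambda>i k j l. (v i * v j * v k * v l) *\<^sub>R (elem i j * elem k l)"
  have expand: "square v * square v = (\<Sum>i\<in>UNIV. \<Sum>k\<in>UNIV. \<Sum>j\<in>UNIV. \<Sum>l\<in>UNIV. ?S i k j l)"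
    unfolding square_def sum_product by (simp add: mult_ac)
  also have "\<dots> = (\<Sum>i\<in>UNIV. \<Sum>k\<in>UNIV. \<Sum>j\<in>UNIV. \<Sum>l\<in>UNIV. - ?S k i j l)"
    by (intro sum.cong refl) (subst elem_mult_swap, simp add: mult_ac)
  also have "\<dots> = - (\<Sum>i\<in>UNIV. \<Sum>k\<in>UNIV. \<Sum>j\<in>UNIV. \<Sum>l\<in>UNIV. ?S k i j l)"
    by (simp only: sum_negf)
  also have "(\<Sum>i\<in>UNIV. \<Sum>k\<in>UNIV. \<Sum>j\<in>UNIV. \<Sum>l\<in>UNIV. ?S k i j l) =
      (\<Sum>k\<in>UNIV. \<Sum>i\<in>UNIV. \<Sum>j\<in>UNIV. \<Sum>l\<in>UNIV. ?S k i j l)"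
    by (rule sum.swap)
  finally have "square v * square v = - (square v * square v)"
    using expand by simp
  then have "2 *\<^sub>R (square v * square v) = 0"
    by (simp add: scaleR_2 eq_neg_iff_add_eq_0)
  then show ?thesis by simp
qed

text \<open>Lagrange's identity $|y|^2 |v|^2 = \langle y, v \rangle^2 + \sum_{i<j} (y_i v_j - y_j v_i)^2$, with
quadratic forms in $v$ replaced by forms of bidegree $(1,1)$. It exhibits $|y|^2 \beta - y \wedge J(y)$
as a sum of squares; the factor 2 appears because each pair $i < j$ is counted twice.\<close>

lemma lagrange_identity:
  fixes y :: "'n::{finite,linorder} \<Rightarrow> real"
  shows "(\<Sum>i\<in>UNIV. \<Sum>j\<in>UNIV. square (\<lambda>l. y i * of_bool (l = j) - y j * of_bool (l = i))) =
     2 *\<^sub>R ((\<Sum>i\<in>UNIV. y i * y i) *\<^sub>R kaehler - square y)"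
proof -
  have double: "a + a - b - b = 2 *\<^sub>R (a - b)" for a b :: "'n even_form"
    by (simp add: scaleR_2)
  have "square (\<lambda>l. y i * of_bool (l = j) - y j * of_bool (l = i)) =
     (y i * y i) *\<^sub>R elem j j + (y j * y j) *\<^sub>R elem i i -
       (y i * y j) *\<^sub>R elem i j - (y j * y i) *\<^sub>R elem j i" (is "square ?w = _") for i j
  proof -
    have pick: "(\<Sum>k\<in>UNIV. ?w k *\<^sub>R f k) = y i *\<^sub>R f j - y j *\<^sub>R f i" for f :: "'n \<Rightarrow> 'n even_form"
      by (simp add: scaleR_diff_left sum_subtractf of_bool_def if_distrib[where f = "\<lambda>c. c *\<^sub>R _"]
          if_distrib[where f = "\<lambda>c. _ * c"] cong: if_cong)
    have "square ?w = (\<Sum>k\<in>UNIV. ?w k *\<^sub>R (\<Sum>l\<in>UNIV. ?w l *\<^sub>R elem k l))"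
      unfolding square_def by (simp only: scaleR_sum_right scaleR_scaleR)
    then show ?thesis
      unfolding pick by (simp add: scaleR_diff_right mult.commute)
  qed
  then have "(\<Sum>i\<in>UNIV. \<Sum>j\<in>UNIV. square (\<lambda>l. y i * of_bool (l = j) - y j * of_bool (l = i))) =
     (\<Sum>i\<in>UNIV. \<Sum>j\<in>UNIV. (y i * y i) *\<^sub>R elem j j) + (\<Sum>i\<in>UNIV. \<Sum>j\<in>UNIV. (y j * y j) *\<^sub>R elem i i) -
     (\<Sum>i\<in>UNIV. \<Sum>j\<in>UNIV. (y i * y j) *\<^sub>R elem i j) - (\<Sum>i\<in>UNIV. \<Sum>j\<in>UNIV. (y j * y i) *\<^sub>R elem j i)"
    by (simp add: sum.distrib sum_subtractf)
  also have "(\<Sum>i\<in>UNIV. \<Sum>j\<in>UNIV. (y i * y i) *\<^sub>R elem j j) = (\<Sum>i\<in>UNIV. y i * y i) *\<^sub>R kaehler"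
    unfolding kaehler_def by (simp add: scaleR_sum_right scaleR_sum_left) (rule sum.swap)
  also have "(\<Sum>i\<in>UNIV. \<Sum>j\<in>UNIV. (y j * y j) *\<^sub>R elem i i) = (\<Sum>i\<in>UNIV. y i * y i) *\<^sub>R kaehler"
    unfolding kaehler_def by (simp add: scaleR_sum_right scaleR_sum_left)
  also have "(\<Sum>i\<in>UNIV. \<Sum>j\<in>UNIV. (y j * y i) *\<^sub>R elem j i) = square y"
    unfolding square_def by (rule sum.swap)
  finally show ?thesis
    unfolding square_def[symmetric] double .
qed

lemma power_add_nilpotent:
  fixes c w :: "'a::comm_ring_1"
  assumes "w * w = 0"
  shows "(c + w) ^ k * w = c ^ k * w" and "(c + w) ^ Suc k = c ^ Suc k + of_nat (Suc k) * (c + w) ^ k * w"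
proof -
  show 1: "(c + w) ^ k * w = c ^ k * w" for k
  proof (induction k)
    case (Suc k)
    have "(c + w) ^ Suc k * w = (c + w) * ((c + w) ^ k * w)" by (simp add: mult_ac)
    also have "\<dots> = c ^ Suc k * w + c ^ k * (w * w)"
      unfolding Suc.IH by (simp add: algebra_simps)
    finally show ?case by (simp add: assms)
  qed simp
  show "(c + w) ^ Suc k = c ^ Suc k + of_nat (Suc k) * (c + w) ^ k * w"
  proof (induction k)
    case (Suc k)
    have "(c + w) ^ Suc (Suc k) = (c + w) ^ Suc k * c + (c + w) ^ Suc k * w"
      by (simp add: algebra_simps)
    also have "(c + w) ^ Suc k * c = c ^ Suc (Suc k) + of_nat (Suc k) * (c * ((c + w) ^ k * w))"
      by (subst Suc) (simp add: algebra_simps)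
    also have "c * ((c + w) ^ k * w) = (c + w) ^ Suc k * w"
      unfolding 1 by simp
    finally show ?case by (simp add: algebra_simps)
  qed simp
qed

text \<open>The source of the exponent $p$: $|y|^2\beta = \frac12\tau + \omega$ with $\omega^2 = 0$, so that
$(|y|^2\beta)^p = (\frac12\tau)^p + p\, (|y|^2 \beta)^{p-1} \omega$. Positive currents are
nonnegative on $\tau^p$, which yields $p\, |y|^{2(p-1)} \beta^{p-1} \wedge \omega \le |y|^{2p} \beta^p$.
The common factor $|y|^{2(p-1)}$ is kept: without it, the difference is no longer a manifest sum of
products of smooth squares near $y = 0$.\<close>

lemma kaehler_power_decomposition:
  fixes y :: "'n::{finite,linorder} \<Rightarrow> real"
  defines "t \<equiv> \<Sum>i\<in>UNIV. y i * y i"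
  defines "\<tau> \<equiv> \<Sum>i\<in>UNIV. \<Sum>j\<in>UNIV. square (\<lambda>l. y i * of_bool (l = j) - y j * of_bool (l = i))"
  assumes "p = Suc k"
  shows "(real p * t ^ k) *\<^sub>R (kaehler ^ k * square y) = t ^ p *\<^sub>R kaehler ^ p - (1 / 2 ^ p) *\<^sub>R \<tau> ^ p"
proof -
  have t: "t *\<^sub>R kaehler = (1/2) *\<^sub>R \<tau> + square y"
    unfolding t_def \<tau>_def lagrange_identity by simp
  have scaleR_power: "(c *\<^sub>R A) ^ m = c ^ m *\<^sub>R A ^ m" for c m and A :: "'n even_form"
    by (induction m) (simp_all add: mult_ac)
  have "t ^ p *\<^sub>R kaehler ^ p = (t *\<^sub>R (kaehler :: 'n even_form)) ^ p"
    by (simp add: scaleR_power)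
  also have "\<dots> = ((1/2) *\<^sub>R \<tau>) ^ p + of_nat p * (t *\<^sub>R kaehler) ^ k * square y"
    unfolding t assms(3) by (rule power_add_nilpotent(2)[OF square_mult_square])
  also have "of_nat p * (t *\<^sub>R kaehler) ^ k * square y = (real p * t ^ k) *\<^sub>R (kaehler ^ k * square y)"
    by (simp add: scaleR_power scaleR_conv_of_real power_mult_distrib mult_ac)
  finally show ?thesis
    by (simp add: scaleR_power power_one_over)
qed

section \<open>Superforms as fields of even forms\<close>

definition even_superform :: "'n::{finite,linorder} superform \<Rightarrow> bool" where
  "even_superform \<alpha> \<longleftrightarrow> (\<forall>K L x. odd (card K + card L) \<longrightarrow> \<alpha> K L x = 0)"

definition at_point :: "'n::{finite,linorder} superform \<Rightarrow> real ^ 'n::{finite,linorder} \<Rightarrow> 'n even_form" where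
  "at_point \<alpha> x = Even_Form (\<lambda>K L. \<alpha> K L x)"

lemma form_coeff_at_point: "even_superform \<alpha> \<Longrightarrow> form_coeff (at_point \<alpha> x) K L = \<alpha> K L x"
  unfolding at_point_def by (subst Even_Form_inverse) (auto simp: even_superform_def)

lemma even_superform_field: "even_superform (\<lambda>K L x. form_coeff (\<Phi> x) K L)"
  by (simp add: even_superform_def form_coeff_odd)

lemma even_superform_eqI:
  assumes "\<And>K L x. \<alpha> K L x = form_coeff (\<Phi> x) K L"
  shows "even_superform \<alpha> \<and> at_point \<alpha> = \<Phi>"
proof -
  have "\<alpha> = (\<lambda>K L x. form_coeff (\<Phi> x) K L)"
    using assms by (intro ext)
  then have "even_superform \<alpha>"
    using even_superform_field by blast
  then show ?thesis
    using assms by (auto intro!: ext even_form_eqI simp: form_coeff_at_point)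
qed

lemma wedge_at_point:
  assumes "even_superform \<alpha>" "even_superform \<gamma>"
  shows "even_superform (\<alpha> \<and>\<^sub>f \<gamma>) \<and> at_point (\<alpha> \<and>\<^sub>f \<gamma>) = (\<lambda>x. at_point \<alpha> x * at_point \<gamma> x)"
  by (rule even_superform_eqI) (simp add: wedge_def form_coeff_mult form_coeff_at_point assms)

lemma wedge_list_at_point:
  assumes "\<And>\<alpha>. \<alpha> \<in> set \<alpha>s \<Longrightarrow> even_superform \<alpha>"
  shows "even_superform (wedge_list \<alpha>s) \<and>
    at_point (wedge_list \<alpha>s) = (\<lambda>x. prod_list (map (\<lambda>\<alpha>. at_point \<alpha> x) \<alpha>s))"
  using assms
proof (induction \<alpha>s)
  case Nil
  show ?case
    unfolding wedge_list_def by (rule even_superform_eqI) (simp add: one_form_def form_coeff_one)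
next
  case (Cons \<alpha> \<alpha>s)
  then show ?case
    using wedge_at_point[of \<alpha> "wedge_list \<alpha>s"] by (auto simp: wedge_list_def)
qed

definition lin_form :: "('n \<Rightarrow> real ^ 'n::{finite,linorder} \<Rightarrow> real) \<Rightarrow> 'n::{finite,linorder} superform" where
  "lin_form v K L x = (if card K = 1 \<and> L = {} then v (the_elem K) x else 0)"

lemma is_form_lin_form: "(\<And>i. smooth (v i)) \<Longrightarrow> is_form 1 0 (lin_form v)"
  unfolding is_form_def
proof (intro conjI allI impI)
  show "smooth (lin_form v K L)" if "\<And>i. smooth (v i)" for K L
  proof (cases "card K = 1 \<and> L = {}")
    case True
    then show ?thesis using that by (simp add: lin_form_def[abs_def])
  next
    case False
    then have "lin_form v K L = (\<lambda>x. 0)" by (auto simp: lin_form_def)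
    then show ?thesis by simp
  qed
qed (auto simp: lin_form_def)

lemma form_coeff_square:
  fixes v :: "'n::{finite,linorder} \<Rightarrow> real"
  shows "form_coeff (square v) K L =
    (if card K = 1 \<and> card L = 1 then v (the_elem K) * v (the_elem L) else 0)"
proof (cases "card K = 1 \<and> card L = 1")
  case True
  then obtain k l where "K = {k}" "L = {l}"
    by (auto simp: card_1_singleton_iff)
  then have "form_coeff (square v) K L =
      (\<Sum>i\<in>UNIV. \<Sum>j\<in>UNIV. if j = l then (if i = k then v i * v j else 0) else 0)"
    unfolding square_def form_coeff_sum form_coeff_simps form_coeff_elem
    by (intro sum.cong refl) auto
  then show ?thesis
    using \<open>K = {k}\<close> \<open>L = {l}\<close> by simp
next
  case False
  then have "form_coeff (elem i j) K L = 0" for i j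
    by (auto simp: form_coeff_elem)
  then show ?thesis
    using False unfolding square_def by auto
qed

text \<open>In the double sum that defines the wedge product only one term survives, with $dx$-part
taken from the first factor and $d\xi$-part from the second, and its sign is $+1$.\<close>

lemma square_at_point:
  "even_superform (lin_form v \<and>\<^sub>f J_op (lin_form v)) \<and>
   at_point (lin_form v \<and>\<^sub>f J_op (lin_form v)) = (\<lambda>x. square (\<lambda>i. v i x))"
proof (rule even_superform_eqI)
  fix K L :: "'a set" and x
  have "(lin_form v \<and>\<^sub>f J_op (lin_form v)) K L x =
     (\<Sum>I\<in>Pow K. \<Sum>J\<in>Pow L. if I = K \<and> J = {} then lin_form v I {} x * lin_form v (L - J) {} x else 0)"
    unfolding wedge_def
  proof (intro sum.cong refl)
    fix I J assume "I \<in> Pow K" "J \<in> Pow L"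
    then show "wedge_sign I J (K - I) (L - J) * (lin_form v I J x * J_op (lin_form v) (K - I) (L - J) x) =
       (if I = K \<and> J = {} then lin_form v I {} x * lin_form v (L - J) {} x else 0)"
      by (cases "J = {}"; cases "K - I = {}") (auto simp: J_op_def lin_form_def)
  qed
  also have "\<dots> = lin_form v K {} x * lin_form v L {} x"
    unfolding sum_Pow_delta by simp
  finally show "(lin_form v \<and>\<^sub>f J_op (lin_form v)) K L x = form_coeff (square (\<lambda>i. v i x)) K L"
    by (auto simp: form_coeff_square lin_form_def)
qed

lemma square_of_bool: "square (\<lambda>j. of_bool (j = i)) = elem i i"
proof (rule even_form_eqI)
  show "form_coeff (square (\<lambda>j. of_bool (j = i))) K L = form_coeff (elem i i) K L" for K L
    by (auto simp: form_coeff_square form_coeff_elem card_1_singleton_iff)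
qed

lemma beta_coeff: "beta K L x = form_coeff kaehler K L"
proof -
  have "dx i = lin_form (\<lambda>j x. of_bool (j = i))" for i :: 'a
    by (auto simp: fun_eq_iff dx_def lin_form_def card_1_singleton_iff)
  moreover have "dxi i = J_op (dx i)" for i :: 'a
    by (auto simp: fun_eq_iff dxi_def J_op_def dx_def)
  ultimately have "(dx i \<and>\<^sub>f dxi i) K L x = form_coeff (elem i i) K L" for i
    using square_at_point[of "\<lambda>j x. of_bool (j = i)"] form_coeff_at_point
    unfolding square_of_bool by metis
  then show ?thesis
    by (simp add: beta_def kaehler_def)
qed

lemma wedge_power_beta_coeff: "wedge_power beta k K L x = form_coeff (kaehler ^ k) K L"
proof -
  have "even_superform (beta :: 'a superform)" "at_point (beta :: 'a superform) = (\<lambda>x. kaehler)"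
    using even_superform_eqI[of beta "\<lambda>x. kaehler", OF beta_coeff] by auto
  then show ?thesis
    using wedge_list_at_point[of "replicate k (beta :: 'a superform)"] form_coeff_at_point
    unfolding wedge_power_def by (metis (no_types, lifting) in_set_replicate map_replicate prod_list_replicate)
qed

section \<open>Pairing a current with a field of even forms\<close>

definition pair :: "'n::{finite,linorder} current \<Rightarrow> (real ^ 'n::{finite,linorder} \<Rightarrow> 'n even_form) \<Rightarrow> real" where
  "pair T \<Phi> = pairing T (\<lambda>K L x. form_coeff (\<Phi> x) K L)"

definition test_field :: "(real ^ 'n::{finite,linorder} \<Rightarrow> 'n::{finite,linorder} even_form) \<Rightarrow> bool" where
  "test_field \<Phi> \<longleftrightarrow> (\<forall>K L. test_fun (\<lambda>x. form_coeff (\<Phi> x) K L))"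

definition smooth_field :: "(real ^ 'n::{finite,linorder} \<Rightarrow> 'n::{finite,linorder} even_form) \<Rightarrow> bool" where
  "smooth_field \<Phi> \<longleftrightarrow> (\<forall>K L. smooth (\<lambda>x. form_coeff (\<Phi> x) K L))"

lemma smooth_field_const [intro]: "smooth_field (\<lambda>x. A)"
  by (auto simp: smooth_field_def)

lemma smooth_field_scaleR [intro]:
  "smooth f \<Longrightarrow> smooth_field \<Phi> \<Longrightarrow> smooth_field (\<lambda>x. f x *\<^sub>R \<Phi> x)"
  by (auto simp: smooth_field_def)

lemma smooth_field_sum [intro]:
  "(\<And>s. s \<in> F \<Longrightarrow> smooth_field (\<Phi> s)) \<Longrightarrow> smooth_field (\<lambda>x. \<Sum>s\<in>F. \<Phi> s x)"
  by (auto simp: smooth_field_def)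

lemma smooth_field_mult [intro]:
  "smooth_field \<Phi> \<Longrightarrow> smooth_field \<Psi> \<Longrightarrow> smooth_field (\<lambda>x. \<Phi> x * \<Psi> x)"
  unfolding smooth_field_def form_coeff_mult by (intro allI smooth_sum smooth_mult smooth_const) auto

lemma smooth_field_power [intro]: "smooth_field \<Phi> \<Longrightarrow> smooth_field (\<lambda>x. \<Phi> x ^ k)"
  by (induction k) auto

lemma smooth_field_prod_list [intro]:
  "(\<And>v. v \<in> set vs \<Longrightarrow> smooth_field (\<Phi> v)) \<Longrightarrow> smooth_field (\<lambda>x. prod_list (map (\<lambda>v. \<Phi> v x) vs))"
  by (induction vs) auto

lemma smooth_field_square [intro]: "(\<And>i. smooth (v i)) \<Longrightarrow> smooth_field (\<lambda>x. square (\<lambda>i. v i x))"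
  unfolding square_def by (intro smooth_field_sum smooth_field_scaleR smooth_mult) auto

lemma test_field_scaleR [intro]:
  "test_fun f \<Longrightarrow> smooth_field \<Phi> \<Longrightarrow> test_field (\<lambda>x. f x *\<^sub>R \<Phi> x)"
  by (auto simp: smooth_field_def test_field_def)

lemma pairing_eq:
  "pairing T \<alpha> = (\<Sum>I\<in>Pow UNIV. \<Sum>J\<in>Pow UNIV. wedge_sign I J (UNIV - I) (UNIV - J) *
     T I J (\<lambda>x. \<alpha> (UNIV - I) (UNIV - J) x)) / (volume_form :: 'n superform) UNIV UNIV 0"
  for T :: "'n::{finite,linorder} current"
  by (simp add: pairing_def top_distr_def current_wedge_def)

lemma pair_eq:
  "pair T \<Phi> = (\<Sum>I\<in>Pow UNIV. \<Sum>J\<in>Pow UNIV. wedge_sign I J (UNIV - I) (UNIV - J) *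
     T I J (\<lambda>x. form_coeff (\<Phi> x) (UNIV - I) (UNIV - J))) / (volume_form :: 'n superform) UNIV UNIV 0"
  for T :: "'n::{finite,linorder} current"
  by (simp add: pair_def pairing_eq)

lemma distribution_add:
  "distribution u \<Longrightarrow> test_fun f \<Longrightarrow> test_fun g \<Longrightarrow> u (\<lambda>x. f x + g x) = u f + u g"
  by (simp add: distribution_def)

lemma distribution_cmult: "distribution u \<Longrightarrow> test_fun f \<Longrightarrow> u (\<lambda>x. c * f x) = c * u f"
  by (simp add: distribution_def)

lemma distribution_zero: "distribution u \<Longrightarrow> u (\<lambda>x. 0) = 0"
  using distribution_cmult[of u "\<lambda>x. 0" 0] by simp

lemma pair_zero: "(\<And>I J. distribution (T I J)) \<Longrightarrow> pair T (\<lambda>x. 0) = 0"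
  by (simp add: pair_eq distribution_zero)

lemma pair_add:
  assumes "\<And>I J. distribution (T I J)" "test_field \<Phi>" "test_field \<Psi>"
  shows "pair T (\<lambda>x. \<Phi> x + \<Psi> x) = pair T \<Phi> + pair T \<Psi>"
proof -
  have "T I J (\<lambda>x. form_coeff (\<Phi> x) K L + form_coeff (\<Psi> x) K L) =
      T I J (\<lambda>x. form_coeff (\<Phi> x) K L) + T I J (\<lambda>x. form_coeff (\<Psi> x) K L)" for I J K L
    by (rule distribution_add) (use assms in \<open>auto simp: test_field_def\<close>)
  then show ?thesis
    by (simp add: pair_eq algebra_simps sum.distrib add_divide_distrib)
qed

lemma pair_cmult:
  assumes "\<And>I J. distribution (T I J)" "test_field \<Phi>"
  shows "pair T (\<lambda>x. c *\<^sub>R \<Phi> x) = c * pair T \<Phi>"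
proof -
  have "T I J (\<lambda>x. c * form_coeff (\<Phi> x) K L) = c * T I J (\<lambda>x. form_coeff (\<Phi> x) K L)" for I J K L
    by (rule distribution_cmult) (use assms in \<open>auto simp: test_field_def\<close>)
  then show ?thesis
    by (simp add: pair_eq sum_distrib_left mult_ac)
qed

lemma test_field_sum [intro]:
  "(\<And>s. s \<in> F \<Longrightarrow> test_field (\<Phi> s)) \<Longrightarrow> test_field (\<lambda>x. \<Sum>s\<in>F. \<Phi> s x)"
  by (auto simp: test_field_def)

lemma pair_sum:
  assumes "\<And>I J. distribution (T I J)" "\<And>s. s \<in> F \<Longrightarrow> test_field (\<Phi> s)"
  shows "pair T (\<lambda>x. \<Sum>s\<in>F. \<Phi> s x) = (\<Sum>s\<in>F. pair T (\<Phi> s))"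
  using assms(2)
proof (induction F rule: infinite_finite_induct)
  case (insert s F)
  then show ?case
    using pair_add[where T = T, OF assms(1), of "\<Phi> s" "\<lambda>x. \<Sum>s\<in>F. \<Phi> s x"] by auto
qed (simp_all add: pair_zero[OF assms(1)])

lemma top_distr_wedge_power_beta:
  "top_distr (T \<and>\<^sub>c wedge_power beta p) \<phi> = pair T (\<lambda>x. \<phi> x *\<^sub>R kaehler ^ p)"
  by (simp add: top_distr_def current_wedge_def pair_eq wedge_power_beta_coeff mult.commute)

lemma weakly_positive_distribution: "weakly_positive p T \<Longrightarrow> distribution (T I J)"
  by (simp add: weakly_positive_def is_current_def)

lemma pair_nonneg_squares:
  fixes T :: "'n::{finite,linorder} current"
  assumes "weakly_positive p T" and f: "test_fun f" "\<And>x. 0 \<le> f x"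
    and vs: "length vs = p" "\<And>v i. v \<in> set vs \<Longrightarrow> smooth (v i)"
  shows "0 \<le> pair T (\<lambda>x. f x *\<^sub>R prod_list (map (\<lambda>v. square (\<lambda>i. v i x)) vs))"
proof -
  let ?\<alpha> = "wedge_list (map (\<lambda>s. lin_form (vs ! s) \<and>\<^sub>f J_op (lin_form (vs ! s))) [0..<p])"
  let ?\<Phi> = "\<lambda>x. f x *\<^sub>R prod_list (map (\<lambda>v. square (\<lambda>i. v i x)) vs)"
  have map: "map (\<lambda>s. lin_form (vs ! s) \<and>\<^sub>f J_op (lin_form (vs ! s))) [0..<p] =
      map (\<lambda>v. lin_form v \<and>\<^sub>f J_op (lin_form v)) vs"
    using vs(1) by (auto intro: nth_equalityI)
  have "at_point (lin_form v \<and>\<^sub>f J_op (lin_form v)) = (\<lambda>x. square (\<lambda>i. v i x))" for v :: "'n \<Rightarrow> _"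
    using square_at_point by blast
  then have "even_superform ?\<alpha> \<and> at_point ?\<alpha> = (\<lambda>x. prod_list (map (\<lambda>v. square (\<lambda>i. v i x)) vs))"
    unfolding map using wedge_list_at_point[of "map (\<lambda>v. lin_form v \<and>\<^sub>f J_op (lin_form v)) vs"]
      square_at_point by (simp add: image_iff o_def) blast
  then have \<alpha>: "form_coeff (prod_list (map (\<lambda>v. square (\<lambda>i. v i x)) vs)) K L = ?\<alpha> K L x" for K L x
    using form_coeff_at_point[of ?\<alpha> x K L] by simp
  have "strongly_positive p (\<lambda>K L x. form_coeff (?\<Phi> x) K L)"
    unfolding strongly_positive_def
  proof (intro exI conjI)
    show "\<forall>s<1::nat. smooth f \<and> (\<forall>x. 0 \<le> f x)"
      using f test_fun_smooth by blast
    show "\<forall>s<1::nat. \<forall>i<p. is_form 1 0 (lin_form (vs ! i))"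
      using vs by (intro allI impI is_form_lin_form) auto
    show "(\<lambda>K L x. form_coeff (?\<Phi> x) K L) = (\<lambda>K L x. \<Sum>s<1::nat. f x * ?\<alpha> K L x)"
      by (simp add: \<alpha>)
  qed
  moreover have "test_field ?\<Phi>"
    using f vs(2) by (intro test_field_scaleR smooth_field_prod_list smooth_field_square) auto
  then have "compactly_supported (\<lambda>K L x. form_coeff (?\<Phi> x) K L)"
    by (simp add: compactly_supported_def test_field_def test_fun_def)
  ultimately show ?thesis
    using assms(1) by (simp add: weakly_positive_def pair_def)
qed

text \<open>Expanding the power gives a sum of products of squares, and each product is a strongly positive form.
The induction expands one factor at a time, keeping the factors already chosen in a list; so the full
multinomial expansion need not be written down.\<close>

lemma pair_nonneg_sum_of_squares_power:
  fixes T :: "'n::{finite,linorder} current" and v :: "'s \<Rightarrow> 'n \<Rightarrow> real ^ 'n::{finite,linorder} \<Rightarrow> real"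
  assumes T: "weakly_positive p T" and f: "test_fun f" "\<And>x. 0 \<le> f x"
    and v: "\<And>s i. s \<in> F \<Longrightarrow> smooth (v s i)"
  shows "0 \<le> pair T (\<lambda>x. f x *\<^sub>R (\<Sum>s\<in>F. square (\<lambda>i. v s i x)) ^ p)"
proof -
  let ?\<tau> = "\<lambda>x. \<Sum>s\<in>F. square (\<lambda>i. v s i x)"
  have "0 \<le> pair T (\<lambda>x. f x *\<^sub>R (prod_list (map (\<lambda>w. square (\<lambda>i. w i x)) vs) * ?\<tau> x ^ k))"
    if "length vs + k = p" "\<And>w i. w \<in> set vs \<Longrightarrow> smooth (w i)" for vs k
    using that
  proof (induction k arbitrary: vs)
    case 0
    then show ?case
      using pair_nonneg_squares[OF T f, of vs] by simp
  next
    case (Suc k)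
    let ?\<Phi> = "\<lambda>s x. f x *\<^sub>R (prod_list (map (\<lambda>w. square (\<lambda>i. w i x)) (v s # vs)) * ?\<tau> x ^ k)"
    have "test_field (?\<Phi> s)" if "s \<in> F" for s
      using f v that Suc.prems
      by (intro test_field_scaleR smooth_field_mult smooth_field_power smooth_field_sum
          smooth_field_prod_list smooth_field_square) auto
    then have "pair T (\<lambda>x. \<Sum>s\<in>F. ?\<Phi> s x) = (\<Sum>s\<in>F. pair T (?\<Phi> s))"
      by (intro pair_sum weakly_positive_distribution[OF T])
    moreover have "0 \<le> pair T (?\<Phi> s)" if "s \<in> F" for s
      using that v Suc.prems by (intro Suc.IH) auto
    moreover have "(\<Sum>s\<in>F. ?\<Phi> s x) =
        f x *\<^sub>R (prod_list (map (\<lambda>w. square (\<lambda>i. w i x)) vs) * ?\<tau> x ^ Suc k)" for x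
      by (simp add: scaleR_sum_right[symmetric] sum_distrib_left sum_distrib_right mult_ac)
    ultimately show ?case
      by (simp add: sum_nonneg)
  qed
  from this[of "[]" p] show ?thesis by simp
qed


section \<open>The convexity condition tested on a function\<close>

text \<open>The assumption on \<open>T\<close> is needed because the sum in the definition also evaluates \<open>T\<close> on the
zero function.\<close>

lemma form_wedge_current_monomial:
  assumes "\<And>I J. T I J (\<lambda>x. 0) = 0" "\<And>I J x. \<alpha> I J x = (if I = A \<and> J = B then 1 else 0)"
  shows "form_wedge_current \<alpha> T M N \<phi> =
    (if A \<subseteq> M \<and> B \<subseteq> N then wedge_sign A B (M - A) (N - B) * T (M - A) (N - B) \<phi> else 0)"
proof -
  have "form_wedge_current \<alpha> T M N \<phi> = (\<Sum>I\<in>Pow M. \<Sum>J\<in>Pow N. if I = A \<and> J = B then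
      wedge_sign I J (M - I) (N - J) * T (M - I) (N - J) \<phi> else 0)"
    unfolding form_wedge_current_def assms(2)
    by (intro sum.cong refl) (auto simp: assms(1))
  then show ?thesis
    unfolding sum_Pow_delta .
qed

lemma partial_zero: "partial i (\<lambda>x. 0) = (\<lambda>x. 0)"
  by (rule ext, rule partial_eqI[where D = "\<lambda>h. 0"]) simp

lemma dd_sharp_top:
  assumes S: "\<And>I J. S I J (\<lambda>x. 0) = 0"
  shows "d_current (d_sharp_current S) UNIV UNIV \<phi> =
    (\<Sum>i\<in>UNIV. \<Sum>j\<in>UNIV. wedge_sign {i} {j} (UNIV - {i}) (UNIV - {j}) *
       S (UNIV - {i}) (UNIV - {j}) (partial j (partial i \<phi>)))"
proof -
  have ds: "d_sharp_current S M N \<phi> = (\<Sum>j\<in>UNIV. if j \<in> N then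
      wedge_sign {} {j} M (N - {j}) * - S M (N - {j}) (partial j \<phi>) else 0)" for M N \<phi>
    unfolding d_sharp_current_def
    by (intro sum.cong refl, subst form_wedge_current_monomial[where A = "{}"])
       (auto simp: partial_distr_def partial_zero S dxi_def)
  then have ds0: "d_sharp_current S M N (\<lambda>x. 0) = 0" for M N
    by (auto simp: partial_zero S intro!: sum.neutral)
  have "d_current (d_sharp_current S) UNIV UNIV \<phi> =
     (\<Sum>i\<in>UNIV. wedge_sign {i} {} (UNIV - {i}) UNIV * - d_sharp_current S (UNIV - {i}) UNIV (partial i \<phi>))"
    unfolding d_current_def
    by (intro sum.cong refl, subst form_wedge_current_monomial[where B = "{}"])
       (auto simp: partial_distr_def partial_zero ds0 dx_def)
  also have "\<dots> = (\<Sum>i\<in>UNIV. \<Sum>j\<in>UNIV. wedge_sign {i} {} (UNIV - {i}) UNIV *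
      wedge_sign {} {j} (UNIV - {i}) (UNIV - {j}) * S (UNIV - {i}) (UNIV - {j}) (partial j (partial i \<phi>)))"
    unfolding ds by (simp add: sum_distrib_left sum_negf mult.assoc)
  also have "\<dots> = (\<Sum>i\<in>UNIV. \<Sum>j\<in>UNIV. wedge_sign {i} {j} (UNIV - {i}) (UNIV - {j}) *
       S (UNIV - {i}) (UNIV - {j}) (partial j (partial i \<phi>)))"
  proof (intro sum.cong refl arg_cong2[where f = "(*)"])
    fix i j :: 'a
    have "{j} \<union> (UNIV - {j}) = UNIV" by auto
    then show "wedge_sign {i} {} (UNIV - {i}) UNIV * wedge_sign {} {j} (UNIV - {i}) (UNIV - {j}) =
       wedge_sign {i} {j} (UNIV - {i}) (UNIV - {j})"
      using wedge_sign_cocycle[of "{i}" "{}" "UNIV - {i}" "{}" "{j}" "UNIV - {j}"] by simp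
  qed
  finally show ?thesis .
qed

text \<open>An instance of associativity, $(T \wedge \alpha) \wedge dx_i \wedge d\xi_j = T \wedge (dx_i \wedge d\xi_j \wedge \alpha)$,
in top degree. The sign on the left is the one that \<open>dd_sharp_top\<close> produces.\<close>

lemma current_wedge_elem:
  fixes T :: "'n::{finite,linorder} current"
  assumes T: "\<And>I J. distribution (T I J)" and \<alpha>: "\<And>K L x. \<alpha> K L x = form_coeff A K L"
    and \<psi>: "test_fun \<psi>"
  shows "wedge_sign {i} {j} (UNIV - {i}) (UNIV - {j}) *
      (T \<and>\<^sub>c \<alpha>) (UNIV - {i}) (UNIV - {j}) \<psi> / (volume_form :: 'n superform) UNIV UNIV 0 =
    pair T (\<lambda>x. \<psi> x *\<^sub>R (elem i j * A))"
proof -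
  let ?U = "UNIV :: 'n set"
  let ?c = "\<lambda>I J. form_coeff A (?U - I - {i}) (?U - J - {j})"
  let ?G = "\<lambda>I J. wedge_sign I J (?U - I) (?U - J) * (wedge_sign {i} {j} (?U - I - {i}) (?U - J - {j}) *
      T I J (\<lambda>x. ?c I J * \<psi> x))"
  have "wedge_sign {i} {j} (?U - {i}) (?U - {j}) * (T \<and>\<^sub>c \<alpha>) (?U - {i}) (?U - {j}) \<psi> =
    (\<Sum>I\<in>Pow (?U - {i}). \<Sum>J\<in>Pow (?U - {j}). ?G I J)"
    unfolding current_wedge_def sum_distrib_left
  proof (intro sum.cong refl)
    fix I J assume *: "I \<in> Pow (?U - {i})" "J \<in> Pow (?U - {j})"
    define R R' where "R = ?U - I - {i}" and "R' = ?U - J - {j}"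
    have sets: "?U - {i} = I \<union> R" "?U - {j} = J \<union> R'" "?U - I = {i} \<union> R" "?U - J = {j} \<union> R'"
        "I \<union> R - I = R" "J \<union> R' - J = R'" "{i} \<union> R - {i} = R" "{j} \<union> R' - {j} = R'"
      using * by (auto simp: R_def R'_def)
    have disj: "{i} \<inter> I = {}" "{j} \<inter> J = {}" "{i} \<inter> R = {}" "{j} \<inter> R' = {}" "I \<inter> R = {}" "J \<inter> R' = {}"
      using * by (auto simp: R_def R'_def)
    have "wedge_sign {i} {j} (I \<union> R) (J \<union> R') * wedge_sign I J R R' =
        wedge_sign {i} {j} I J * wedge_sign {i} {j} R R' * wedge_sign I J R R'"
      using disj by (simp add: wedge_sign_Un_right)
    also have "wedge_sign {i} {j} I J = wedge_sign I J {i} {j}"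
      using disj by (intro wedge_sign_swap) auto
    also have "\<dots> * wedge_sign {i} {j} R R' * wedge_sign I J R R' =
        wedge_sign I J ({i} \<union> R) ({j} \<union> R') * wedge_sign {i} {j} R R'"
      by (subst wedge_sign_Un_right) (use disj in auto)
    finally have sign: "wedge_sign {i} {j} (I \<union> R) (J \<union> R') * wedge_sign I J R R' =
        wedge_sign I J ({i} \<union> R) ({j} \<union> R') * wedge_sign {i} {j} R R'" .
    show "wedge_sign {i} {j} (?U - {i}) (?U - {j}) * (wedge_sign I J (?U - {i} - I) (?U - {j} - J) *
        T I J (\<lambda>x. \<alpha> (?U - {i} - I) (?U - {j} - J) x * \<psi> x)) = ?G I J"
      by (simp only: sets \<alpha> sign flip: mult.assoc)
  qed
  also have "\<dots> = (\<Sum>I\<in>Pow ?U. \<Sum>J\<in>Pow ?U. if i \<notin> I \<and> j \<notin> J then ?G I J else 0)"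
  proof -
    have eq: "(\<Sum>I\<in>Pow (?U - {k}). F I) = (\<Sum>I\<in>Pow ?U. if k \<notin> I then F I else 0)" for k F
      by (rule sum.mono_neutral_cong_left) auto
    show ?thesis
      unfolding eq by (auto intro!: sum.cong)
  qed
  also have "\<dots> = (\<Sum>I\<in>Pow ?U. \<Sum>J\<in>Pow ?U. wedge_sign I J (?U - I) (?U - J) *
     T I J (\<lambda>x. form_coeff (\<psi> x *\<^sub>R (elem i j * A)) (?U - I) (?U - J)))"
  proof (intro sum.cong refl)
    fix I J
    let ?w = "wedge_sign {i} {j} (?U - I - {i}) (?U - J - {j})"
    have "test_fun (\<lambda>x. ?c I J * \<psi> x)"
      using \<psi> by auto
    from distribution_cmult[OF T this, of I J ?w]
    have "T I J (\<lambda>x. \<psi> x * (?w * ?c I J)) = ?w * T I J (\<lambda>x. ?c I J * \<psi> x)"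
      by (simp add: mult_ac)
    moreover have "T I J (\<lambda>x. 0) = 0"
      using T by (rule distribution_zero)
    ultimately show "(if i \<notin> I \<and> j \<notin> J then ?G I J else 0) = wedge_sign I J (?U - I) (?U - J) *
        T I J (\<lambda>x. form_coeff (\<psi> x *\<^sub>R (elem i j * A)) (?U - I) (?U - J))"
      by (auto simp: form_coeff_elem_mult)
  qed
  finally show ?thesis
    by (simp add: pair_eq)
qed

lemma pairing_function:
  fixes D :: "'n::{finite,linorder} current"
  assumes "\<And>I J. D I J (\<lambda>x. 0) = 0"
  shows "pairing D (\<lambda>K L x. f x * one_form K L x) = D UNIV UNIV f / (volume_form :: 'n superform) UNIV UNIV 0"
proof -
  have top: "wedge_sign I J (UNIV - I) (UNIV - J) * D I J (\<lambda>x. f x * one_form (UNIV - I) (UNIV - J) x) =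
     (if I = UNIV \<and> J = UNIV then D I J f else 0)" for I J
    by (auto simp: one_form_def assms)
  show ?thesis
    unfolding pairing_eq top sum_Pow_delta by simp
qed

text \<open>Integration by parts: $\int f\, dd^{\#}(T \wedge \beta^k) = \int T \wedge \beta^k \wedge dd^{\#}f$.\<close>

lemma convex_current_test:
  fixes T :: "'n::{finite,linorder} current"
  assumes T: "weakly_positive p T" and conv: "convex_current 1 (T \<and>\<^sub>c wedge_power beta k)"
    and f: "test_fun f" "\<And>x. 0 \<le> f x" and ff: "\<And>i j. test_fun (partial j (partial i f))"
  shows "0 \<le> pair T (\<lambda>x. kaehler ^ k * (\<Sum>i\<in>UNIV. \<Sum>j\<in>UNIV. partial j (partial i f) x *\<^sub>R elem i j))"
proof -
  note TD = weakly_positive_distribution[OF T]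
  let ?S = "T \<and>\<^sub>c wedge_power beta k" and ?v = "(volume_form :: 'n superform) UNIV UNIV 0"
  let ?D = "d_current (d_sharp_current ?S)"
  have D: "weakly_positive 0 ?D"
    using conv by (simp add: convex_current_def)
  have S0: "?S I J (\<lambda>x. 0) = 0" for I J
    by (auto simp: current_wedge_def distribution_zero[OF TD] intro!: sum.neutral)
  have "strongly_positive 0 (\<lambda>K L x. f x * one_form K L x :: real)"
    unfolding strongly_positive_def
    by (rule exI[of _ 1], rule exI[of _ "\<lambda>s. f"]) (use f in \<open>auto simp: wedge_list_def test_fun_smooth\<close>)
  moreover have "compactly_supported (\<lambda>K L x. f x * one_form K L x)"
    unfolding compactly_supported_def
    by (intro allI test_fun_compact) (use f in \<open>auto simp: one_form_def\<close>)
  ultimately have "0 \<le> pairing ?D (\<lambda>K L x. f x * one_form K L x)"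
    using D by (simp add: weakly_positive_def)
  also have "\<dots> = ?D UNIV UNIV f / ?v"
    by (intro pairing_function distribution_zero[OF weakly_positive_distribution[OF D]])
  also have "\<dots> = (\<Sum>i\<in>UNIV. \<Sum>j\<in>UNIV. pair T (\<lambda>x. partial j (partial i f) x *\<^sub>R (elem i j * kaehler ^ k)))"
    unfolding dd_sharp_top[where S = ?S, OF S0] sum_divide_distrib
    by (intro sum.cong refl current_wedge_elem TD wedge_power_beta_coeff ff)
  also have "\<dots> = pair T (\<lambda>x. \<Sum>i\<in>UNIV. \<Sum>j\<in>UNIV. partial j (partial i f) x *\<^sub>R (elem i j * kaehler ^ k))"
    using ff by (simp add: pair_sum[where T = T, OF TD] test_field_sum test_field_scaleR smooth_field_const)
  also have "(\<lambda>x. \<Sum>i\<in>UNIV. \<Sum>j\<in>UNIV. partial j (partial i f) x *\<^sub>R (elem i j * kaehler ^ k)) =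
      (\<lambda>x. kaehler ^ k * (\<Sum>i\<in>UNIV. \<Sum>j\<in>UNIV. partial j (partial i f) x *\<^sub>R elem i j))"
    by (simp add: sum_distrib_left mult.commute)
  finally show ?thesis .
qed

section \<open>Smooth cutoff functions\<close>

lemma flat_1_pos: "s > 0 \<Longrightarrow> flat 1 s > 0"
  by (simp add: flat_def)

lemma flat_1_nonneg [simp]: "flat 1 s \<ge> 0"
  by (simp add: flat_def)

lemma flat_1_le_1 [simp]: "flat 1 s \<le> 1"
  by (simp add: flat_def)

lemma flat_1_mono: "s \<le> t \<Longrightarrow> flat 1 s \<le> flat 1 t"
  by (auto simp: flat_def le_imp_inverse_le)

text \<open>With $e(s) = \exp(-1/s)$ this is $e(e(1) - e(1 - y)) / e(e(1))$. For $y \ge 1$ the inner term $e(1 - y)$ vanishes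
and the quotient is 1; for $y \le 0$ the inner term is at least $e(1)$, and the outer $e$ vanishes. Its
smoothness is that of a composition of $e$ with affine functions and with itself.\<close>

definition smooth_step :: "real \<Rightarrow> real" where
  "smooth_step y = inverse (flat 1 (flat 1 1)) * flat 1 (flat 1 1 + - 1 * flat 1 (1 + - 1 * y))"

lemma smooth_step_0: "y \<le> 0 \<Longrightarrow> smooth_step y = 0"
  using flat_1_mono[of 1 "1 - y"] by (simp add: smooth_step_def)

lemma smooth_step_1: "y \<ge> 1 \<Longrightarrow> smooth_step y = 1"
  using flat_1_pos[OF flat_1_pos[of 1]] by (simp add: smooth_step_def)

lemma smooth_step_bounds: "0 \<le> smooth_step y" "smooth_step y \<le> 1"
proof -
  have "flat 1 (flat 1 1) > 0"
    by (intro flat_1_pos) simp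
  moreover have "flat 1 (flat 1 1 - flat 1 (1 - y)) \<le> flat 1 (flat 1 1)"
    by (intro flat_1_mono) simp
  ultimately show "0 \<le> smooth_step y" "smooth_step y \<le> 1"
    by (simp_all add: smooth_step_def field_simps)
qed

lemma smooth_smooth_step [intro]: "smooth f \<Longrightarrow> smooth (\<lambda>x. smooth_step (f x))"
  unfolding smooth_step_def by (intro smooth_mult smooth_add smooth_flat smooth_const)

definition cutoffs :: "(real ^ 'n::finite) set \<Rightarrow> (real ^ 'n \<Rightarrow> real) set" where
  "cutoffs U = {f. test_fun f \<and> (\<forall>x. 0 \<le> f x \<and> f x \<le> 1) \<and> supp f \<subseteq> U}"

text \<open>A finite sum of bumps that is positive on \<open>K\<close> is bounded below there by some \<open>c > 0\<close>; composing it with a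
smooth step between 0 and \<open>c / 2\<close> makes it equal to 1 not only on \<open>K\<close> but on a neighbourhood of \<open>K\<close>.\<close>

lemma smooth_urysohn:
  fixes K :: "(real ^ 'n::finite) set"
  assumes K: "compact K" and U: "open U" "K \<subseteq> U"
  obtains f W where "f \<in> cutoffs U" "open W" "K \<subseteq> W" "\<And>x. x \<in> W \<Longrightarrow> f x = 1"
proof -
  have "\<exists>r>0. cball x r \<subseteq> U" if "x \<in> K" for x
    using U that open_contains_cball by blast
  then obtain r where r: "\<And>x. x \<in> K \<Longrightarrow> r x > 0" "\<And>x. x \<in> K \<Longrightarrow> cball x (r x) \<subseteq> U"
    by metis
  have "K \<subseteq> (\<Union>x\<in>K. ball x (r x))" using r(1) by force
  then obtain C where C: "C \<subseteq> K" "finite C" "K \<subseteq> (\<Union>x\<in>C. ball x (r x))"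
    using compactE_image[OF K, of K "\<lambda>x. ball x (r x)"] by (metis open_ball)
  define g where "g y = (\<Sum>x\<in>C. flat 1 ((r x)\<^sup>2 - dist_sq x y))" for y
  have smooth_g: "smooth g"
    unfolding g_def by (intro smooth_sum smooth_flat smooth_diff smooth_const smooth_dist_sq)
  have g_pos: "g y > 0" if y: "y \<in> K" for y
  proof -
    obtain x where x: "x \<in> C" "y \<in> ball x (r x)" using y C(3) by blast
    then have "(dist x y)\<^sup>2 < (r x)\<^sup>2" by (intro power_strict_mono) (auto simp: mem_ball)
    then have "flat 1 ((r x)\<^sup>2 - dist_sq x y) > 0" by (intro flat_1_pos) (simp add: dist_sq)
    then show ?thesis
      unfolding g_def using x(1) C(2) by (intro sum_pos2[of C x]) auto
  qed
  have g_zero: "g y = 0" if "y \<notin> (\<Union>x\<in>C. cball x (r x))" for y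
    unfolding g_def
  proof (intro sum.neutral ballI flat_nonpos)
    fix x assume "x \<in> C"
    then have "r x \<le> dist x y" "0 \<le> r x" using that r(1) C(1) by force+
    then show "(r x)\<^sup>2 - dist_sq x y \<le> 0" by (simp add: dist_sq power_mono)
  qed
  obtain c where c: "c > 0" "\<And>y. y \<in> K \<Longrightarrow> c \<le> g y"
  proof (cases "K = {}")
    case False
    obtain z where "z \<in> K" "\<And>y. y \<in> K \<Longrightarrow> g z \<le> g y"
      using continuous_attains_inf[OF K False smooth_continuous[OF smooth_g]] by blast
    then show ?thesis using that[of "g z"] g_pos by blast
  qed (use that[of 1] in auto)
  define f where "f y = smooth_step (2 / c * g y)" for y
  let ?L = "\<Union>x\<in>C. cball x (r x)"
  have L: "compact ?L" using C(2) by (intro compact_UN) auto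
  have f0: "f y = 0" if "y \<notin> ?L" for y
    using g_zero[OF that] by (simp add: f_def smooth_step_0)
  have "smooth f" unfolding f_def by (intro smooth_smooth_step smooth_mult smooth_const smooth_g)
  then have "test_fun f" using L f0 by (rule test_funI)
  moreover have "supp f \<subseteq> ?L" by (rule supp_subset[OF compact_imp_closed[OF L] f0])
  then have "supp f \<subseteq> U" using r(2) C(1) by blast
  ultimately have "f \<in> cutoffs U"
    by (simp add: cutoffs_def f_def smooth_step_bounds)
  moreover have "open {y. c / 2 < g y}"
    by (intro open_Collect_less continuous_on_const smooth_continuous smooth_g)
  moreover have "K \<subseteq> {y. c / 2 < g y}"
  proof
    fix y assume "y \<in> K"
    then show "y \<in> {y. c / 2 < g y}" using c(2)[of y] c(1) by simp
  qed
  moreover have "f x = 1" if "x \<in> {y. c / 2 < g y}" for x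
    using that c(1) unfolding f_def by (intro smooth_step_1) (simp add: field_simps)
  ultimately show thesis by (rule that)
qed

section \<open>Positive functionals are measures\<close>

definition positive_functional :: "'n::finite functional \<Rightarrow> bool" where
  "positive_functional u \<longleftrightarrow>
     (\<forall>f g. test_fun f \<longrightarrow> test_fun g \<longrightarrow> u (\<lambda>x. f x + g x) = u f + u g) \<and>
     (\<forall>c f. test_fun f \<longrightarrow> u (\<lambda>x. c * f x) = c * u f) \<and>
     (\<forall>f. test_fun f \<longrightarrow> (\<forall>x. 0 \<le> f x) \<longrightarrow> 0 \<le> u f)"

lemma positive_functional_add:
  "positive_functional u \<Longrightarrow> test_fun f \<Longrightarrow> test_fun g \<Longrightarrow> u (\<lambda>x. f x + g x) = u f + u g"
  by (simp add: positive_functional_def)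

lemma positive_functional_cmult:
  "positive_functional u \<Longrightarrow> test_fun f \<Longrightarrow> u (\<lambda>x. c * f x) = c * u f"
  by (simp add: positive_functional_def)

lemma positive_functional_nonneg:
  "positive_functional u \<Longrightarrow> test_fun f \<Longrightarrow> (\<And>x. 0 \<le> f x) \<Longrightarrow> 0 \<le> u f"
  by (simp add: positive_functional_def)

lemma positive_functional_mono:
  assumes u: "positive_functional u" and f: "test_fun f" and g: "test_fun g" and le: "\<And>x. f x \<le> g x"
  shows "u f \<le> u g"
proof -
  have diff: "test_fun (\<lambda>x. g x - f x)" using f g by auto
  then have "0 \<le> u (\<lambda>x. g x - f x)"
    using le by (intro positive_functional_nonneg[OF u]) auto
  moreover have "u (\<lambda>x. f x + (g x - f x)) = u f + u (\<lambda>x. g x - f x)"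
    by (rule positive_functional_add[OF u f diff])
  ultimately show ?thesis by simp
qed

lemma positive_functional_sum:
  assumes "positive_functional u" "\<And>s. s \<in> F \<Longrightarrow> test_fun (f s)"
  shows "u (\<lambda>x. \<Sum>s\<in>F. f s x) = (\<Sum>s\<in>F. u (f s))"
  using assms(2)
proof (induction F rule: infinite_finite_induct)
  case (insert s F)
  then show ?case
    using positive_functional_add[OF assms(1), of "f s" "\<lambda>x. \<Sum>s\<in>F. f s x"] by auto
qed (use positive_functional_cmult[OF assms(1), of "\<lambda>x. 0" 0] in simp_all)

text \<open>The outer measure of the Riesz construction: open sets are measured by the test functions that they dominate,
arbitrary sets by the open sets that contain them.\<close>

definition open_content :: "'n::finite functional \<Rightarrow> (real ^ 'n) set \<Rightarrow> ennreal" where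
  "open_content u U = (SUP f\<in>cutoffs U. ennreal (u f))"

definition outer_content :: "'n::finite functional \<Rightarrow> (real ^ 'n) set \<Rightarrow> ennreal" where
  "outer_content u A = (INF U\<in>{U. open U \<and> A \<subseteq> U}. open_content u U)"

lemma zero_in_cutoffs: "(\<lambda>x. 0) \<in> cutoffs U"
  by (auto simp: cutoffs_def supp_def)

lemma cutoffs_mono: "U \<subseteq> V \<Longrightarrow> cutoffs U \<subseteq> cutoffs V"
  by (auto simp: cutoffs_def)

lemma open_content_upper: "f \<in> cutoffs U \<Longrightarrow> ennreal (u f) \<le> open_content u U"
  unfolding open_content_def by (rule SUP_upper)

lemma open_content_mono: "U \<subseteq> V \<Longrightarrow> open_content u U \<le> open_content u V"
  unfolding open_content_def by (rule SUP_subset_mono[OF cutoffs_mono]) auto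

lemma outer_content_lower: "open U \<Longrightarrow> A \<subseteq> U \<Longrightarrow> outer_content u A \<le> open_content u U"
  unfolding outer_content_def by (rule INF_lower) auto

lemma outer_content_open: "open U \<Longrightarrow> outer_content u U = open_content u U"
  by (rule antisym[OF outer_content_lower]) (auto simp: outer_content_def intro: INF_greatest open_content_mono)

lemma outer_content_mono: "A \<subseteq> B \<Longrightarrow> outer_content u A \<le> outer_content u B"
  unfolding outer_content_def by (rule INF_superset_mono) auto

text \<open>A test function supported in \<open>U \<union> V\<close> is cut into a part supported in \<open>U\<close> and a part supported in \<open>V\<close>,
with a cutoff that equals 1 near the compact set where the support leaves \<open>V\<close>.\<close>

lemma open_content_Un:
  assumes u: "positive_functional u" and U: "open U" "open V"
  shows "open_content u (U \<union> V) \<le> open_content u U + open_content u V"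
  unfolding open_content_def[of u "U \<union> V"]
proof (rule SUP_least)
  fix f assume "f \<in> cutoffs (U \<union> V)"
  then have f: "test_fun f" "\<And>x. 0 \<le> f x" "\<And>x. f x \<le> 1" "supp f \<subseteq> U \<union> V"
    by (auto simp: cutoffs_def)
  have "compact (supp f - V)"
    using f(1) U(2) by (intro compact_diff test_fun_compact)
  moreover have "supp f - V \<subseteq> U" using f(4) by auto
  ultimately obtain h W where h: "h \<in> cutoffs U" and W: "open W" "supp f - V \<subseteq> W"
    and h1: "\<And>x. x \<in> W \<Longrightarrow> h x = 1"
    using smooth_urysohn[OF _ U(1)] by metis
  have h': "smooth h" "\<And>x. 0 \<le> h x" "\<And>x. h x \<le> 1" "supp h \<subseteq> U"
    using h by (auto simp: cutoffs_def test_fun_smooth)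
  let ?f1 = "\<lambda>x. h x * f x" and ?f2 = "\<lambda>x. (1 - h x) * f x"
  have test: "test_fun ?f1" "test_fun ?f2"
    by (rule test_fun_mult[OF h'(1) f(1)], rule test_fun_mult[OF smooth_diff[OF smooth_const h'(1)] f(1)])
  have "supp ?f1 \<subseteq> supp h"
    by (rule supp_subset) (auto simp: zero_outside_supp[of _ h] closed_supp)
  then have f1: "?f1 \<in> cutoffs U"
    using test f h' by (auto simp: cutoffs_def mult_le_one)
  have "supp ?f2 \<subseteq> supp f - W"
  proof (rule supp_subset)
    show "closed (supp f - W)" using W(1) by (simp add: supp_def closed_Diff)
  qed (use h1 zero_outside_supp[of _ f] in auto)
  then have f2: "?f2 \<in> cutoffs V"
    using test f h' W by (auto simp: cutoffs_def mult_le_one)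
  have "u f = u (\<lambda>x. ?f1 x + ?f2 x)" by (simp add: algebra_simps)
  also have "\<dots> = u ?f1 + u ?f2" by (rule positive_functional_add[OF u test])
  finally have "ennreal (u f) = ennreal (u ?f1) + ennreal (u ?f2)"
    using positive_functional_nonneg[OF u test(1)] positive_functional_nonneg[OF u test(2)] f h'
    by (simp add: ennreal_plus)
  also have "\<dots> \<le> open_content u U + open_content u V"
    using f1 f2 by (intro add_mono open_content_upper)
  finally show "ennreal (u f) \<le> open_content u U + open_content u V" .
qed

lemma open_content_empty:
  assumes "positive_functional u"
  shows "open_content u {} = 0"
proof -
  have "f = (\<lambda>x. 0)" if "f \<in> cutoffs {}" for f :: "real ^ 'a \<Rightarrow> real"
    using that zero_outside_supp[of _ f] by (auto simp: cutoffs_def)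
  moreover have "u (\<lambda>x. 0) = 0"
    using positive_functional_cmult[OF assms, of "\<lambda>x. 0" 0] by simp
  ultimately show ?thesis
    unfolding open_content_def by (intro antisym SUP_least) auto
qed

lemma open_content_UN:
  assumes u: "positive_functional u" and U: "\<And>i::nat. open (U i)"
  shows "open_content u (\<Union>i. U i) \<le> (\<Sum>i. open_content u (U i))"
  unfolding open_content_def[of u "\<Union>i. U i"]
proof (rule SUP_least)
  fix f assume f: "f \<in> cutoffs (\<Union>i. U i)"
  then have "compact (supp f)" "supp f \<subseteq> (\<Union>i. U i)"
    by (auto simp: cutoffs_def test_fun_compact)
  then obtain C where C: "finite C" "supp f \<subseteq> (\<Union>i\<in>C. U i)"
    using U by (metis compactE_image)
  have "f \<in> cutoffs (\<Union>i\<in>C. U i)" using f C by (auto simp: cutoffs_def)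
  then have "ennreal (u f) \<le> open_content u (\<Union>i\<in>C. U i)"
    by (rule open_content_upper)
  also have "\<dots> \<le> (\<Sum>i\<in>C. open_content u (U i))"
    using C(1)
  proof (induction C)
    case (insert i C)
    then show ?case
      using open_content_Un[OF u U, of "\<Union>i\<in>C. U i" i] U
      by (auto intro!: order_trans[OF open_content_Un[OF u U]] add_mono)
  qed (simp add: open_content_empty[OF u])
  also have "\<dots> \<le> (\<Sum>i. open_content u (U i))"
    by (rule sum_le_suminf) (use C in auto)
  finally show "ennreal (u f) \<le> (\<Sum>i. open_content u (U i))" .
qed

lemma outer_content_outer_measure:
  assumes u: "positive_functional u"
  shows "outer_measure_space (Pow UNIV) (outer_content u)"
  unfolding outer_measure_space_def
proof (intro conjI)
  show "positive (Pow UNIV) (outer_content u)"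
    by (simp add: positive_def outer_content_open open_content_empty[OF u])
  show "increasing (Pow UNIV) (outer_content u)"
    by (simp add: increasing_def outer_content_mono)
  show "countably_subadditive (Pow UNIV) (outer_content u)"
    unfolding countably_subadditive_def
  proof (intro allI impI)
    fix A :: "nat \<Rightarrow> (real ^ 'a) set"
    show "outer_content u (\<Union>i. A i) \<le> (\<Sum>i. outer_content u (A i))"
    proof (rule ennreal_le_epsilon)
      fix e :: real assume "0 < e" "(\<Sum>n. outer_content u (A n)) < top"
      then have "outer_content u (A n) < outer_content u (A n) + e * (1/2)^Suc n" for n
        by (auto simp add: less_top dest!: ennreal_suminf_lessD)
      then have "\<exists>U. open U \<and> A n \<subseteq> U \<and> open_content u U < outer_content u (A n) + e * (1/2)^Suc n" for n
        using INF_less_iff[THEN iffD1, of "open_content u" "{U. open U \<and> A n \<subseteq> U}"]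
        unfolding outer_content_def[symmetric] by blast
      then obtain U where U: "\<And>n. open (U n)" "\<And>n. A n \<subseteq> U n"
        "\<And>n. open_content u (U n) \<le> outer_content u (A n) + e * (1/2)^Suc n"
        by (metis less_imp_le)
      have "outer_content u (\<Union>i. A i) \<le> open_content u (\<Union>i. U i)"
        using U by (intro outer_content_lower) auto
      also have "\<dots> \<le> (\<Sum>n. open_content u (U n))"
        by (rule open_content_UN[OF u U(1)])
      also have "\<dots> \<le> (\<Sum>n. outer_content u (A n) + e * (1/2) ^ Suc n)"
        by (intro suminf_le allI U(3)) auto
      also have "\<dots> = (\<Sum>n. outer_content u (A n)) + (\<Sum>n. ennreal e * ennreal ((1/2) ^ Suc n))"
        using \<open>0 < e\<close> by (subst suminf_add[symmetric])
                         (auto simp del: ennreal_suminf_cmult simp add: ennreal_mult[symmetric])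
      also have "\<dots> = (\<Sum>n. outer_content u (A n)) + e"
        unfolding ennreal_suminf_cmult
        by (subst suminf_ennreal_eq[OF zero_le_power power_half_series]) auto
      finally show "outer_content u (\<Union>i. A i) \<le> (\<Sum>n. outer_content u (A n)) + e" .
    qed
  qed
qed

text \<open>Caratheodory's condition for the open set \<open>V\<close>. Choose \<open>f\<close> supported in \<open>V \<inter> U\<close> nearly
optimal, and then \<open>g\<close> supported in \<open>U\<close> away from the support of \<open>f\<close>: the supports are disjoint, so
\<open>f + g\<close> is still a competitor for \<open>U\<close>.\<close>

lemma open_content_split:
  assumes u: "positive_functional u" and U: "open U" and V: "open V"
  shows "outer_content u (V \<inter> U) + outer_content u (U - V) \<le> open_content u U"
proof -
  have "ennreal (u f) + outer_content u (U - V) \<le> open_content u U" if f: "f \<in> cutoffs (V \<inter> U)" for f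
  proof -
    have f': "test_fun f" "\<And>x. 0 \<le> f x" "\<And>x. f x \<le> 1" "supp f \<subseteq> V \<inter> U"
      using f by (auto simp: cutoffs_def)
    have "open (U - supp f)"
      using U by (simp add: supp_def open_Diff)
    then have "outer_content u (U - V) \<le> open_content u (U - supp f)"
      using f'(4) by (intro outer_content_lower) auto
    then have "ennreal (u f) + outer_content u (U - V) \<le> ennreal (u f) + open_content u (U - supp f)"
      by (rule add_left_mono)
    also have "\<dots> = (SUP g\<in>cutoffs (U - supp f). ennreal (u f) + ennreal (u g))"
      unfolding open_content_def
      by (rule ennreal_SUP_add_right) (use zero_in_cutoffs in auto)
    also have "\<dots> \<le> open_content u U"
    proof (rule SUP_least)
      fix g assume "g \<in> cutoffs (U - supp f)"
      then have g: "test_fun g" "\<And>x. 0 \<le> g x" "\<And>x. g x \<le> 1" "supp g \<subseteq> U - supp f"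
        by (auto simp: cutoffs_def)
      have "f x + g x \<le> 1" for x
        by (cases "x \<in> supp f") (use g f' zero_outside_supp[of x f] zero_outside_supp[of x g] in force)+
      moreover have "supp (\<lambda>x. f x + g x) \<subseteq> supp f \<union> supp g"
        by (rule supp_subset) (auto simp: zero_outside_supp[of _ f] zero_outside_supp[of _ g] closed_Un closed_supp)
      ultimately have "(\<lambda>x. f x + g x) \<in> cutoffs U"
        using f' g by (auto simp: cutoffs_def)
      then have "ennreal (u (\<lambda>x. f x + g x)) \<le> open_content u U"
        by (rule open_content_upper)
      then show "ennreal (u f) + ennreal (u g) \<le> open_content u U"
        using positive_functional_nonneg[OF u f'(1,2)] positive_functional_nonneg[OF u g(1,2)]
        by (simp add: positive_functional_add[OF u f'(1) g(1)] ennreal_plus)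
    qed
    finally show ?thesis .
  qed
  then have "(SUP f\<in>cutoffs (V \<inter> U). ennreal (u f) + outer_content u (U - V)) \<le> open_content u U"
    by (rule SUP_least)
  moreover have "(SUP f\<in>cutoffs (V \<inter> U). ennreal (u f) + outer_content u (U - V)) =
      open_content u (V \<inter> U) + outer_content u (U - V)"
    unfolding open_content_def by (rule ennreal_SUP_add_left) (use zero_in_cutoffs in auto)
  ultimately show ?thesis
    using U V by (simp add: outer_content_open open_Int)
qed

definition functional_measure :: "'n::finite functional \<Rightarrow> (real ^ 'n) measure" where
  "functional_measure u = measure_of UNIV (sets borel) (outer_content u)"

lemma
  assumes u: "positive_functional u"
  shows sets_functional_measure [simp]: "sets (functional_measure u) = sets borel"
    and emeasure_functional_measure: "A \<in> sets borel \<Longrightarrow> emeasure (functional_measure u) A = outer_content u A"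
proof -
  let ?L = "lambda_system UNIV (Pow UNIV) (outer_content u)"
  have "measure_space UNIV ?L (outer_content u)"
    by (rule sigma_algebra.caratheodory_lemma[OF sigma_algebra_Pow outer_content_outer_measure[OF u]])
  moreover have "sets borel \<subseteq> ?L"
  proof -
    have "V \<in> ?L" if V: "open V" for V
      unfolding lambda_system_def
    proof (intro CollectI conjI ballI antisym)
      fix A :: "(real ^ 'a) set"
      show "outer_content u (V \<inter> A) + outer_content u ((UNIV - V) \<inter> A) \<le> outer_content u A"
        unfolding outer_content_def[of u A]
      proof (rule INF_greatest)
        fix U assume "U \<in> {U. open U \<and> A \<subseteq> U}"
        then have U: "open U" "A \<subseteq> U" by auto
        have "outer_content u (V \<inter> A) + outer_content u ((UNIV - V) \<inter> A) \<le>
            outer_content u (V \<inter> U) + outer_content u (U - V)"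
          using U by (intro add_mono outer_content_mono) auto
        also have "\<dots> \<le> open_content u U"
          by (rule open_content_split[OF u U(1) V])
        finally show "outer_content u (V \<inter> A) + outer_content u ((UNIV - V) \<inter> A) \<le> open_content u U" .
      qed
      have "outer_content u ((V \<inter> A) \<union> ((UNIV - V) \<inter> A)) \<le>
          outer_content u (V \<inter> A) + outer_content u ((UNIV - V) \<inter> A)"
      proof -
        have "countably_subadditive (Pow UNIV) (outer_content u)" "positive (Pow UNIV) (outer_content u)"
          using outer_content_outer_measure[OF u] by (auto simp: outer_measure_space_def)
        then have "subadditive (Pow UNIV) (outer_content u)"
          using ring_of_sets.countably_subadditive_subadditive[OF ring_of_sets_Pow] by blast
        then show ?thesis by (rule subadditiveD) auto
      qed
      then show "outer_content u A \<le> outer_content u (V \<inter> A) + outer_content u ((UNIV - V) \<inter> A)"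
        by (simp add: Int_Un_distrib2[symmetric])
    qed auto
    then show ?thesis
      using \<open>measure_space UNIV ?L (outer_content u)\<close> unfolding sets_borel measure_space_def
      by (intro sigma_algebra.sigma_sets_subset) auto
  qed
  ultimately have "measure_space UNIV (sets borel) (outer_content u)"
    using measure_down sets.sigma_algebra_axioms[of borel] by (metis space_borel)
  then show "sets (functional_measure u) = sets borel"
    and "A \<in> sets borel \<Longrightarrow> emeasure (functional_measure u) A = outer_content u A"
    unfolding functional_measure_def
    by (auto simp: emeasure_measure_of_sigma measure_space_def sets.sigma_sets_eq[of borel, simplified])
qed


lemma outer_content_le_functional:
  assumes u: "positive_functional u" and f: "test_fun f" "\<And>x. 0 \<le> f x"
    and W: "open W" "K \<subseteq> W" "\<And>x. x \<in> W \<Longrightarrow> 1 \<le> f x"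
  shows "outer_content u K \<le> ennreal (u f)"
proof -
  have "open_content u W \<le> ennreal (u f)"
    unfolding open_content_def
  proof (intro SUP_least ennreal_leI)
    fix g assume "g \<in> cutoffs W"
    then have g: "test_fun g" "\<And>x. g x \<le> 1" "supp g \<subseteq> W"
      by (auto simp: cutoffs_def)
    have "g x \<le> f x" for x
    proof (cases "x \<in> W")
      case True
      then show ?thesis using g(2) W(3) order_trans by blast
    next
      case False
      then have "g x = 0" using g(3) by (intro zero_outside_supp) auto
      then show ?thesis using f(2) by simp
    qed
    then show "u g \<le> u f"
      by (rule positive_functional_mono[OF u g(1) f(1)])
  qed
  then show ?thesis
    using outer_content_lower[OF W(1,2)] order_trans by blast
qed

lemma functional_le_outer_content:
  assumes "f \<in> cutoffs UNIV" "supp f \<subseteq> K"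
  shows "ennreal (u f) \<le> outer_content u K"
  unfolding outer_content_def
  by (intro INF_greatest open_content_upper) (use assms in \<open>auto simp: cutoffs_def\<close>)

lemma integrable_test_fun:
  assumes M: "sets M = sets borel" "\<And>K. compact K \<Longrightarrow> emeasure M K < \<infinity>" and f: "test_fun f"
  shows "integrable M f"
proof -
  obtain B where B: "\<And>x. \<bar>f x\<bar> \<le> B"
    using test_fun_bounded[OF f] by blast
  have "f \<in> borel_measurable borel"
    by (intro borel_measurable_continuous_onI smooth_continuous test_fun_smooth f)
  then have "f \<in> borel_measurable M"
    using measurable_cong_sets[OF M(1) refl] by blast
  moreover have "supp f \<in> sets M"
    unfolding M(1) by (simp add: supp_def)
  ultimately show ?thesis
    using M(2)[OF test_fun_compact[OF f]] B
    by (intro integrableI_bounded_set[of "supp f" M f B]) (auto simp: zero_outside_supp[of _ f])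
qed

lemma functional_measure_finite:
  assumes u: "positive_functional u" and K: "compact K"
  shows "emeasure (functional_measure u) K < \<infinity>"
proof -
  obtain f W where f: "f \<in> cutoffs UNIV" "open W" "K \<subseteq> W" "\<And>x. x \<in> W \<Longrightarrow> f x = 1"
    using smooth_urysohn[OF K open_UNIV] by auto
  have "outer_content u K \<le> ennreal (u f)"
    using f by (intro outer_content_le_functional[OF u, where W = W]) (auto simp: cutoffs_def)
  also have "\<dots> < \<infinity>" by simp
  finally show ?thesis
    by (simp only: emeasure_functional_measure[OF u borel_compact[OF K]])
qed

text \<open>At $z$, the first $\lfloor z \rfloor$ steps have reached the value 1.\<close>

lemma steps_lower_bound:
  assumes "0 \<le> z" "z \<le> real N"
  shows "z \<le> (\<Sum>k<N. smooth_step (z - real k)) + 1"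
proof -
  let ?m = "nat \<lfloor>z\<rfloor>"
  have m: "real ?m \<le> z" "z \<le> real ?m + 1"
    using assms(1) by linarith+
  have "?m \<le> N" using m assms(2) by linarith
  have "real ?m = (\<Sum>k<?m. 1)" by simp
  also have "\<dots> = (\<Sum>k<?m. smooth_step (z - real k))"
  proof (intro sum.cong refl smooth_step_1[symmetric])
    show "1 \<le> z - real k" if "k \<in> {..<?m}" for k
    proof -
      have "k + 1 \<le> ?m" using that by simp
      then have "real k + 1 \<le> real ?m" by linarith
      then show ?thesis using m by linarith
    qed
  qed
  also have "\<dots> \<le> (\<Sum>k<N. smooth_step (z - real k))"
    using \<open>?m \<le> N\<close> by (intro sum_mono2) (auto simp: smooth_step_bounds)
  finally show ?thesis using m by linarith
qed

lemma steps_upper_bound: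
  assumes "0 \<le> z"
  shows "(\<Sum>k<N. of_bool (real k \<le> z)) \<le> z + 1"
proof -
  let ?m = "nat \<lfloor>z\<rfloor>"
  have "(\<Sum>k<N. of_bool (real k \<le> z)) = (\<Sum>k\<in>{k. k < N \<and> real k \<le> z}. 1 :: real)"
    by (rule sum.mono_neutral_cong_right) auto
  also have "\<dots> \<le> (\<Sum>k<Suc ?m. 1)"
  proof (rule sum_mono2)
    show "{k. k < N \<and> real k \<le> z} \<subseteq> {..<Suc ?m}"
      by (auto simp: le_nat_floor less_Suc_eq_le)
  qed auto
  also have "\<dots> = real ?m + 1" by simp
  also have "\<dots> \<le> z + 1" using assms by linarith
  finally show ?thesis .
qed

text \<open>Slice the range of \<open>f\<close> into layers of height \<open>e\<close> by smooth steps. Each step function lies between 0 and 1 and is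
supported in a compact superlevel set of \<open>f\<close>, whose measure bounds the functional; the sum of these measures is an
approximation of the integral of \<open>f\<close>. The error is of order \<open>e\<close>.\<close>

lemma functional_le_integral:
  assumes u: "positive_functional u" and f: "test_fun f" "\<And>x. 0 \<le> f x"
  shows "u f \<le> integral\<^sup>L (functional_measure u) f"
proof -
  let ?M = "functional_measure u" and ?K = "supp f"
  note fin = functional_measure_finite[OF u]
  have K: "compact ?K" by (rule test_fun_compact[OF f(1)])
  obtain B where B: "\<And>x. \<bar>f x\<bar> \<le> B" "B \<ge> 0"
    using test_fun_bounded[OF f(1)] by blast
  obtain \<psi> W where \<psi>: "\<psi> \<in> cutoffs UNIV" "open W" "?K \<subseteq> W" "\<And>x. x \<in> W \<Longrightarrow> \<psi> x = 1"
    using smooth_urysohn[OF K open_UNIV subset_UNIV] by metis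
  have \<psi>': "test_fun \<psi>" "\<And>x. 0 \<le> \<psi> x"
    using \<psi> by (auto simp: cutoffs_def)
  have "u f \<le> integral\<^sup>L ?M f + e * (measure ?M ?K + u \<psi>)" if e: "e > 0" for e
  proof -
    (* enough layers of height e to exceed the bound B of f *)
    obtain N where N: "B / e \<le> real N" using real_arch_simple by blast
    define \<theta> where "\<theta> k x = smooth_step (inverse e * f x - real k)" for k :: nat and x
    define L where "L k = {x. real k * e \<le> f x} \<inter> ?K" for k :: nat
    have L: "compact (L k)" for k
      unfolding L_def
      by (intro closed_Int_compact closed_Collect_le smooth_continuous test_fun_smooth f K continuous_on_const)
    have \<theta>0: "\<theta> k x = 0" if "x \<notin> L k" for k x
    proof -
      have "f x \<le> real k * e"
        using that e zero_outside_supp[of x f] by (force simp: L_def)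
      then show ?thesis
        unfolding \<theta>_def using e by (intro smooth_step_0) (simp add: field_simps)
    qed
    have \<theta>_test: "test_fun (\<theta> k)" for k
    proof (rule test_funI[OF _ L \<theta>0])
      show "smooth (\<theta> k)"
        unfolding \<theta>_def by (intro smooth_smooth_step smooth_diff smooth_mult smooth_const test_fun_smooth f)
    qed
    have \<theta>_bounds: "0 \<le> \<theta> k x" "\<theta> k x \<le> 1" for k x
      by (simp_all add: \<theta>_def smooth_step_bounds)
    have \<theta>_le: "u (\<theta> k) \<le> measure ?M (L k)" for k
    proof -
      have "supp (\<theta> k) \<subseteq> L k"
        by (rule supp_subset[OF compact_imp_closed[OF L] \<theta>0])
      then have "ennreal (u (\<theta> k)) \<le> outer_content u (L k)"
        using \<theta>_test \<theta>_bounds by (intro functional_le_outer_content) (auto simp: cutoffs_def)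
      also have "\<dots> = emeasure ?M (L k)"
        by (simp add: emeasure_functional_measure[OF u] borel_compact[OF L])
      also have "\<dots> = ennreal (measure ?M (L k))"
        using fin[OF L[of k]] by (intro emeasure_eq_ennreal_measure) simp
      finally show ?thesis by (simp add: ennreal_le_iff)
    qed
    have "f x \<le> e * (\<Sum>k<N. \<theta> k x) + e * \<psi> x" for x
    proof (cases "x \<in> ?K")
      case True
      have "0 \<le> inverse e * f x" "inverse e * f x \<le> real N"
        using e f(2)[of x] B(1)[of x] N by (auto simp: field_simps)
      then have "inverse e * f x \<le> (\<Sum>k<N. \<theta> k x) + 1"
        unfolding \<theta>_def by (rule steps_lower_bound)
      then show ?thesis
        using e \<psi>(4)[of x] \<psi>(3) True by (auto simp: field_simps)
    next
      case False
      then have "f x = 0" by (rule zero_outside_supp)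
      then show ?thesis
        using e \<psi>'(2) by (simp add: \<theta>_def smooth_step_bounds sum_nonneg)
    qed
    then have "u f \<le> u (\<lambda>x. e * (\<Sum>k<N. \<theta> k x) + e * \<psi> x)"
      using \<theta>_test \<psi>'(1) f(1) by (intro positive_functional_mono[OF u] test_fun_add test_fun_cmult test_fun_sum)
    also have "\<dots> = e * (\<Sum>k<N. u (\<theta> k)) + e * u \<psi>"
    proof -
      have 1: "test_fun (\<lambda>x. \<Sum>k<N. \<theta> k x)" using \<theta>_test by (intro test_fun_sum)
      show ?thesis
        using positive_functional_add[OF u test_fun_cmult[OF 1] test_fun_cmult[OF \<psi>'(1)], of e e]
          positive_functional_cmult[OF u 1, of e] positive_functional_cmult[OF u \<psi>'(1), of e]
          positive_functional_sum[OF u, of "{..<N}" \<theta>] \<theta>_test by simp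
    qed
    also have "\<dots> \<le> e * (\<Sum>k<N. measure ?M (L k)) + e * u \<psi>"
      using e by (intro add_mono mult_left_mono sum_mono \<theta>_le) auto
    also have "e * (\<Sum>k<N. measure ?M (L k)) \<le> integral\<^sup>L ?M f + e * measure ?M ?K"
    proof -
      have sets: "L k \<in> sets ?M" "?K \<in> sets ?M" for k
        using L K by (auto simp: sets_functional_measure[OF u] borel_compact)
      have int: "integrable ?M (indicat_real (L k))" "integrable ?M (indicat_real ?K)" for k
        using sets fin[OF L] fin[OF K] by (auto intro: integrable_real_indicator)
      have int_f: "integrable ?M f"
        by (rule integrable_test_fun[OF sets_functional_measure[OF u] fin f(1)])
      have "e * (\<Sum>k<N. measure ?M (L k)) = (\<integral>x. e * (\<Sum>k<N. indicat_real (L k) x) \<partial>?M)"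
        using sets int by (simp add: Bochner_Integration.integral_sum)
      also have "\<dots> \<le> (\<integral>x. f x + e * indicat_real ?K x \<partial>?M)"
      proof (rule integral_mono)
        show "integrable ?M (\<lambda>x. e * (\<Sum>k<N. indicat_real (L k) x))"
          using int by (intro integrable_mult_right Bochner_Integration.integrable_sum)
        show "integrable ?M (\<lambda>x. f x + e * indicat_real ?K x)"
          using int int_f by (intro integrable_mult_right Bochner_Integration.integrable_add)
        show "e * (\<Sum>k<N. indicat_real (L k) x) \<le> f x + e * indicat_real ?K x" for x
        proof (cases "x \<in> ?K")
          case True
          have "(\<Sum>k<N. indicat_real (L k) x) = (\<Sum>k<N. of_bool (real k \<le> inverse e * f x))"
            using True e by (intro sum.cong) (auto simp: L_def indicator_def field_simps)
          also have "\<dots> \<le> inverse e * f x + 1"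
            using e f(2) by (intro steps_upper_bound) auto
          finally have "e * (\<Sum>k<N. indicat_real (L k) x) \<le> e * (inverse e * f x + 1)"
            using e by (intro mult_left_mono) auto
          moreover have "e * (inverse e * f x + 1) = f x + e"
            using e by (simp add: field_simps)
          ultimately show ?thesis
            using True by simp
        next
          case False
          then show ?thesis using f(2) by (simp add: L_def)
        qed
      qed
      also have "\<dots> = integral\<^sup>L ?M f + e * measure ?M ?K"
        using int int_f sets by simp
      finally show ?thesis .
    qed
    finally show ?thesis by (simp add: algebra_simps)
  qed
  note approx = this
  let ?C = "measure ?M ?K + u \<psi>"
  have C: "0 \<le> ?C"
    using positive_functional_nonneg[OF u \<psi>'] by simp
  show ?thesis
  proof (rule field_le_epsilon)
    fix d :: real assume d: "0 < d"
    have "u f \<le> integral\<^sup>L ?M f + d / (?C + 1) * ?C"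
      using C d by (intro approx) simp
    also have "d / (?C + 1) * ?C \<le> d"
      using C d by (simp add: field_simps)
    finally show "u f \<le> integral\<^sup>L ?M f + d" by simp
  qed
qed

text \<open>The previous inequality is applied to $B \psi - f \ge 0$, where $\psi$ is a cutoff that equals 1 near the support of
\<open>f\<close>. It remains to see that the functional and the integral nearly agree on $\psi$: this
holds when the support of $\psi$ lies in an open set whose measure exceeds that of the support of \<open>f\<close> by little.\<close>

lemma integral_le_functional:
  assumes u: "positive_functional u" and f: "test_fun f"
  shows "integral\<^sup>L (functional_measure u) f \<le> u f"
proof -
  let ?M = "functional_measure u" and ?K = "supp f"
  note fin = functional_measure_finite[OF u] and em = emeasure_functional_measure[OF u]
  have K: "compact ?K" by (rule test_fun_compact[OF f])
  obtain B where B: "\<And>x. \<bar>f x\<bar> \<le> B" "B \<ge> 0"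
    using test_fun_bounded[OF f] by blast
  have "integral\<^sup>L ?M f \<le> u f + B * e" if e: "e > 0" for e
  proof -
    have "outer_content u ?K = ennreal (measure ?M ?K)"
      using fin[OF K] by (simp add: emeasure_eq_ennreal_measure[symmetric] em borel_compact[OF K] less_top)
    then have "outer_content u ?K < outer_content u ?K + ennreal e"
      using e by (simp add: ennreal_plus[symmetric] ennreal_less_iff del: ennreal_plus)
    then obtain U where U: "open U" "?K \<subseteq> U" "open_content u U < outer_content u ?K + ennreal e"
      using INF_less_iff[THEN iffD1, of "open_content u" "{U. open U \<and> ?K \<subseteq> U}"]
      unfolding outer_content_def[symmetric] by blast
    obtain \<psi> W where \<psi>: "\<psi> \<in> cutoffs U" "open W" "?K \<subseteq> W" "\<And>x. x \<in> W \<Longrightarrow> \<psi> x = 1"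
      using smooth_urysohn[OF K U(1,2)] by metis
    have \<psi>': "test_fun \<psi>" "\<And>x. 0 \<le> \<psi> x" "\<And>x. \<psi> x \<le> 1" "supp \<psi> \<subseteq> U"
      using \<psi> by (auto simp: cutoffs_def)
    have int: "integrable ?M \<psi>" "integrable ?M f"
      using integrable_test_fun[OF sets_functional_measure[OF u] fin] \<psi>'(1) f by blast+
    have "integral\<^sup>L ?M \<psi> \<le> u \<psi> + e"
    proof -
      have S: "compact (supp \<psi>)" by (rule test_fun_compact[OF \<psi>'(1)])
      have "integral\<^sup>L ?M \<psi> \<le> (\<integral>x. indicat_real (supp \<psi>) x \<partial>?M)"
      proof (rule integral_mono[OF int(1)])
        show "integrable ?M (indicat_real (supp \<psi>))"
          using fin[OF S] S by (intro integrable_real_indicator) (auto simp: sets_functional_measure[OF u] borel_compact)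
        show "\<psi> x \<le> indicat_real (supp \<psi>) x" for x
          using \<psi>'(3)[of x] zero_outside_supp[of x \<psi>] by (auto simp: indicator_def)
      qed
      also have "\<dots> = measure ?M (supp \<psi>)"
        using S by (simp add: sets_functional_measure[OF u] borel_compact)
      finally have "ennreal (integral\<^sup>L ?M \<psi>) \<le> ennreal (measure ?M (supp \<psi>))"
        by (rule ennreal_leI)
      also have "\<dots> = outer_content u (supp \<psi>)"
        using fin[OF S] by (simp add: emeasure_eq_ennreal_measure[symmetric] em borel_compact[OF S] less_top)
      also have "\<dots> \<le> outer_content u ?K + ennreal e"
        using outer_content_lower[OF U(1) \<psi>'(4), of u] U(3) by simp
      also have "\<dots> \<le> ennreal (u \<psi>) + ennreal e"
        using outer_content_le_functional[OF u \<psi>'(1,2) \<psi>(2,3)] \<psi>(4) by (intro add_right_mono) auto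
      also have "\<dots> = ennreal (u \<psi> + e)"
        using e positive_functional_nonneg[OF u \<psi>'(1,2)] by (simp add: ennreal_plus)
      finally show ?thesis
        using e positive_functional_nonneg[OF u \<psi>'(1,2)] by (simp add: ennreal_le_iff del: ennreal_plus)
    qed
    then have "B * integral\<^sup>L ?M \<psi> \<le> B * (u \<psi> + e)"
      using B(2) by (rule mult_left_mono)
    moreover have "u (\<lambda>x. B * \<psi> x + - 1 * f x) \<le> (\<integral>x. B * \<psi> x + - 1 * f x \<partial>?M)"
    proof (rule functional_le_integral[OF u])
      show "test_fun (\<lambda>x. B * \<psi> x + - 1 * f x)"
        by (intro test_fun_add test_fun_cmult \<psi>'(1) f)
      show "0 \<le> B * \<psi> x + - 1 * f x" for x
        using B(1)[of x] B(2) \<psi>(3,4) \<psi>'(2)[of x] zero_outside_supp[of x f]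
        by (cases "x \<in> ?K") auto
    qed
    moreover have "u (\<lambda>x. B * \<psi> x + - 1 * f x) = B * u \<psi> - u f"
      using positive_functional_add[OF u test_fun_cmult[OF \<psi>'(1)] test_fun_cmult[OF f], of B "-1"]
        positive_functional_cmult[OF u \<psi>'(1), of B] positive_functional_cmult[OF u f, of "-1"] by simp
    moreover have "(\<integral>x. B * \<psi> x + - 1 * f x \<partial>?M) = B * integral\<^sup>L ?M \<psi> - integral\<^sup>L ?M f"
      using int by simp
    ultimately show ?thesis by (simp add: algebra_simps)
  qed
  note approx = this
  show ?thesis
  proof (rule field_le_epsilon)
    fix d :: real assume d: "0 < d"
    have "integral\<^sup>L ?M f \<le> u f + B * (d / (B + 1))"
      using B d by (intro approx) simp
    also have "B * (d / (B + 1)) \<le> d"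
      using B d by (simp add: field_simps)
    finally show "integral\<^sup>L ?M f \<le> u f + d" by simp
  qed
qed

text \<open>The previous inequality for $f$ and for $-f$ gives equality. This is the Riesz representation theorem.\<close>

lemma functional_measure_represents:
  fixes u :: "'n::finite functional"
  assumes u: "positive_functional u"
  shows "represents (functional_measure u) u"
  unfolding represents_def
proof (intro conjI allI impI)
  fix f :: "real ^ 'n \<Rightarrow> real" assume f: "test_fun f"
  have "integral\<^sup>L (functional_measure u) (\<lambda>x. - 1 * f x) \<le> u (\<lambda>x. - 1 * f x)"
    by (intro integral_le_functional[OF u] test_fun_cmult f)
  then have "u f \<le> integral\<^sup>L (functional_measure u) f"
    by (simp add: positive_functional_cmult[OF u f, of "-1", simplified])
  then show "u f = integral\<^sup>L (functional_measure u) f"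
    using integral_le_functional[OF u f] by simp
qed (simp_all add: functional_measure_finite[OF u, simplified] sets_functional_measure[OF u])

lemma tendsto_flat_1: "s > 0 \<Longrightarrow> (\<lambda>k. flat 1 (real k * s)) \<longlonglongrightarrow> 1"
proof -
  assume s: "s > 0"
  have "filterlim (\<lambda>k. s * real k) at_top sequentially"
    by (rule filterlim_tendsto_pos_mult_at_top[OF tendsto_const s filterlim_real_sequentially])
  then have "filterlim (\<lambda>k. real k * s) at_top sequentially"
    by (simp only: mult.commute)
  then have "(\<lambda>k. exp (- inverse (real k * s))) \<longlonglongrightarrow> exp (- 0)"
    by (intro tendsto_exp tendsto_minus tendsto_inverse_0_at_top)
  moreover have "\<forall>\<^sub>F k in sequentially. exp (- inverse (real k * s)) = flat 1 (real k * s)"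
    using eventually_gt_at_top[of 0] by eventually_elim (use s in \<open>simp add: flat_def\<close>)
  ultimately show ?thesis
    by (auto intro: Lim_transform_eventually)
qed

lemma represents_finite_box:
  assumes "represents P u"
  shows "emeasure P (box a b) < \<infinity>"
proof -
  have "emeasure P (box a b) \<le> emeasure P (cbox a b)"
    using assms by (intro emeasure_mono box_subset_cbox) (auto simp: represents_def)
  also have "\<dots> < \<infinity>"
    using assms compact_cbox unfolding represents_def by blast
  finally show ?thesis .
qed

text \<open>The product $g$ of the functions $e^{-1/(x_i - a_i)}\, e^{-1/(b_i - x_i)}$ is positive exactly on the open box, and
$e^{-1/(k g)}$ are test functions that increase to its indicator function. So the functional determines the measure of boxes.\<close>

lemma represents_unique:
  fixes u :: "'n::finite functional"
  assumes M: "represents M u" and N: "represents N u"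
  shows "M = N"
proof -
  have box: "emeasure M (box a b) = emeasure N (box a b)" for a b :: "real ^ 'n"
  proof -
    define g where "g x = (\<Prod>i\<in>UNIV. flat 1 (x $ i - a $ i) * flat 1 (b $ i - x $ i))" for x :: "real ^ 'n"
    have smooth: "smooth g"
      unfolding g_def by (intro smooth_prod smooth_mult smooth_flat smooth_diff smooth_const smooth_component)
    have g_pos: "g x > 0" if "x \<in> box a b" for x
      using that unfolding g_def by (intro prod_pos) (auto simp: mem_box_cart flat_1_pos)
    have g0: "g x = 0" if "x \<notin> box a b" for x
    proof -
      from that obtain i where "x $ i - a $ i \<le> 0 \<or> b $ i - x $ i \<le> 0"
        by (auto simp: mem_box_cart not_less)
      then show ?thesis
        unfolding g_def by (intro prod_zero[OF finite] bexI[of _ i]) auto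
    qed
    have test: "test_fun (\<lambda>x. flat 1 (real k * g x))" for k
    proof (rule test_funI[of _ "cbox a b"])
      show "smooth (\<lambda>x. flat 1 (real k * g x))"
        by (intro smooth_flat smooth_mult smooth_const smooth)
      show "flat 1 (real k * g x) = 0" if "x \<notin> cbox a b" for x
      proof -
        have "x \<notin> box a b" using that box_subset_cbox by blast
        then show ?thesis by (simp add: g0)
      qed
    qed simp
    have lim: "(\<lambda>k. integral\<^sup>L P (\<lambda>x. flat 1 (real k * g x))) \<longlonglongrightarrow> measure P (box a b)"
      if P: "represents P u" for P
    proof -
      have sets: "box a b \<in> sets P" "cbox a b \<in> sets P" and fin: "emeasure P (cbox a b) < \<infinity>"
        using P by (auto simp: represents_def)
      have "integrable P (indicat_real (cbox a b))"
        using sets fin by (intro integrable_real_indicator)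
      then have "(\<lambda>k. integral\<^sup>L P (\<lambda>x. flat 1 (real k * g x))) \<longlonglongrightarrow> integral\<^sup>L P (indicat_real (box a b))"
      proof (rule integral_dominated_convergence[rotated 2])
        show "AE x in P. (\<lambda>k. flat 1 (real k * g x)) \<longlonglongrightarrow> indicat_real (box a b) x"
        proof (rule AE_I2)
          show "(\<lambda>k. flat 1 (real k * g x)) \<longlonglongrightarrow> indicat_real (box a b) x" for x
            by (cases "x \<in> box a b") (simp_all add: tendsto_flat_1 g_pos g0)
        qed
        show "AE x in P. norm (flat 1 (real k * g x)) \<le> indicat_real (cbox a b) x" for k
        proof (rule AE_I2)
          show "norm (flat 1 (real k * g x)) \<le> indicat_real (cbox a b) x" for x
            by (cases "x \<in> box a b") (use box_subset_cbox[of a b] in \<open>auto simp: g0\<close>)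
        qed
        show "(\<lambda>x. flat 1 (real k * g x)) \<in> borel_measurable P" for k
          using integrable_test_fun[OF _ _ test] P by (auto simp: represents_def)
      qed (use sets in simp)
      then show ?thesis using sets by simp
    qed
    have "integral\<^sup>L M (\<lambda>x. flat 1 (real k * g x)) = integral\<^sup>L N (\<lambda>x. flat 1 (real k * g x))" for k
      using M N test by (simp add: represents_def)
    then have "measure M (box a b) = measure N (box a b)"
      using LIMSEQ_unique[OF lim[OF M]] lim[OF N] by simp
    moreover have "emeasure P (box a b) = ennreal (measure P (box a b))" if "represents P u" for P
      using represents_finite_box[OF that, of a b] by (intro emeasure_eq_ennreal_measure) simp
    ultimately show ?thesis using M N by simp
  qed
  let ?E = "range (\<lambda>(a, b). box a b :: (real ^ 'n) set)"
  show "M = N"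
  proof (rule measure_eqI_generator_eq[where E = ?E and \<Omega> = UNIV and A = "\<lambda>k. box (\<chi> i. - real k) (\<chi> i. real k)"])
    show "Int_stable ?E"
      by (auto simp: Int_stable_def box_Int_box)
    show "sets M = sigma_sets UNIV ?E" "sets N = sigma_sets UNIV ?E"
      using M N by (simp_all add: represents_def borel_eq_box)
    show "emeasure M X = emeasure N X" if "X \<in> ?E" for X
      using that box by auto
    show "(\<Union>k. box (\<chi> i. - real k) (\<chi> i. real k)) = (UNIV :: (real ^ 'n) set)"
    proof (rule UNIV_eq_I[symmetric])
      fix x :: "real ^ 'n"
      obtain k where k: "norm x < real k" using reals_Archimedean2 by blast
      have "- real k < x $ i \<and> x $ i < real k" for i
        using component_le_norm_cart[of x i] k by linarith
      then have "x \<in> box (\<chi> i. - real k) (\<chi> i. real k)"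
        by (simp add: mem_box_cart)
      then show "x \<in> (\<Union>k. box (\<chi> i. - real k) (\<chi> i. real k))" by blast
    qed
    show "emeasure M (box (\<chi> i. - real k) (\<chi> i. real k)) \<noteq> \<infinity>" for k
      using represents_finite_box[OF M] by (simp add: less_top)
  qed auto
qed

section \<open>The differential inequality\<close>

abbreviation flat' :: "real \<Rightarrow> real" where
  "flat' \<equiv> flat [:0, 0, 1:]"

lemma flat_1_DERIV: "(flat 1 has_real_derivative flat' s) (at s)"
  using flat_DERIV[of 1 s] by (simp add: pderiv_1)

lemma flat'_nonneg: "0 \<le> flat' s"
  by (simp add: flat_def)

lemma flat'_le: "flat' s \<le> 4"
proof (cases "s > 0")
  case True
  define v where "v = inverse s"
  have v: "v > 0" using True by (simp add: v_def)
  have "(v / 2)\<^sup>2 \<le> (exp (v / 2))\<^sup>2"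
  proof (rule power_mono)
    show "v / 2 \<le> exp (v / 2)"
      using exp_ge_add_one_self[of "v / 2"] by linarith
  qed (use v in simp)
  also have "\<dots> = exp v"
    by (simp add: power2_eq_square flip: exp_add)
  finally have "v\<^sup>2 \<le> 4 * exp v"
    by (simp add: power_divide)
  then have "v\<^sup>2 * exp (- v) \<le> 4"
    by (simp add: exp_minus field_simps)
  then show ?thesis
    using True by (simp add: flat_def v_def power2_eq_square)
qed simp

lemma flat_1_lipschitz: "\<bar>flat 1 s - flat 1 t\<bar> \<le> 4 * \<bar>s - t\<bar>"
  using field_differentiable_bound[of UNIV "flat 1" flat' 4 s t] flat_1_DERIV flat'_nonneg flat'_le
  by (simp add: abs_mult)

lemma antiderivative_UNIV:
  fixes h :: "real \<Rightarrow> real"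
  assumes "continuous_on UNIV h"
  obtains H where "\<And>t. (H has_real_derivative h t) (at t)"
proof -
  have "isCont h x" for x
    using assms by (simp add: continuous_on_eq_continuous_at)
  then have "\<exists>H. \<forall>t. - \<infinity> < ereal t \<longrightarrow> ereal t < \<infinity> \<longrightarrow> (H has_vector_derivative h t) (at t)"
    by (intro einterval_antiderivative) auto
  then show thesis
    using that by (auto simp: has_real_derivative_iff_has_vector_derivative)
qed

text \<open>The test function $\chi(|x - a|^2)$ with $-\chi' = h$ and $\chi = 0$ beyond \<open>R\<close>. Only its derivatives are explicit, and they
suffice for smoothness; since \<open>h\<close> is nonnegative, $\chi$ is nonnegative.\<close>

lemma smooth_radial_potential:
  fixes a :: "real ^ 'n::finite" and h h' :: "real \<Rightarrow> real"
  assumes h: "\<And>t. (h has_real_derivative h' t) (at t)" and smooth_h: "smooth (\<lambda>x. h (dist_sq a x))"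
    and nonneg: "\<And>t. 0 \<le> h t" and R: "0 < R" "\<And>t. t \<ge> R \<Longrightarrow> h t = 0"
  obtains \<phi> where "test_fun \<phi>" "\<And>x. 0 \<le> \<phi> x"
    "\<And>i. smooth (partial i \<phi>)"
    "\<And>i j x. partial j (partial i \<phi>) x =
       - 4 * h' (dist_sq a x) * ((x $ i - a $ i) * (x $ j - a $ j)) - 2 * h (dist_sq a x) * of_bool (i = j)"
proof -
  have "continuous_on UNIV h"
    using h by (meson DERIV_isCont continuous_at_imp_continuous_on)
  then obtain H where H: "\<And>t. (H has_real_derivative h t) (at t)"
    using antiderivative_UNIV by blast
  define \<eta> where "\<eta> t = H R - H t" for t
  have \<eta>: "(\<eta> has_real_derivative - h t) (at t)" for t
    unfolding \<eta>_def by (auto intro!: derivative_eq_intros H)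
  have \<eta>0: "\<eta> t = 0" if "t \<ge> R" for t
  proof -
    have "\<exists>c. \<forall>t\<in>{R..}. \<eta> t = c"
    proof (rule has_field_derivative_zero_constant)
      show "(\<eta> has_real_derivative 0) (at t within {R..})" if "t \<in> {R..}" for t
        using has_field_derivative_at_within[OF \<eta>[of t]] R(2)[of t] that by simp
    qed simp
    then have "\<eta> t = \<eta> R" using that by auto
    then show ?thesis by (simp add: \<eta>_def)
  qed
  have \<eta>_nonneg: "0 \<le> \<eta> t" for t
  proof (cases "t \<le> R")
    case True
    then have "\<eta> R \<le> \<eta> t"
      by (rule DERIV_nonpos_imp_nonincreasing) (use \<eta> nonneg in force)
    then show ?thesis by (simp add: \<eta>0)
  qed (simp add: \<eta>0)
  let ?q = "dist_sq a"
  define \<phi> where "\<phi> x = \<eta> (?q x)" for x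
  have q: "?q differentiable (at x)" for x
    by (intro smooth_differentiable smooth_dist_sq)
  have \<phi>1: "partial i \<phi> = (\<lambda>x. (- 2 * h (?q x)) * (x $ i - a $ i))" for i
    unfolding \<phi>_def by (rule ext, subst partial_compose(1)[OF q \<eta>]) (simp add: partial_dist_sq)
  have smooth1: "smooth (partial i \<phi>)" for i
    unfolding \<phi>1 by (intro smooth_mult smooth_const smooth_h smooth_diff smooth_component)
  have "smooth \<phi>"
    by (rule smooth_from_partials[OF _ smooth1]) (unfold \<phi>_def, rule partial_compose(2)[OF q \<eta>])
  moreover have "\<phi> x = 0" if "x \<notin> cball a (sqrt R)" for x
  proof -
    have "R \<le> ?q x"
      using R(1) that by (intro dist_sq_ge) auto
    then show ?thesis by (simp add: \<phi>_def \<eta>0)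
  qed
  ultimately have test: "test_fun \<phi>"
    using compact_cball by (intro test_funI)
  have \<phi>2: "partial j (partial i \<phi>) x =
       - 4 * h' (?q x) * ((x $ i - a $ i) * (x $ j - a $ j)) - 2 * h (?q x) * of_bool (i = j)" for i j x
  proof -
    let ?f = "\<lambda>x. - 2 * h (?q x)" and ?g = "\<lambda>x :: real ^ 'n. x $ i - a $ i"
    have D: "((\<lambda>t. - 2 * h t) has_real_derivative - 2 * h' t) (at t)" for t
      by (rule DERIV_cmult[OF h])
    have f: "partial j ?f x = (- 2 * h' (?q x)) * (2 * (x $ j - a $ j))" "?f differentiable (at x)"
      using partial_compose(1)[OF q D, of j x] partial_compose(2)[OF q D] by (simp_all only: partial_dist_sq)
    have comp: "(\<lambda>x. x $ i) differentiable (at x)" "(\<lambda>x :: real ^ 'n. - (a $ i)) differentiable (at x)"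
      by (intro smooth_differentiable smooth_component smooth_const)+
    have const: "partial j (\<lambda>x. - (a $ i)) x = 0"
      by (rule partial_eqI[where D = "\<lambda>h. 0"]) simp
    have g: "partial j ?g x = of_bool (i = j)" "?g differentiable (at x)"
      using partial_add[OF comp, of j] const differentiable_add[OF comp]
      by (simp_all add: partial_component)
    show ?thesis
      unfolding \<phi>1 partial_mult[OF f(2) g(2)] f(1) g(1) by (simp add: algebra_simps)
  qed
  show thesis
    by (rule that[OF test _ smooth1 \<phi>2]) (simp add: \<phi>_def \<eta>_nonneg)
qed

lemma positive_functional_beta_power:
  fixes T :: "'n::{finite,linorder} current"
  assumes T: "weakly_positive p T"
  shows "positive_functional (\<lambda>f. pair T (\<lambda>x. f x *\<^sub>R kaehler ^ p))"
  unfolding positive_functional_def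
proof (intro conjI allI impI)
  note TD = weakly_positive_distribution[OF T]
  fix f g :: "real ^ 'n::{finite,linorder} \<Rightarrow> real" and c assume f: "test_fun f"
  show "pair T (\<lambda>x. (f x + g x) *\<^sub>R kaehler ^ p) =
      pair T (\<lambda>x. f x *\<^sub>R kaehler ^ p) + pair T (\<lambda>x. g x *\<^sub>R kaehler ^ p)" if "test_fun g"
    unfolding scaleR_add_left using f that
    by (intro pair_add[where T = T, OF TD] test_field_scaleR smooth_field_const)
  show "pair T (\<lambda>x. (c * f x) *\<^sub>R kaehler ^ p) = c * pair T (\<lambda>x. f x *\<^sub>R kaehler ^ p)"
    unfolding scaleR_scaleR[symmetric] using f
    by (intro pair_cmult[where T = T, OF TD] test_field_scaleR smooth_field_const)
  show "0 \<le> pair T (\<lambda>x. f x *\<^sub>R kaehler ^ p)" if "\<forall>x. 0 \<le> f x"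
    using pair_nonneg_sum_of_squares_power[OF T f, of UNIV "\<lambda>i j x. of_bool (j = i)"] that
    by (simp add: square_of_bool kaehler_def)
qed

text \<open>The Hessian of the radial potential of $h(t) = e(c - m t^p)$ turns the convexity condition into
$0 \le \int T \wedge \beta^{p-1} \wedge (4 t^{p-1} g(t)\, \omega - 2 h(t)\, \beta)$ with $g(t) = m p\, e'(c - m t^p)$. The factor
$t^{p-1}$ is what \<open>kaehler_power_decomposition\<close> requires, and it is the reason for taking $h$ as a function of $t^p$.\<close>

lemma radial_inequality:
  fixes T :: "'n::{finite,linorder} current" and a :: "real ^ 'n::{finite,linorder}"
  assumes T: "weakly_positive (Suc k) T"
    and conv: "convex_current 1 (T \<and>\<^sub>c wedge_power beta k)"
    and c: "c > 0" and m: "m > 0"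
  defines "\<sigma> \<equiv> \<lambda>f. pair T (\<lambda>x. f x *\<^sub>R kaehler ^ Suc k)"
    and "\<tau> \<equiv> \<lambda>x. dist_sq a x ^ Suc k"
  shows "\<sigma> (\<lambda>x. flat 1 (c - m * \<tau> x)) \<le> 2 * m * \<sigma> (\<lambda>x. \<tau> x * flat' (c - m * \<tau> x))"
proof -
  note TD = weakly_positive_distribution[OF T]
  let ?p = "Suc k" and ?q = "dist_sq a"
  define h where "h t = flat 1 (c - m * t ^ ?p)" for t
  define g where "g t = m * real ?p * flat' (c - m * t ^ ?p)" for t
  have h: "(h has_real_derivative - (t ^ k * g t)) (at t)" for t
  proof -
    have "((\<lambda>t. c - m * t ^ ?p) has_real_derivative - (m * (real ?p * t ^ k))) (at t)"
      using DERIV_diff[OF DERIV_const DERIV_cmult[OF DERIV_pow[of ?p t]], of c m] by simp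
    from DERIV_chain2[OF flat_1_DERIV this] show ?thesis
      unfolding h_def g_def by (rule DERIV_cong) (simp only: mult_minus_left mult_ac)
  qed
  (* the maximum with 1 ensures t <= t^p for t >= R, so that e and its derivative vanish beyond R *)
  define R where "R = max 1 (c / m)"
  have R: "R > 0" "c - m * t ^ ?p \<le> 0" if "t \<ge> R" for t
  proof -
    have "1 \<le> t" "c / m \<le> t" using that by (auto simp: R_def)
    then have "t ^ 1 \<le> t ^ ?p" by (intro power_increasing) auto
    then have "c / m \<le> t ^ ?p" using \<open>c / m \<le> t\<close> by simp
    then show "c - m * t ^ ?p \<le> 0" using m by (simp add: field_simps)
  qed (simp add: R_def)
  have R0: "R > 0" by (simp add: R_def)
  have smooth_arg: "smooth (\<lambda>x. c - m * ?q x ^ ?p)"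
    by (intro smooth_diff smooth_mult smooth_const smooth_power smooth_dist_sq)
  have smooth_h: "smooth (\<lambda>x. h (?q x))"
    unfolding h_def by (intro smooth_flat smooth_arg)
  have smooth_g: "smooth (\<lambda>x. g (?q x))"
    unfolding g_def by (intro smooth_mult smooth_const smooth_flat smooth_arg)
  have outside: "R \<le> ?q x" if "x \<notin> cball a (sqrt R)" for x
    using R0 that by (intro dist_sq_ge) auto
  have test_h: "test_fun (\<lambda>x. h (?q x))"
    by (rule test_funI[OF smooth_h compact_cball[of a "sqrt R"]]) (use outside R in \<open>auto simp: h_def\<close>)
  have test_g: "test_fun (\<lambda>x. g (?q x))"
    by (rule test_funI[OF smooth_g compact_cball[of a "sqrt R"]]) (use outside R in \<open>auto simp: g_def\<close>)
  obtain \<phi> where \<phi>: "test_fun \<phi>" "\<And>x. 0 \<le> \<phi> x"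
    and \<phi>2: "\<And>i j x. partial j (partial i \<phi>) x =
       - 4 * (- (?q x ^ k * g (?q x))) * ((x $ i - a $ i) * (x $ j - a $ j)) - 2 * h (?q x) * of_bool (i = j)"
  proof -
    have "0 \<le> h t" for t by (simp add: h_def)
    moreover have "h t = 0" if "t \<ge> R" for t using R(2)[OF that] by (simp add: h_def)
    ultimately show thesis
      using smooth_radial_potential[OF h smooth_h _ R0] that by metis
  qed
  have test_\<phi>2: "test_fun (partial j (partial i \<phi>))" for i j
  proof -
    have "partial j (partial i \<phi>) = (\<lambda>x. (4 * ?q x ^ k * ((x $ i - a $ i) * (x $ j - a $ j))) * g (?q x)
        - (2 * of_bool (i = j)) * h (?q x))"
      by (auto simp: \<phi>2)
    moreover have "test_fun \<dots>"
      using test_g test_h by (intro test_fun_diff test_fun_mult smooth_mult smooth_power smooth_diff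
          smooth_component smooth_const smooth_dist_sq)
    ultimately show ?thesis by simp
  qed
  let ?y = "\<lambda>x i. x $ i - a $ i"
  let ?F = "\<lambda>x. kaehler ^ k * (\<Sum>i\<in>UNIV. \<Sum>j\<in>UNIV. partial j (partial i \<phi>) x *\<^sub>R elem i j)"
  let ?sq = "\<lambda>x. \<Sum>i\<in>UNIV. \<Sum>j\<in>UNIV. square (\<lambda>l. ?y x i * of_bool (l = j) - ?y x j * of_bool (l = i))"
  have hessian: "(\<Sum>i\<in>UNIV. \<Sum>j\<in>UNIV. partial j (partial i \<phi>) x *\<^sub>R elem i j) =
      (4 * g (?q x) * ?q x ^ k) *\<^sub>R square (?y x) - (2 * h (?q x)) *\<^sub>R kaehler" for x
  proof -
    have "(\<Sum>i\<in>UNIV. \<Sum>j\<in>UNIV. partial j (partial i \<phi>) x *\<^sub>R elem i j) =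
      (\<Sum>i\<in>UNIV. \<Sum>j\<in>UNIV. (4 * g (?q x) * ?q x ^ k) *\<^sub>R ((?y x i * ?y x j) *\<^sub>R elem i j) -
          (if i = j then (2 * h (?q x)) *\<^sub>R elem i i else 0))"
      by (intro sum.cong refl) (auto simp: \<phi>2 scaleR_diff_left mult_ac)
    also have "\<dots> = (4 * g (?q x) * ?q x ^ k) *\<^sub>R square (?y x) - (2 * h (?q x)) *\<^sub>R kaehler"
      by (simp add: sum_subtractf square_def kaehler_def scaleR_sum_right)
    finally show ?thesis .
  qed
  have decomposition: "(real ?p) *\<^sub>R ?F x + (4 / 2 ^ ?p * g (?q x)) *\<^sub>R ?sq x ^ ?p =
      (4 * g (?q x) * \<tau> x - 2 * real ?p * h (?q x)) *\<^sub>R kaehler ^ ?p" for x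
  proof -
    have "(real ?p * ?q x ^ k) *\<^sub>R (kaehler ^ k * square (?y x)) =
        ?q x ^ ?p *\<^sub>R kaehler ^ ?p - (1 / 2 ^ ?p) *\<^sub>R ?sq x ^ ?p"
      using kaehler_power_decomposition[of ?p k "?y x"] by (simp add: dist_sq_def)
    then have "(4 * g (?q x)) *\<^sub>R ((real ?p * ?q x ^ k) *\<^sub>R (kaehler ^ k * square (?y x))) =
        (4 * g (?q x)) *\<^sub>R (?q x ^ ?p *\<^sub>R kaehler ^ ?p - (1 / 2 ^ ?p) *\<^sub>R ?sq x ^ ?p)"
      by simp
    moreover have "(real ?p) *\<^sub>R ?F x =
        (4 * g (?q x)) *\<^sub>R ((real ?p * ?q x ^ k) *\<^sub>R (kaehler ^ k * square (?y x))) -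
        (2 * real ?p * h (?q x)) *\<^sub>R kaehler ^ ?p"
      unfolding hessian by (simp add: right_diff_distrib scaleR_diff_right mult_ac)
    ultimately show ?thesis
      by (simp add: scaleR_diff_right scaleR_diff_left \<tau>_def mult_ac)
  qed
  have smooth_sq: "smooth_field (\<lambda>x. ?sq x)"
    by (intro smooth_field_sum smooth_field_square smooth_diff smooth_mult smooth_const smooth_component)
  have test_F: "test_field ?F"
  proof -
    have "?F = (\<lambda>x. \<Sum>i\<in>UNIV. \<Sum>j\<in>UNIV. partial j (partial i \<phi>) x *\<^sub>R (kaehler ^ k * elem i j))"
      by (simp add: sum_distrib_left)
    moreover have "test_field \<dots>"
      using test_\<phi>2 by (intro test_field_sum test_field_scaleR smooth_field_const)
    ultimately show ?thesis by simp
  qed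
  have test_sq: "test_field (\<lambda>x. (4 / 2 ^ ?p * g (?q x)) *\<^sub>R ?sq x ^ ?p)"
    using test_g smooth_sq by (intro test_field_scaleR test_fun_cmult smooth_field_power)
  have test_pF: "test_field (\<lambda>x. real ?p *\<^sub>R ?F x)"
    using test_F by (auto simp: test_field_def)
  have "0 \<le> pair T ?F"
    by (rule convex_current_test[OF T conv \<phi> test_\<phi>2])
  then have "0 \<le> pair T (\<lambda>x. real ?p *\<^sub>R ?F x)"
    by (subst pair_cmult[where T = T, OF TD test_F]) simp
  moreover have "0 \<le> pair T (\<lambda>x. (4 / 2 ^ ?p * g (?q x)) *\<^sub>R ?sq x ^ ?p)"
  proof -
    let ?v = "\<lambda>(i, j) l x. ?y x i * of_bool (l = j) - ?y x j * of_bool (l = i)"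
    have "?sq x = (\<Sum>s\<in>UNIV. square (\<lambda>l. ?v s l x))" for x
      unfolding sum.cartesian_product UNIV_Times_UNIV by (simp add: case_prod_unfold)
    moreover have "0 \<le> pair T (\<lambda>x. (4 / 2 ^ ?p * g (?q x)) *\<^sub>R (\<Sum>s\<in>UNIV. square (\<lambda>l. ?v s l x)) ^ ?p)"
    proof (rule pair_nonneg_sum_of_squares_power[OF T])
      show "test_fun (\<lambda>x. 4 / 2 ^ ?p * g (?q x))"
        by (rule test_fun_cmult[OF test_g])
      show "0 \<le> 4 / 2 ^ ?p * g (?q x)" for x
        using m by (simp add: g_def flat'_nonneg)
      show "smooth (?v s l)" for s l
        by (cases s) (auto intro!: smooth_diff smooth_mult)
    qed
    ultimately show ?thesis by simp
  qed
  ultimately have "0 \<le> pair T (\<lambda>x. (4 * g (?q x) * \<tau> x - 2 * real ?p * h (?q x)) *\<^sub>R kaehler ^ ?p)"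
    unfolding decomposition[symmetric] by (subst pair_add[where T = T, OF TD test_pF test_sq]) simp
  also have "\<dots> = \<sigma> (\<lambda>x. (4 * m * real ?p) * (\<tau> x * flat' (c - m * \<tau> x)) + (- 2 * real ?p) * flat 1 (c - m * \<tau> x))"
  proof -
    have "4 * g (?q x) * \<tau> x - 2 * real ?p * h (?q x) =
        (4 * m * real ?p) * (\<tau> x * flat' (c - m * \<tau> x)) + (- 2 * real ?p) * flat 1 (c - m * \<tau> x)" for x
      by (simp add: g_def h_def \<tau>_def algebra_simps)
    then show ?thesis
      unfolding \<sigma>_def by simp
  qed
  also have "\<dots> = (4 * m * real ?p) * \<sigma> (\<lambda>x. \<tau> x * flat' (c - m * \<tau> x)) + (- 2 * real ?p) * \<sigma> (\<lambda>x. flat 1 (c - m * \<tau> x))"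
  proof -
    have \<sigma>: "positive_functional \<sigma>"
      unfolding \<sigma>_def by (rule positive_functional_beta_power[OF T])
    have 1: "test_fun (\<lambda>x. flat 1 (c - m * \<tau> x))"
      using test_h by (simp add: h_def \<tau>_def)
    have "test_fun (\<lambda>x. (?q x ^ ?p * (1 / (m * real ?p))) * g (?q x))"
      using test_g by (intro test_fun_mult smooth_mult smooth_power smooth_dist_sq smooth_const)
    then have 2: "test_fun (\<lambda>x. \<tau> x * flat' (c - m * \<tau> x))"
      using m by (simp add: g_def \<tau>_def mult_ac)
    show ?thesis
      using positive_functional_add[OF \<sigma> test_fun_cmult[OF 2] test_fun_cmult[OF 1]]
        positive_functional_cmult[OF \<sigma> 1] positive_functional_cmult[OF \<sigma> 2] by simp
  qed
  finally have "0 \<le> (2 * real ?p) * (2 * m * \<sigma> (\<lambda>x. \<tau> x * flat' (c - m * \<tau> x)) - \<sigma> (\<lambda>x. flat 1 (c - m * \<tau> x)))"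
    by (simp add: algebra_simps)
  then show ?thesis
    by (simp add: zero_le_mult_iff)
qed

section \<open>Monotonicity\<close>

text \<open>Differentiation under the integral sign by dominated convergence. For parameters above \<open>m / 2\<close> the integrands all vanish outside one
compact sublevel set of $\tau$, and on it the difference quotients are bounded by the Lipschitz constant of \<open>flat 1\<close>.\<close>

lemma DERIV_integral_flat:
  fixes M :: "(real ^ 'n::finite) measure" and \<tau> :: "real ^ 'n \<Rightarrow> real"
  assumes M: "sets M = sets borel" "\<And>K. compact K \<Longrightarrow> emeasure M K < \<infinity>"
    and \<tau>: "continuous_on UNIV \<tau>" "\<And>x. 0 \<le> \<tau> x" "\<And>b. compact {x. \<tau> x \<le> b}"
    and c: "0 < c" and m: "0 < m"
  shows "((\<lambda>m. \<integral>x. flat 1 (c - m * \<tau> x) \<partial>M) has_real_derivative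
     - (\<integral>x. \<tau> x * flat' (c - m * \<tau> x) \<partial>M)) (at m)"
proof -
  define K where "K = {x. \<tau> x \<le> 2 * c / m}"
  have K: "compact K" unfolding K_def by (rule \<tau>(3))
  have outside: "flat 1 (c - m' * \<tau> x) = 0" if "m / 2 \<le> m'" "x \<notin> K" for m' x
  proof -
    have "c < m / 2 * \<tau> x" using that(2) m by (simp add: K_def field_simps)
    also have "\<dots> \<le> m' * \<tau> x" using that(1) \<tau>(2) by (rule mult_right_mono)
    finally show ?thesis by simp
  qed
  have meas: "f \<in> borel_measurable M" if "continuous_on UNIV f" for f :: "real ^ 'n \<Rightarrow> real"
    using borel_measurable_continuous_onI[OF that] measurable_cong_sets[OF M(1) refl] by blast
  have cont: "continuous_on UNIV (\<lambda>x. flat P (c - m' * \<tau> x))" for P m'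
  proof (rule continuous_on_compose2[of UNIV "flat P"])
    show "continuous_on UNIV (flat P)"
      using DERIV_isCont[OF flat_DERIV] by (intro continuous_at_imp_continuous_on) blast
    show "continuous_on UNIV (\<lambda>x. c - m' * \<tau> x)"
      by (intro continuous_on_diff continuous_on_mult continuous_on_const \<tau>(1))
  qed simp
  have K_sets: "K \<in> sets M" using K by (simp add: M(1) borel_compact)
  have int_K: "integrable M (indicat_real K)"
    using K_sets M(2)[OF K] by (rule integrable_real_indicator)
  have int: "integrable M (\<lambda>x. flat 1 (c - m' * \<tau> x))" if "m / 2 \<le> m'" for m'
    by (rule integrableI_bounded_set[OF K_sets meas[OF cont] M(2)[OF K], of _ _ 1]) (use outside[OF that] in auto)
  let ?D = "\<lambda>m' x. (flat 1 (c - m' * \<tau> x) - flat 1 (c - m * \<tau> x)) / (m' - m)"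
  have "((\<lambda>m'. ((\<integral>x. flat 1 (c - m' * \<tau> x) \<partial>M) - (\<integral>x. flat 1 (c - m * \<tau> x) \<partial>M)) / (m' - m)) \<longlongrightarrow>
      - (\<integral>x. \<tau> x * flat' (c - m * \<tau> x) \<partial>M)) (at m within {m / 2 <..})"
    unfolding tendsto_at_iff_sequentially
  proof (intro allI impI)
    fix X :: "nat \<Rightarrow> real" assume X: "\<forall>i. X i \<in> {m / 2<..} - {m}" and lim: "X \<longlonglongrightarrow> m"
    have limit: "(\<lambda>i. \<integral>x. ?D (X i) x \<partial>M) \<longlonglongrightarrow> (\<integral>x. - (\<tau> x * flat' (c - m * \<tau> x)) \<partial>M)"
    proof (rule integral_dominated_convergence[where w = "\<lambda>x. 4 * (2 * c / m) * indicat_real K x"])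
      show "integrable M (\<lambda>x. 4 * (2 * c / m) * indicat_real K x)"
        by (intro integrable_mult_right int_K)
      show "AE x in M. (\<lambda>i. ?D (X i) x) \<longlonglongrightarrow> - (\<tau> x * flat' (c - m * \<tau> x))"
      proof (rule AE_I2)
        fix x
        have "((\<lambda>m'. c - m' * \<tau> x) has_real_derivative - \<tau> x) (at m)"
          by (auto intro!: derivative_eq_intros)
        from DERIV_chain2[OF flat_1_DERIV this]
        have "((\<lambda>m'. flat 1 (c - m' * \<tau> x)) has_real_derivative - (\<tau> x * flat' (c - m * \<tau> x))) (at m)"
          by (simp add: mult.commute)
        then have "((\<lambda>m'. ?D m' x) \<longlongrightarrow> - (\<tau> x * flat' (c - m * \<tau> x))) (at m)"
          by (simp add: has_field_derivative_iff)
        then show "(\<lambda>i. ?D (X i) x) \<longlonglongrightarrow> - (\<tau> x * flat' (c - m * \<tau> x))"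
          using X lim unfolding tendsto_at_iff_sequentially by (auto simp: o_def)
      qed
      show "AE x in M. norm (?D (X i) x) \<le> 4 * (2 * c / m) * indicat_real K x" for i
      proof (rule AE_I2)
        fix x
        have Xi: "m / 2 \<le> X i" "X i \<noteq> m" using X[rule_format, of i] by auto
        show "norm (?D (X i) x) \<le> 4 * (2 * c / m) * indicat_real K x"
        proof (cases "x \<in> K")
          case True
          have "\<bar>flat 1 (c - X i * \<tau> x) - flat 1 (c - m * \<tau> x)\<bar> \<le> 4 * \<bar>(c - X i * \<tau> x) - (c - m * \<tau> x)\<bar>"
            by (rule flat_1_lipschitz)
          also have "(c - X i * \<tau> x) - (c - m * \<tau> x) = - ((X i - m) * \<tau> x)"
            by (simp add: algebra_simps)
          finally have "\<bar>flat 1 (c - X i * \<tau> x) - flat 1 (c - m * \<tau> x)\<bar> \<le> 4 * \<tau> x * \<bar>X i - m\<bar>"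
            using \<tau>(2)[of x] by (simp add: abs_mult mult_ac)
          then have "norm (?D (X i) x) \<le> 4 * \<tau> x"
            using Xi by (simp add: abs_divide pos_divide_le_eq)
          also have "\<dots> \<le> 4 * (2 * c / m)" using True by (simp add: K_def)
          finally show ?thesis using True by simp
        next
          case False
          then show ?thesis using Xi m outside[of "X i" x] outside[of m x] by simp
        qed
      qed
      show "(\<lambda>x. - (\<tau> x * flat' (c - m * \<tau> x))) \<in> borel_measurable M"
        by (intro meas continuous_on_minus continuous_on_mult cont \<tau>(1))
      show "?D (X i) \<in> borel_measurable M" for i
        by (intro borel_measurable_divide borel_measurable_diff borel_measurable_const meas cont)
    qed
    have quotient: "(\<integral>x. ?D (X i) x \<partial>M) =
        ((\<integral>x. flat 1 (c - X i * \<tau> x) \<partial>M) - (\<integral>x. flat 1 (c - m * \<tau> x) \<partial>M)) / (X i - m)" for i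
      using int[of "X i"] int[of m] X[rule_format, of i] m by simp
    show "((\<lambda>m'. ((\<integral>x. flat 1 (c - m' * \<tau> x) \<partial>M) - (\<integral>x. flat 1 (c - m * \<tau> x) \<partial>M)) / (m' - m)) \<circ> X)
        \<longlonglongrightarrow> - (\<integral>x. \<tau> x * flat' (c - m * \<tau> x) \<partial>M)"
      using limit unfolding quotient by (simp add: o_def)
  qed
  moreover have "at m within {m / 2<..} = at m"
    using m by (intro at_within_open) auto
  ultimately show ?thesis
    by (simp add: has_field_derivative_iff)
qed

lemma compact_dist_sq_power_le: "compact {x :: real ^ 'n::finite. dist_sq a x ^ Suc k \<le> b}"
proof -
  have "{x. dist_sq a x ^ Suc k \<le> b} \<subseteq> cball a (max 1 b)"
  proof
    fix x assume x: "x \<in> {x. dist_sq a x ^ Suc k \<le> b}"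
    show "x \<in> cball a (max 1 b)"
    proof (cases "dist a x \<le> 1")
      case False
      then have "dist a x ^ 1 \<le> dist a x ^ (2 * Suc k)"
        by (intro power_increasing) auto
      also have "\<dots> = dist_sq a x ^ Suc k"
        by (simp only: dist_sq power_mult)
      finally show ?thesis using x by simp
    qed simp
  qed
  then have "bounded {x. dist_sq a x ^ Suc k \<le> b}"
    using bounded_cball bounded_subset by blast
  moreover have "closed {x. dist_sq a x ^ Suc k \<le> b}"
    by (intro closed_Collect_le continuous_on_const continuous_on_power smooth_continuous smooth_dist_sq)
  ultimately show ?thesis
    by (simp add: compact_eq_bounded_closed)
qed

text \<open>The derivative of $\sqrt m\, G(m)$ is $(G(m) + 2 m G'(m)) / (2 \sqrt m)$, and \<open>radial_inequality\<close> says that the numerator is not positive.\<close>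

lemma sqrt_integral_decreasing:
  fixes T :: "'n::{finite,linorder} current" and a :: "real ^ 'n::{finite,linorder}"
  assumes T: "weakly_positive (Suc k) T"
    and conv: "convex_current 1 (T \<and>\<^sub>c wedge_power beta k)"
    and M: "represents M (\<lambda>f. pair T (\<lambda>x. f x *\<^sub>R kaehler ^ Suc k))"
    and c: "c > 0" and m: "0 < m" "m \<le> m'"
  defines "G \<equiv> \<lambda>m. \<integral>x. flat 1 (c - m * dist_sq a x ^ Suc k) \<partial>M"
  shows "sqrt m' * G m' \<le> sqrt m * G m"
proof (rule DERIV_nonpos_imp_nonincreasing[OF m(2), of "\<lambda>m. sqrt m * G m"])
  fix s assume "m \<le> s" "s \<le> m'"
  then have s: "s > 0" using m(1) by simp
  let ?\<tau> = "\<lambda>x. dist_sq a x ^ Suc k"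
  let ?I = "\<integral>x. ?\<tau> x * flat' (c - s * ?\<tau> x) \<partial>M"
  have borel: "sets M = sets borel" "\<And>K. compact K \<Longrightarrow> emeasure M K < \<infinity>"
    using M by (auto simp: represents_def)
  have "(G has_real_derivative - ?I) (at s)"
    unfolding G_def
  proof (rule DERIV_integral_flat[OF borel _ _ compact_dist_sq_power_le c s])
    show "continuous_on UNIV ?\<tau>"
      by (intro continuous_on_power smooth_continuous smooth_dist_sq)
    show "0 \<le> ?\<tau> x" for x
      by (simp only: dist_sq zero_le_power zero_le_power2)
  qed
  from DERIV_mult[OF DERIV_real_sqrt[OF s] this]
  have deriv: "((\<lambda>m. sqrt m * G m) has_real_derivative inverse (sqrt s) / 2 * G s - ?I * sqrt s) (at s)"
    by (rule DERIV_cong) simp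
  have arg: "smooth (\<lambda>x. c - s * ?\<tau> x)"
    by (intro smooth_diff smooth_mult smooth_power smooth_const smooth_dist_sq)
  have zero: "c - s * ?\<tau> x \<le> 0" if "x \<notin> {x. ?\<tau> x \<le> c / s}" for x
    using that s by (simp add: field_simps)
  have test1: "test_fun (\<lambda>x. flat 1 (c - s * ?\<tau> x))"
    by (rule test_funI[OF smooth_flat[OF arg] compact_dist_sq_power_le[of a k "c / s"]])
       (rule flat_nonpos[OF zero])
  have test2: "test_fun (\<lambda>x. ?\<tau> x * flat' (c - s * ?\<tau> x))"
  proof (rule test_funI[OF _ compact_dist_sq_power_le[of a k "c / s"]])
    show "smooth (\<lambda>x. ?\<tau> x * flat' (c - s * ?\<tau> x))"
      by (intro smooth_mult smooth_power smooth_dist_sq smooth_flat arg)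
    show "?\<tau> x * flat' (c - s * ?\<tau> x) = 0" if "x \<notin> {x. ?\<tau> x \<le> c / s}" for x
      using flat_nonpos[OF zero[OF that]] by simp
  qed
  have eq: "pair T (\<lambda>x. f x *\<^sub>R kaehler ^ Suc k) = integral\<^sup>L M f" if "test_fun f" for f
    using M that unfolding represents_def by blast
  have "G s \<le> 2 * s * ?I"
    using radial_inequality[OF T conv c s, of a] unfolding eq[OF test1] eq[OF test2] G_def .
  then have "inverse (sqrt s) / 2 * G s \<le> inverse (sqrt s) / 2 * (2 * s * ?I)"
    using s by (intro mult_left_mono) auto
  also have "\<dots> = ?I * (inverse (sqrt s) * s)"
    by simp
  also have "inverse (sqrt s) * s = sqrt s"
    using s real_div_sqrt[of s] by (simp add: divide_inverse mult.commute)
  finally show "\<exists>y. ((\<lambda>m. sqrt m * G m) has_real_derivative y) (at s) \<and> y \<le> 0"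
    by (intro exI[of _ "inverse (sqrt s) / 2 * G s - ?I * sqrt s"] conjI deriv) linarith
qed

lemma integral_tendsto_ball_measure:
  fixes a :: "real ^ 'n::finite"
  assumes M: "sets M = sets borel" "\<And>K. compact K \<Longrightarrow> emeasure M K < \<infinity>" and r: "r > 0" and p: "p > 0"
  shows "(\<lambda>k. \<integral>x. flat 1 (real k - real k / r ^ (2 * p) * dist_sq a x ^ p) \<partial>M) \<longlonglongrightarrow> measure M (ball a r)"
proof -
  have sets: "ball a r \<in> sets M" "cball a r \<in> sets M" by (simp_all add: M(1))
  have power: "dist_sq a x ^ p = dist a x ^ (2 * p)" for x
    by (simp only: dist_sq power_mult)
  have factor: "real k - real k / r ^ (2 * p) * dist_sq a x ^ p = real k * (1 - (dist a x / r) ^ (2 * p))" for k x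
    by (simp add: power power_divide algebra_simps)
  have inside: "0 < 1 - (dist a x / r) ^ (2 * p)" if "x \<in> ball a r" for x
    using that r p by (simp add: power_less_one_iff)
  have outside: "flat 1 (real k * (1 - (dist a x / r) ^ (2 * p))) = 0" if "x \<notin> ball a r" for x k
    using that r by (intro flat_nonpos) (simp add: mult_nonneg_nonpos one_le_power)
  have "(\<lambda>k. \<integral>x. flat 1 (real k * (1 - (dist a x / r) ^ (2 * p))) \<partial>M) \<longlonglongrightarrow> (\<integral>x. indicat_real (ball a r) x \<partial>M)"
  proof (rule integral_dominated_convergence[where w = "indicat_real (cball a r)"])
    show "integrable M (indicat_real (cball a r))"
      using sets M(2)[OF compact_cball] by (intro integrable_real_indicator)
    show "AE x in M. (\<lambda>k. flat 1 (real k * (1 - (dist a x / r) ^ (2 * p)))) \<longlonglongrightarrow> indicat_real (ball a r) x"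
    proof (rule AE_I2)
      show "(\<lambda>k. flat 1 (real k * (1 - (dist a x / r) ^ (2 * p)))) \<longlonglongrightarrow> indicat_real (ball a r) x" for x
        by (cases "x \<in> ball a r") (use tendsto_flat_1[OF inside] outside in \<open>simp_all del: mem_ball\<close>)
    qed
    show "AE x in M. norm (flat 1 (real k * (1 - (dist a x / r) ^ (2 * p)))) \<le> indicat_real (cball a r) x" for k
    proof (rule AE_I2)
      show "norm (flat 1 (real k * (1 - (dist a x / r) ^ (2 * p)))) \<le> indicat_real (cball a r) x" for x
        using outside[of x k] by (cases "x \<in> ball a r") (auto simp: indicator_def)
    qed
    show "(\<lambda>x. flat 1 (real k * (1 - (dist a x / r) ^ (2 * p)))) \<in> borel_measurable M" for k
    proof -
      have "smooth (\<lambda>x. flat 1 (real k - real k / r ^ (2 * p) * dist_sq a x ^ p))"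
        by (intro smooth_flat smooth_diff smooth_mult smooth_const smooth_power smooth_dist_sq)
      from borel_measurable_continuous_onI[OF smooth_continuous[OF this]] show ?thesis
        unfolding factor using measurable_cong_sets[OF M(1) refl] by blast
    qed
  qed (use sets in simp)
  then show ?thesis
    unfolding factor using sets by simp
qed

lemma mono_on_tendsto_at_right_0:
  fixes f :: "real \<Rightarrow> real"
  assumes mono: "mono_on {0<..} f" and nonneg: "\<And>r. r > 0 \<Longrightarrow> 0 \<le> f r"
  shows "(f \<longlongrightarrow> (INF r\<in>{0<..}. f r)) (at_right 0)"
proof (rule order_tendstoI)
  have bdd: "bdd_below (f ` {0<..})"
    using nonneg by (intro bdd_belowI[of _ 0]) auto
  show "\<forall>\<^sub>F r in at_right 0. y < f r" if "y < (INF r\<in>{0<..}. f r)" for y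
    using eventually_at_right_less[of "0 :: real"]
  proof eventually_elim
    case (elim r)
    then show ?case using that cINF_lower[OF bdd, of r] by simp
  qed
  show "\<forall>\<^sub>F r in at_right 0. f r < y" if y: "(INF r\<in>{0<..}. f r) < y" for y
  proof -
    obtain s where s: "s > 0" "f s < y"
      using y bdd by (subst (asm) cINF_less_iff) auto
    have "\<forall>\<^sub>F r in at_right 0. r \<in> {0<..<s}"
      using s(1) by (rule eventually_at_right_real)
    then show ?thesis
    proof eventually_elim
      case (elim r)
      then have "f r \<le> f s" by (intro mono_onD[OF mono]) (use s in auto)
      then show ?case using s(2) by simp
    qed
  qed
qed

theorem corollary2:
  fixes T :: "'n::{finite,linorder} current" and a :: "real ^ 'n::{finite,linorder}" and p :: nat
  assumes "1 \<le> p"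
    and "weakly_positive p T"
    and "convex_current 1 (T \<and>\<^sub>c wedge_power beta (p - 1))"
  shows "(\<forall>r>0. 0 \<le> nu p T a r) \<and>
         mono_on {0<..} (nu p T a) \<and>
         (nu p T a \<longlongrightarrow> lelong_number p T a) (at_right 0)"
proof -
  obtain k where p: "p = Suc k"
    using assms(1) by (cases p) auto
  have T: "weakly_positive (Suc k) T" and conv: "convex_current 1 (T \<and>\<^sub>c wedge_power beta k)"
    using assms p by simp_all
  let ?u = "\<lambda>f. pair T (\<lambda>x. f x *\<^sub>R kaehler ^ p)"
  define M where "M = functional_measure ?u"
  have M: "represents M ?u"
    unfolding M_def p by (rule functional_measure_represents[OF positive_functional_beta_power[OF T]])
  have "top_distr (T \<and>\<^sub>c wedge_power beta p) = ?u"
    by (rule ext) (rule top_distr_wedge_power_beta)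
  moreover have "(THE \<mu>. represents \<mu> ?u) = M"
    by (rule the_equality, rule M, rule represents_unique[OF _ M])
  ultimately have nu: "nu p T a r = measure M (ball a r) / r ^ p" for r
    by (simp only: nu_def super_integral_def) simp
  have nonneg: "0 \<le> nu p T a r" if "r > 0" for r
    using that by (simp add: nu)
  have borel: "sets M = sets borel" "\<And>K. compact K \<Longrightarrow> emeasure M K < \<infinity>"
    using M by (auto simp: represents_def)
  have mono: "mono_on {0<..} (nu p T a)"
  proof (rule mono_onI)
    fix r s :: real assume "r \<in> {0<..}" "s \<in> {0<..}" "r \<le> s"
    then have r: "0 < r" and s: "0 < s" and rs: "r \<le> s" by auto
    (* the choice c = j, m = j / r^(2p) makes the prefactor sqrt m a fixed multiple of 1 / r^p *)
    let ?I = "\<lambda>r j. \<integral>x. flat 1 (real j - real j / r ^ (2 * p) * dist_sq a x ^ p) \<partial>M"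
    have "?I r j / r ^ p \<le> ?I s j / s ^ p" if j: "j > 0" for j :: nat
    proof -
      have "real j / s ^ (2 * p) \<le> real j / r ^ (2 * p)"
        using r s rs j by (intro divide_left_mono power_mono mult_pos_pos) auto
      then have "sqrt (real j / r ^ (2 * p)) * ?I r j \<le> sqrt (real j / s ^ (2 * p)) * ?I s j"
        using sqrt_integral_decreasing[OF T conv M[unfolded p], of "real j" "real j / s ^ (2 * p)"
            "real j / r ^ (2 * p)" a] j s
        by (simp only: p[symmetric] of_nat_0_less_iff zero_less_divide_iff zero_less_power simp_thms)
      moreover have "sqrt (real j / t ^ (2 * p)) = sqrt (real j) * (1 / t ^ p)" if "t > 0" for t
      proof -
        have "t ^ (2 * p) = (t ^ p)\<^sup>2" by (simp add: power_mult[symmetric] mult.commute)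
        then show ?thesis using that by (simp add: real_sqrt_divide)
      qed
      ultimately have "sqrt (real j) * (?I r j / r ^ p) \<le> sqrt (real j) * (?I s j / s ^ p)"
        using r s by (simp only: mult.assoc times_divide_eq_left mult_1_left times_divide_eq_right)
      then show ?thesis
        using j by (simp only: mult_le_cancel_left_pos real_sqrt_gt_0_iff of_nat_0_less_iff)
    qed
    then have le: "\<forall>\<^sub>F j in sequentially. ?I r j / r ^ p \<le> ?I s j / s ^ p"
      by (rule eventually_mono[OF eventually_gt_at_top[of 0]])
    have limit: "(\<lambda>j. ?I t j / t ^ p) \<longlonglongrightarrow> measure M (ball a t) / t ^ p" if t: "t > 0" for t
    proof (rule tendsto_divide[OF _ tendsto_const])
      show "(\<lambda>j. ?I t j) \<longlonglongrightarrow> measure M (ball a t)"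
        by (rule integral_tendsto_ball_measure[OF borel t]) (simp_all add: p)
    qed (use t in simp)
    show "nu p T a r \<le> nu p T a s"
      unfolding nu by (rule tendsto_le[OF sequentially_bot limit[OF s] limit[OF r] le])
  qed
  have "(nu p T a \<longlongrightarrow> (INF r\<in>{0<..}. nu p T a r)) (at_right 0)"
    by (rule mono_on_tendsto_at_right_0[OF mono nonneg])
  then have "(nu p T a \<longlongrightarrow> lelong_number p T a) (at_right 0)"
    unfolding lelong_number_def by (subst tendsto_Lim[OF trivial_limit_at_right_real])
  then show ?thesis
    using nonneg mono by blast
qed

end
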